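(* For a finitely generated group $G$, the following are equivalent: (1) $G$ admits a digraphical regular representation (DRR); (2) $G$ admits a finite degree DRR, i.e. a DRR given by a finite generating set; (3) $G$ is not isomorphic to the quaternion group $Q_8$ of order $8$, nor to any of $(\mathbf{Z}/2\mathbf{Z})^2$, $(\mathbf{Z}/2\mathbf{Z})^3$, $(\mathbf{Z}/2\mathbf{Z})^4$, $(\mathbf{Z}/3\mathbf{Z})^2$.
   Context: Given a group $G$ and a (not necessarily symmetric, possibly infinite) generating set $S\subseteq G\setminus\{1\}$, the Cayley digraph $\overrightarrow{\mathrm{Cay}}(G,S)$ is the directed graph with vertex set $G$ and with an arc (directed edge) from $g$ to $h$ if and only if $g^{-1}h\in S$. A Cayley digraph of $G$ whose automorphism group (as a digraph) acts freely on its vertex set is called a digraphical regular representation (DRR) of $G$. *)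

theory Defs
  imports "HOL-Algebra.Algebra" "HOL-Algebra.Product_Groups" "HOL-Algebra.Group_Action"
    "Graph_Theory.Pair_Digraph"
begin

section \<open>Generating sets\<close>

definition generating_set :: "('a, 'b) monoid_scheme \<Rightarrow> 'a set \<Rightarrow> bool" where
  "generating_set G S \<longleftrightarrow> S \<subseteq> carrier G \<and> generate G S = carrier G"

definition finitely_generated :: "('a, 'b) monoid_scheme \<Rightarrow> bool" where
  "finitely_generated G \<longleftrightarrow> (\<exists>S. finite S \<and> generating_set G S)"


section \<open>Digraph automorphisms\<close>

text \<open>The arcs of a \<^typ>\<open>'a pair_pre_digraph\<close> are a set of ordered pairs of vertices, so an
  automorphism is determined by its action on vertices. Elements of \<^const>\<open>Bij\<close> are
  \<^const>\<open>undefined\<close> outside the vertex set, so equality of automorphisms is equality of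
  functions.\<close>

definition digraph_aut :: "'a pair_pre_digraph \<Rightarrow> ('a \<Rightarrow> 'a) set" where
  "digraph_aut D = {f \<in> Bij (pverts D).
     \<forall>u \<in> pverts D. \<forall>v \<in> pverts D. (f u, f v) \<in> parcs D \<longleftrightarrow> (u, v) \<in> parcs D}"

definition digraph_aut_group :: "'a pair_pre_digraph \<Rightarrow> ('a \<Rightarrow> 'a) monoid" where
  "digraph_aut_group D = BijGroup (pverts D) \<lparr>carrier := digraph_aut D\<rparr>"

definition acts_freely ::
    "('g, 'b) monoid_scheme \<Rightarrow> 'a set \<Rightarrow> ('g \<Rightarrow> 'a \<Rightarrow> 'a) \<Rightarrow> bool" where
  "acts_freely G E \<phi> \<longleftrightarrow> group_action G E \<phi> \<and> (\<forall>x \<in> E. stabilizer G \<phi> x = {\<one>\<^bsub>G\<^esub>})"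

lemma subgroup_digraph_aut: "subgroup (digraph_aut D) (BijGroup (pverts D))"
proof -
  let ?V = "pverts D" and ?B = "BijGroup (pverts D)"
  interpret group ?B by (rule group_BijGroup)
  have mem: "f v \<in> ?V" if "f \<in> Bij ?V" "v \<in> ?V" for f v
    using that by (auto simp: Bij_def bij_betw_def)
  show ?thesis
  proof (rule subgroupI)
    show "digraph_aut D \<subseteq> carrier ?B" by (auto simp: digraph_aut_def BijGroup_def)
    have "(\<lambda>x\<in>?V. x) \<in> digraph_aut D" by (simp add: digraph_aut_def id_Bij)
    then show "digraph_aut D \<noteq> {}" by blast
  next
    fix f assume f: "f \<in> digraph_aut D"
    then have fB: "f \<in> Bij ?V" by (simp add: digraph_aut_def)
    have bij: "bij_betw f ?V ?V" using fB by (simp add: Bij_def)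
    let ?g = "\<lambda>x\<in>?V. inv_into ?V f x"
    have gm: "?g v \<in> ?V" and fg: "f (?g v) = v" if "v \<in> ?V" for v
      using that bij by (auto simp: bij_betw_def inv_into_into f_inv_into_f)
    have "(?g u, ?g v) \<in> parcs D \<longleftrightarrow> (u, v) \<in> parcs D" if "u \<in> ?V" "v \<in> ?V" for u v
    proof -
      have "(f (?g u), f (?g v)) \<in> parcs D \<longleftrightarrow> (?g u, ?g v) \<in> parcs D"
        using f gm[OF that(1)] gm[OF that(2)] unfolding digraph_aut_def by blast
      then show ?thesis using fg that by simp
    qed
    moreover have "?g \<in> Bij ?V" by (rule restrict_inv_into_Bij[OF fB])
    ultimately have "?g \<in> digraph_aut D" unfolding digraph_aut_def by blast
    then show "inv\<^bsub>?B\<^esub> f \<in> digraph_aut D" by (simp add: inv_BijGroup[OF fB])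
  next
    fix f g assume f: "f \<in> digraph_aut D" and g: "g \<in> digraph_aut D"
    then have B: "f \<in> Bij ?V" "g \<in> Bij ?V" by (auto simp: digraph_aut_def)
    have "compose ?V f g \<in> digraph_aut D"
      using f g B mem[OF B(2)] by (simp add: digraph_aut_def compose_Bij compose_eq)
    then show "f \<otimes>\<^bsub>?B\<^esub> g \<in> digraph_aut D" using B by (simp add: BijGroup_def)
  qed
qed

lemma group_action_digraph_aut: "group_action (digraph_aut_group D) (pverts D) (\<lambda>f. f)"
proof -
  interpret B: group "BijGroup (pverts D)" by (rule group_BijGroup)
  have "group (digraph_aut_group D)"
    unfolding digraph_aut_group_def by (rule B.subgroup_imp_group[OF subgroup_digraph_aut])
  moreover have "(\<lambda>f. f) \<in> hom (digraph_aut_group D) (BijGroup (pverts D))"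
    using subgroup.subset[OF subgroup_digraph_aut]
    by (auto simp: hom_def digraph_aut_group_def)
  ultimately show ?thesis
    by (simp add: group_action_def group_hom_def group_hom_axioms_def B.is_group)
qed


section \<open>Cayley digraphs and digraphical regular representations\<close>

definition cayley_digraph :: "('a, 'b) monoid_scheme \<Rightarrow> 'a set \<Rightarrow> 'a pair_pre_digraph" where
  "cayley_digraph G S = \<lparr>pverts = carrier G,
     parcs = {(g, h). g \<in> carrier G \<and> h \<in> carrier G \<and> inv\<^bsub>G\<^esub> g \<otimes>\<^bsub>G\<^esub> h \<in> S}\<rparr>"

definition is_DRR :: "('a, 'b) monoid_scheme \<Rightarrow> 'a set \<Rightarrow> bool" where
  "is_DRR G S \<longleftrightarrow> generating_set G S \<and> \<one>\<^bsub>G\<^esub> \<notin> S \<and>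
     acts_freely (digraph_aut_group (cayley_digraph G S)) (pverts (cayley_digraph G S)) (\<lambda>f. f)"

definition admits_DRR :: "('a, 'b) monoid_scheme \<Rightarrow> bool" where
  "admits_DRR G \<longleftrightarrow> (\<exists>S. is_DRR G S)"

definition admits_finite_degree_DRR :: "('a, 'b) monoid_scheme \<Rightarrow> bool" where
  "admits_finite_degree_DRR G \<longleftrightarrow> (\<exists>S. finite S \<and> is_DRR G S)"


section \<open>The exceptional groups\<close>

definition cyclic_power :: "nat \<Rightarrow> nat \<Rightarrow> (nat \<Rightarrow> int) monoid" where
  "cyclic_power m n = product_group {..<n} (\<lambda>_. integer_mod_group m)"

datatype quat_unit = Q1 | Qi | Qj | Qk

text \<open>The product of two quaternion units, with a flag that is \<^const>\<open>True\<close> iff the sign of the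
  product is negative.\<close>

fun quat_unit_mult :: "quat_unit \<Rightarrow> quat_unit \<Rightarrow> bool \<times> quat_unit" where
  "quat_unit_mult Q1 y = (False, y)"
| "quat_unit_mult x Q1 = (False, x)"
| "quat_unit_mult Qi Qi = (True, Q1)"
| "quat_unit_mult Qi Qj = (False, Qk)"
| "quat_unit_mult Qi Qk = (True, Qj)"
| "quat_unit_mult Qj Qi = (True, Qk)"
| "quat_unit_mult Qj Qj = (True, Q1)"
| "quat_unit_mult Qj Qk = (False, Qi)"
| "quat_unit_mult Qk Qi = (False, Qj)"
| "quat_unit_mult Qk Qj = (True, Qi)"
| "quat_unit_mult Qk Qk = (True, Q1)"

text \<open>The pair \<open>(s, u)\<close> stands for \<open>-u\<close> if \<open>s\<close> and for \<open>u\<close> otherwise; signs multiply by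
  exclusive or, which is \<open>\<noteq>\<close> on \<^typ>\<open>bool\<close>.\<close>

definition quaternion_group :: "(bool \<times> quat_unit) monoid" where
  "quaternion_group = \<lparr>carrier = UNIV,
     monoid.mult = (\<lambda>(s, x) (t, y). case quat_unit_mult x y of (r, z) \<Rightarrow> ((s \<noteq> t) \<noteq> r, z)),
     one = (False, Q1)\<rparr>"

lemma group_quaternion_group: "group quaternion_group"
proof (rule groupI)
  fix x y z
  show "x \<otimes>\<^bsub>quaternion_group\<^esub> y \<otimes>\<^bsub>quaternion_group\<^esub> z
      = x \<otimes>\<^bsub>quaternion_group\<^esub> (y \<otimes>\<^bsub>quaternion_group\<^esub> z)"
    by (cases x; cases y; cases z; rename_tac s a t b r c; case_tac a; case_tac b; case_tac c)
      (simp_all add: quaternion_group_def, auto)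
next
  fix x
  show "\<one>\<^bsub>quaternion_group\<^esub> \<otimes>\<^bsub>quaternion_group\<^esub> x = x"
    by (cases x) (simp add: quaternion_group_def)
next
  fix x :: "bool \<times> quat_unit"
  obtain s a where x: "x = (s, a)" by (cases x)
  have "(if a = Q1 then s else \<not> s, a) \<otimes>\<^bsub>quaternion_group\<^esub> x = \<one>\<^bsub>quaternion_group\<^esub>"
    unfolding x by (cases a) (simp_all add: quaternion_group_def)
  then show "\<exists>y\<in>carrier quaternion_group. y \<otimes>\<^bsub>quaternion_group\<^esub> x = \<one>\<^bsub>quaternion_group\<^esub>"
    by (rule bexI) (simp add: quaternion_group_def)
qed (auto simp: quaternion_group_def)

lemma order_quaternion_group: "order quaternion_group = 8"
proof -
  have units: "(UNIV :: quat_unit set) = {Q1, Qi, Qj, Qk}" by (auto intro: quat_unit.exhaust)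
  have "card (UNIV :: quat_unit set) = 4" unfolding units by simp
  then have "card (UNIV :: (bool \<times> quat_unit) set) = 8"
    by (simp add: card_cartesian_product flip: UNIV_Times_UNIV)
  then show ?thesis by (simp add: order_def quaternion_group_def)
qed

end

theory Submission
  imports Defs
begin

text \<open>The elements fixed by all automorphisms of a Cayley digraph that fix the identity form a subgroup,
  and the digraph is a DRR if this subgroup is the whole group. The subsets preserved by these
  automorphisms are closed under Boolean operations and under conditions on the arcs between them,
  so small connection sets can be analysed by looking at products inside the connection set.

  A finite subgroup \<open>K\<close> with a small rigid set \<open>T\<close> also has the large rigid set \<open>D = K - {\<one>} - T\<close>. In
  \<open>D \<union> {x}\<close> with \<open>x \<notin> K\<close> the elements of \<open>D\<close> have in-neighbours and \<open>x\<close> has none, so \<open>D \<union> {x}\<close> is rigid in the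
  group generated by \<open>K\<close> and \<open>x\<close>, and the argument can be repeated as long as this group is finite. As
  soon as it is an infinite group \<open>H\<close>, all missing generators \<open>x\<close> can be added at once in the form
  \<open>x \<otimes> u\<close>, for triples of elements \<open>u \<in> H\<close> that are chosen generically and recognised up to left translation.
  The same works if \<open>H\<close> is an infinite subgroup generated by two elements \<open>a\<close> and \<open>b\<close>, starting from
  the set of \<open>a\<close>, \<open>b\<close> and \<open>a \<otimes> b\<close>. If all pairs of elements generate finite subgroups and none of the small rigid
  sets occurs, then the group is cyclic, quaternion, symmetric of degree three, an elementary abelian
  2-group or \<open>\<int>\<^sub>3\<^sup>2\<close>.

  Conversely, every subset of an exceptional group is preserved by a nontrivial automorphism. For
  \<open>\<int>\<^sub>2\<^sup>n\<close> this follows by counting bases, as there are only 6435 subsets of cardinality 7 but 20160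
  bases if \<open>n = 4\<close>.\<close>

subsection \<open>Automorphisms fixing the identity and their invariant sets\<close>

text \<open>An automorphism that fixes the identity need not preserve a subgroup K, so rigidity
  inside K says nothing by itself about an overgroup. Complements repair this: if |K| \<ge> 2|T| + 4
  then every element of K is a product of two elements of D, so whatever preserves D preserves K and
  restricts to an automorphism of the complementary digraph on K. The same inequality is the origin
  of the numerical bounds: sets of two, three, four, six and twelve elements require order at least
  8, 10, 12, 16 and 28, and smaller groups have to be analysed by hand. The quaternion group
  survives because x, y and xy form a directed triangle there, which can be rotated. Asymmetry
  enters only at the passage to an infinite group; in exponent two no set has it, but finitely
  generated groups of exponent two are finite. Counting bases fails for the group of order 9, where
  up to 70 subsets of one size face only 48 bases; this group and the quaternion group are settled
  by explicit lists of automorphisms.\<close>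

context group
begin

text \<open>Unlike the elements of \<open>Bij\<close>, these maps are arbitrary outside
  \<open>K\<close>; hence rigidity is expressed pointwise on \<open>K\<close> and not as equality of
  functions.\<close>

definition aut1 :: "'a set \<Rightarrow> 'a set \<Rightarrow> ('a \<Rightarrow> 'a) set" where
  "aut1 K S = {f. bij_betw f K K \<and> f \<one> = \<one> \<and>
     (\<forall>a\<in>K. \<forall>b\<in>K. inv (f a) \<otimes> f b \<in> S \<longleftrightarrow> inv a \<otimes> b \<in> S)}"

text \<open>Inclusion suffices even for infinite \<open>P\<close>, because \<open>aut1 K S\<close>
  is closed under inverses.\<close>

definition invar :: "'a set \<Rightarrow> 'a set \<Rightarrow> 'a set \<Rightarrow> bool" where
  "invar K S P \<longleftrightarrow> P \<subseteq> K \<and> (\<forall>f\<in>aut1 K S. f ` P \<subseteq> P)"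

definition fixd :: "'a set \<Rightarrow> 'a set \<Rightarrow> 'a set" where
  "fixd K S = {g \<in> K. \<forall>f\<in>aut1 K S. f g = g}"

definition rigid :: "'a set \<Rightarrow> 'a set \<Rightarrow> bool" where
  "rigid K S \<longleftrightarrow> (\<forall>f\<in>aut1 K S. \<forall>a\<in>K. f a = a)"

lemma m_inv_cancel [simp]:
  assumes "a \<in> carrier G" "b \<in> carrier G"
  shows "inv a \<otimes> (a \<otimes> b) = b" "a \<otimes> (inv a \<otimes> b) = b"
  using assms by (simp_all flip: m_assoc)

lemma aut1D:
  assumes "f \<in> aut1 K S"
  shows "bij_betw f K K" "f \<one> = \<one>"
    "\<And>a b. a \<in> K \<Longrightarrow> b \<in> K \<Longrightarrow> inv (f a) \<otimes> f b \<in> S \<longleftrightarrow> inv a \<otimes> b \<in> S"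
    "\<And>a. a \<in> K \<Longrightarrow> f a \<in> K"
  using assms by (auto simp: aut1_def bij_betw_def)

lemma rigid_iff_fixd: "rigid K S \<longleftrightarrow> K \<subseteq> fixd K S"
  by (auto simp: rigid_def fixd_def)

end

locale subgrp = group +
  fixes K :: "'a set"
  assumes subgroup_K: "subgroup K G"
begin

lemma K_carrier: "a \<in> K \<Longrightarrow> a \<in> carrier G"
  using subgroup.subset[OF subgroup_K] by blast

lemma K_closed: "a \<in> K \<Longrightarrow> b \<in> K \<Longrightarrow> a \<otimes> b \<in> K" "a \<in> K \<Longrightarrow> inv a \<in> K" "\<one> \<in> K"
  using subgroup_K by (auto simp: subgroup.m_closed subgroup.m_inv_closed subgroup.one_closed)

lemmas K_simps = K_closed K_carrier

text \<open>Left translations are automorphisms of a Cayley digraph, so \<open>f\<close> can be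
  moved from the vertex \<open>a\<close> back to the identity. Statements about neighbours of the
  identity thereby carry over to every vertex.\<close>

lemma aut1_translate:
  assumes f: "f \<in> aut1 K S" and a: "a \<in> K"
  shows "(\<lambda>x. inv (f a) \<otimes> f (a \<otimes> x)) \<in> aut1 K S"
proof -
  have "bij_betw (\<lambda>x. a \<otimes> x) K K"
    by (rule bij_betw_byWitness[where f' = "\<lambda>x. inv a \<otimes> x"]) (use a in \<open>auto simp: K_simps\<close>)
  moreover have "bij_betw (\<lambda>x. inv (f a) \<otimes> x) K K"
    by (rule bij_betw_byWitness[where f' = "\<lambda>x. f a \<otimes> x"])
      (use aut1D(4)[OF f a] in \<open>auto simp: K_simps\<close>)
  ultimately have "bij_betw ((\<lambda>x. inv (f a) \<otimes> x) \<circ> (f \<circ> (\<lambda>x. a \<otimes> x))) K K"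
    using aut1D(1)[OF f] by (blast intro: bij_betw_trans)
  then have b: "bij_betw (\<lambda>x. inv (f a) \<otimes> f (a \<otimes> x)) K K" by (simp add: comp_def)
  have m: "f (a \<otimes> x) \<in> carrier G" if "x \<in> K" for x
    using that a aut1D(4)[OF f] by (auto simp: K_simps)
  have fa: "f a \<in> carrier G" using a aut1D(4)[OF f] by (auto simp: K_simps)
  have "inv (inv (f a) \<otimes> f (a \<otimes> x)) \<otimes> (inv (f a) \<otimes> f (a \<otimes> y)) = inv (f (a \<otimes> x)) \<otimes> f (a \<otimes> y)"
    if "x \<in> K" "y \<in> K" for x y
    using m[OF that(1)] m[OF that(2)] fa by (simp add: inv_mult_group m_assoc)
  moreover have "inv (a \<otimes> x) \<otimes> (a \<otimes> y) = inv x \<otimes> y" if "x \<in> K" "y \<in> K" for x y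
    using that a by (simp add: inv_mult_group m_assoc K_simps)
  ultimately show ?thesis
    using b a fa aut1D(3)[OF f]
    by (auto simp: aut1_def K_simps)
qed

lemma aut1_inv_into:
  assumes f: "f \<in> aut1 K S"
  shows "inv_into K f \<in> aut1 K S"
proof -
  note b = aut1D(1)[OF f]
  let ?g = "inv_into K f"
  have gK: "?g x \<in> K" and fg: "f (?g x) = x" if "x \<in> K" for x
    using that b by (auto simp: bij_betw_def inv_into_into f_inv_into_f)
  have "?g \<one> = \<one>" using b aut1D(2)[OF f] K_closed(3)
    by (metis bij_betw_def inv_into_f_f)
  moreover have "inv (?g x) \<otimes> ?g y \<in> S \<longleftrightarrow> inv x \<otimes> y \<in> S" if "x \<in> K" "y \<in> K" for x y
    using aut1D(3)[OF f gK[OF that(1)] gK[OF that(2)]] fg that by simp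
  ultimately show ?thesis using bij_betw_inv_into[OF b] by (simp add: aut1_def)
qed

lemma invar_mem_iff:
  assumes P: "invar K S P" and f: "f \<in> aut1 K S" and x: "x \<in> K"
  shows "f x \<in> P \<longleftrightarrow> x \<in> P"
proof
  assume "f x \<in> P"
  then have "inv_into K f (f x) \<in> P" using P aut1_inv_into[OF f] unfolding invar_def by blast
  then show "x \<in> P" using x aut1D(1)[OF f] by (simp add: bij_betw_def)
qed (use P f in \<open>auto simp: invar_def\<close>)

text \<open>An invariant set can take over the role of the connection set: the translate of
  \<open>f\<close> at \<open>a\<close> preserves \<open>P\<close>. This is what allows refinements
  to be iterated.\<close>

lemma invar_arc:
  assumes P: "invar K S P" and f: "f \<in> aut1 K S" and ab: "a \<in> K" "b \<in> K"
  shows "inv (f a) \<otimes> f b \<in> P \<longleftrightarrow> inv a \<otimes> b \<in> P"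
  using invar_mem_iff[OF P aut1_translate[OF f ab(1)], of "inv a \<otimes> b"] ab
  by (simp add: K_simps)

lemma invarI:
  assumes "P \<subseteq> K" "\<And>f x. f \<in> aut1 K S \<Longrightarrow> x \<in> P \<Longrightarrow> f x \<in> P"
  shows "invar K S P"
  using assms by (auto simp: invar_def)

lemma invar_gens: "S \<subseteq> K \<Longrightarrow> invar K S S"
proof (rule invarI)
  fix f x assume S: "S \<subseteq> K" and f: "f \<in> aut1 K S" and x: "x \<in> S"
  then have "inv \<one> \<otimes> x \<in> S" using K_carrier by auto
  then have "inv (f \<one>) \<otimes> f x \<in> S" using aut1D(3)[OF f, of \<one> x] S x K_closed by blast
  then show "f x \<in> S" using aut1D[OF f] S x K_carrier by (auto simp: subset_iff)
qed

lemma invar_Int: "invar K S P \<Longrightarrow> invar K S Q \<Longrightarrow> invar K S (P \<inter> Q)"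
  by (auto simp: invar_def image_subset_iff)

lemma invar_Diff:
  assumes "invar K S P" "invar K S Q" shows "invar K S (P - Q)"
proof (rule invarI)
  fix f x assume f: "f \<in> aut1 K S" and x: "x \<in> P - Q"
  then have "x \<in> K" using assms by (auto simp: invar_def)
  then show "f x \<in> P - Q"
    using x invar_mem_iff[OF assms(1) f] invar_mem_iff[OF assms(2) f] by blast
qed (use assms in \<open>auto simp: invar_def\<close>)

text \<open>The condition on \<open>inv s\<close> describes an arc from \<open>s\<close> to the
  identity, which is a fixed vertex.\<close>

lemma invar_inv: 
  assumes P: "invar K S P" and Q: "invar K S Q"
  shows "invar K S {s \<in> P. inv s \<in> Q}"
proof (rule invarI)
  fix f x assume f: "f \<in> aut1 K S" and x: "x \<in> {s \<in> P. inv s \<in> Q}"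
  have xK: "x \<in> K" using x P by (auto simp: invar_def)
  have "inv (f x) \<otimes> f \<one> \<in> Q \<longleftrightarrow> inv x \<otimes> \<one> \<in> Q"
    by (rule invar_arc[OF Q f xK K_closed(3)])
  then show "f x \<in> {s \<in> P. inv s \<in> Q}"
    using x xK aut1D[OF f] invar_mem_iff[OF P f] by (simp add: K_simps)
qed (use P in \<open>auto simp: invar_def\<close>)

text \<open>The predicate \<open>C\<close> is left open because both exact counts and lower bounds
  occur. An automorphism maps one set of in-neighbours bijectively onto the other, so infinite sets
  do no harm.\<close>

lemma invar_count_in:
  assumes P: "invar K S P" and Q: "invar K S Q" and R: "invar K S R"
  shows "invar K S {s \<in> P. C (card {t \<in> Q. inv t \<otimes> s \<in> R})}"
proof (rule invarI)
  fix f x assume f: "f \<in> aut1 K S" and x: "x \<in> {s \<in> P. C (card {t \<in> Q. inv t \<otimes> s \<in> R})}"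
  have xK: "x \<in> K" and QK: "Q \<subseteq> K" using x P Q by (auto simp: invar_def)
  have "f ` {t \<in> Q. inv t \<otimes> x \<in> R} = {t \<in> Q. inv t \<otimes> f x \<in> R}"
  proof
    show "f ` {t \<in> Q. inv t \<otimes> x \<in> R} \<subseteq> {t \<in> Q. inv t \<otimes> f x \<in> R}"
      using invar_arc[OF R f _ xK] invar_mem_iff[OF Q f] QK by auto
    show "{t \<in> Q. inv t \<otimes> f x \<in> R} \<subseteq> f ` {t \<in> Q. inv t \<otimes> x \<in> R}"
    proof
      fix t assume t: "t \<in> {t \<in> Q. inv t \<otimes> f x \<in> R}"
      then have "t \<in> f ` K" using QK aut1D(1)[OF f] by (auto simp: bij_betw_def)
      then obtain u where u: "u \<in> K" "t = f u" by blast
      then have "u \<in> Q" "inv u \<otimes> x \<in> R"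
        using t invar_arc[OF R f u(1) xK] invar_mem_iff[OF Q f] by auto
      then show "t \<in> f ` {t \<in> Q. inv t \<otimes> x \<in> R}" using u by blast
    qed
  qed
  moreover have "inj_on f {t \<in> Q. inv t \<otimes> x \<in> R}"
    using aut1D(1)[OF f] QK by (auto simp: bij_betw_def inj_on_def)
  ultimately have "card {t \<in> Q. inv t \<otimes> f x \<in> R} = card {t \<in> Q. inv t \<otimes> x \<in> R}"
    using card_image by fastforce
  then show "f x \<in> {s \<in> P. C (card {t \<in> Q. inv t \<otimes> s \<in> R})}"
    using x invar_mem_iff[OF P f xK] by simp
qed (use P in \<open>auto simp: invar_def\<close>)

lemma invar_in:
  assumes P: "invar K S P" and Q: "invar K S Q" and R: "invar K S R"
  shows "invar K S {s \<in> P. \<exists>t\<in>Q. inv t \<otimes> s \<in> R}"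
proof (rule invarI)
  fix f x assume f: "f \<in> aut1 K S" and x: "x \<in> {s \<in> P. \<exists>t\<in>Q. inv t \<otimes> s \<in> R}"
  then obtain t where t: "t \<in> Q" "inv t \<otimes> x \<in> R" by blast
  have K: "x \<in> K" "t \<in> K" using x t P Q by (auto simp: invar_def)
  show "f x \<in> {s \<in> P. \<exists>t\<in>Q. inv t \<otimes> s \<in> R}"
    using x t invar_mem_iff[OF P f K(1)] invar_mem_iff[OF Q f K(2)] invar_arc[OF R f K(2,1)] by auto
qed (use P in \<open>auto simp: invar_def\<close>)

lemma invar_out:
  assumes P: "invar K S P" and Q: "invar K S Q" and R: "invar K S R"
  shows "invar K S {s \<in> P. \<exists>t\<in>Q. inv s \<otimes> t \<in> R}"
proof (rule invarI)
  fix f x assume f: "f \<in> aut1 K S" and x: "x \<in> {s \<in> P. \<exists>t\<in>Q. inv s \<otimes> t \<in> R}"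
  then obtain t where t: "t \<in> Q" "inv x \<otimes> t \<in> R" by blast
  have K: "x \<in> K" "t \<in> K" using x t P Q by (auto simp: invar_def)
  show "f x \<in> {s \<in> P. \<exists>t\<in>Q. inv s \<otimes> t \<in> R}"
    using x t invar_mem_iff[OF P f K(1)] invar_mem_iff[OF Q f K(2)] invar_arc[OF R f K] by auto
qed (use P in \<open>auto simp: invar_def\<close>)

lemma invar_singleton: "invar K S {g} \<longleftrightarrow> g \<in> fixd K S"
  by (auto simp: invar_def fixd_def)

lemma invar_fixd: "P \<subseteq> fixd K S \<Longrightarrow> invar K S P"
  unfolding invar_def fixd_def by fastforce

text \<open>The translate of \<open>f\<close> at \<open>a\<close> fixes \<open>g\<close>. So every
  \<open>f\<close> commutes with right multiplication by \<open>g\<close>, which makes the fixed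
  points a subgroup.\<close>

lemma fixd_mult:
  assumes g: "g \<in> fixd K S" and f: "f \<in> aut1 K S" and a: "a \<in> K"
  shows "f (a \<otimes> g) = f a \<otimes> g"
proof -
  have gK: "g \<in> K" using g by (simp add: fixd_def)
  have "inv (f a) \<otimes> f (a \<otimes> g) = g" using g aut1_translate[OF f a] by (auto simp: fixd_def)
  moreover have "f a \<in> carrier G" "f (a \<otimes> g) \<in> carrier G"
    using a gK aut1D(4)[OF f] by (auto simp: K_simps)
  ultimately show ?thesis using m_inv_cancel(2) by metis
qed

lemma fixd_subgroup: "subgroup (fixd K S) G"
proof (rule subgroupI)
  show "fixd K S \<subseteq> carrier G" by (auto simp: fixd_def K_carrier)
  show "fixd K S \<noteq> {}" using K_closed(3) aut1D(2) by (auto simp: fixd_def)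
next
  fix a assume a: "a \<in> fixd K S"
  then have aK: "a \<in> K" by (simp add: fixd_def)
  have "f (inv a) = inv a" if f: "f \<in> aut1 K S" for f
  proof -
    have "f (inv a) \<otimes> a = \<one>"
      using fixd_mult[OF a f K_closed(2)[OF aK]] aK aut1D(2)[OF f] by (simp add: K_simps)
    then show ?thesis using aK aut1D(4)[OF f K_closed(2)[OF aK]] inv_equality K_carrier by metis
  qed
  then show "inv a \<in> fixd K S" using aK by (simp add: fixd_def K_closed)
next
  fix a b assume ab: "a \<in> fixd K S" "b \<in> fixd K S"
  then have K: "a \<in> K" "b \<in> K" by (auto simp: fixd_def)
  have "f (a \<otimes> b) = a \<otimes> b" if "f \<in> aut1 K S" for f
    using fixd_mult[OF ab(2) that K(1)] ab(1) that unfolding fixd_def by auto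
  then show "a \<otimes> b \<in> fixd K S" using K by (simp add: fixd_def K_closed)
qed

lemma generate_fixd: "A \<subseteq> fixd K S \<Longrightarrow> generate G A \<subseteq> fixd K S"
  by (rule generate_subgroup_incl[OF _ fixd_subgroup])

lemma rigidI: "A \<subseteq> fixd K S \<Longrightarrow> K \<subseteq> generate G A \<Longrightarrow> rigid K S"
  unfolding rigid_iff_fixd using generate_fixd[of A S] by blast

text \<open>By injectivity the quotient of two images is trivial only if the two points agree, and
  away from the diagonal the two arc sets are complementary.\<close>

lemma aut1_compl: "aut1 K (K - {\<one>} - S) \<subseteq> aut1 K S" if "S \<subseteq> K" "\<one> \<notin> S"
proof
  fix f assume f: "f \<in> aut1 K (K - {\<one>} - S)"
  have "inv (f a) \<otimes> f b \<in> S \<longleftrightarrow> inv a \<otimes> b \<in> S" if ab: "a \<in> K" "b \<in> K" for a b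
  proof (cases "a = b")
    case True
    then show ?thesis using ab \<open>\<one> \<notin> S\<close> aut1D(4)[OF f ab(1)] by (simp add: K_simps)
  next
    case False
    then have "f a \<noteq> f b" using ab aut1D(1)[OF f] by (auto simp: bij_betw_def inj_on_def)
    have fK: "f a \<in> K" "f b \<in> K" using aut1D(4)[OF f] ab by auto
    have "inv (f a) \<otimes> f b \<noteq> \<one>" using \<open>f a \<noteq> f b\<close> fK K_carrier
      by (metis inv_equality inv_inv m_closed inv_closed l_inv r_cancel)
    moreover have "inv a \<otimes> b \<noteq> \<one>" using False ab K_carrier
      by (metis inv_equality inv_inv m_closed inv_closed l_inv r_cancel)
    ultimately show ?thesis using aut1D(3)[OF f ab] fK ab by (auto simp: K_closed)
  qed
  then show "f \<in> aut1 K S" using f by (auto simp: aut1_def)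
qed

lemma rigid_compl:
  assumes "S \<subseteq> K" "\<one> \<notin> S" "rigid K S" shows "rigid K (K - {\<one>} - S)"
  using aut1_compl[OF assms(1,2)] assms(3) unfolding rigid_def by blast

end

section \<open>Digraphical regular representations as rigid generating sets\<close>

context group
begin

text \<open>Freeness concerns the stabilisers of all vertices; transitivity of the left translations
  reduces them to the stabiliser of the identity.\<close>

lemma is_DRR_iff:
  "is_DRR G S \<longleftrightarrow> S \<subseteq> carrier G \<and> generate G S = carrier G \<and> \<one> \<notin> S \<and> rigid (carrier G) S"
proof -
  interpret subgrp G "carrier G" by (intro subgrp.intro subgrp_axioms.intro is_group subgroup_self)
  let ?D = "cayley_digraph G S"
  have V [simp]: "pverts ?D = carrier G" by (simp add: cayley_digraph_def)
  have aut: "f \<in> digraph_aut ?D \<longleftrightarrow> f \<in> Bij (carrier G) \<and>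
      (\<forall>a\<in>carrier G. \<forall>b\<in>carrier G. inv (f a) \<otimes> f b \<in> S \<longleftrightarrow> inv a \<otimes> b \<in> S)" for f
  proof -
    have "f a \<in> carrier G" if "f \<in> Bij (carrier G)" "a \<in> carrier G" for a
      using that by (auto simp: Bij_def bij_betw_def)
    then show ?thesis by (auto simp: digraph_aut_def cayley_digraph_def)
  qed
  have one: "\<one>\<^bsub>digraph_aut_group ?D\<^esub> = (\<lambda>x\<in>carrier G. x)"
    and car: "carrier (digraph_aut_group ?D) = digraph_aut ?D"
    by (simp_all add: digraph_aut_group_def BijGroup_def)
  have "acts_freely (digraph_aut_group ?D) (carrier G) (\<lambda>f. f) \<longleftrightarrow>
      (\<forall>x\<in>carrier G. stabilizer (digraph_aut_group ?D) (\<lambda>f. f) x = {\<lambda>x\<in>carrier G. x})"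
    using group_action_digraph_aut[of ?D] by (simp add: acts_freely_def one)
  also have "\<dots> \<longleftrightarrow> rigid (carrier G) S"
  proof
    assume free: "\<forall>x\<in>carrier G. stabilizer (digraph_aut_group ?D) (\<lambda>f. f) x = {\<lambda>x\<in>carrier G. x}"
    show "rigid (carrier G) S" unfolding rigid_def
    proof (intro ballI)
      fix f a assume f: "f \<in> aut1 (carrier G) S" and a: "a \<in> carrier G"
      have "restrict f (carrier G) \<in> digraph_aut ?D"
        using aut1D[OF f] unfolding aut by (auto simp: Bij_def bij_betw_def inj_on_def)
      then have "restrict f (carrier G) \<in> stabilizer (digraph_aut_group ?D) (\<lambda>f. f) \<one>"
        using aut1D(2)[OF f] by (simp add: stabilizer_def car)
      then have "restrict f (carrier G) = (\<lambda>x\<in>carrier G. x)" using free by auto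
      then show "f a = a" using a by (metis restrict_apply')
    qed
  next
    assume r: "rigid (carrier G) S"
    show "\<forall>x\<in>carrier G. stabilizer (digraph_aut_group ?D) (\<lambda>f. f) x = {\<lambda>x\<in>carrier G. x}"
    proof (intro ballI equalityI subsetI)
      fix x f assume x: "x \<in> carrier G" and "f \<in> stabilizer (digraph_aut_group ?D) (\<lambda>f. f) x"
      then have f: "f \<in> Bij (carrier G)" "f x = x"
        "\<And>a b. a \<in> carrier G \<Longrightarrow> b \<in> carrier G \<Longrightarrow> inv (f a) \<otimes> f b \<in> S \<longleftrightarrow> inv a \<otimes> b \<in> S"
        by (auto simp: stabilizer_def car aut)
      have fc: "f a \<in> carrier G" if "a \<in> carrier G" for a
        using f(1) that by (auto simp: Bij_def bij_betw_def)
      \<comment> \<open>Conjugation by the translation by \<open>x\<close> carries the stabiliser of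
        \<open>x\<close> to that of the identity.\<close>
      let ?g = "\<lambda>y. inv x \<otimes> f (x \<otimes> y)"
      have "bij_betw (\<lambda>y. x \<otimes> y) (carrier G) (carrier G)"
        by (rule bij_betw_byWitness[where f' = "\<lambda>y. inv x \<otimes> y"]) (use x in auto)
      moreover have "bij_betw (\<lambda>y. inv x \<otimes> y) (carrier G) (carrier G)"
        by (rule bij_betw_byWitness[where f' = "\<lambda>y. x \<otimes> y"]) (use x in auto)
      ultimately have "bij_betw ((\<lambda>y. inv x \<otimes> y) \<circ> (f \<circ> (\<lambda>y. x \<otimes> y))) (carrier G) (carrier G)"
        using f(1) by (auto simp: Bij_def intro: bij_betw_trans)
      moreover have "inv (?g a) \<otimes> ?g b = inv (f (x \<otimes> a)) \<otimes> f (x \<otimes> b)"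
        "inv (x \<otimes> a) \<otimes> (x \<otimes> b) = inv a \<otimes> b" if "a \<in> carrier G" "b \<in> carrier G" for a b
        using x that by (simp_all add: fc inv_mult_group m_assoc)
      ultimately have "?g \<in> aut1 (carrier G) S"
        using x f(2) f(3) by (auto simp: aut1_def comp_def)
      then have g: "inv x \<otimes> f (x \<otimes> y) = y" if "y \<in> carrier G" for y
        using r that by (auto simp: rigid_def)
      have "f y = y" if y: "y \<in> carrier G" for y
        using g[of "inv x \<otimes> y"] x y fc[OF y] by simp
      then have "f = (\<lambda>x\<in>carrier G. x)"
        using f(1) by (auto simp: Bij_def extensional_def)
      then show "f \<in> {\<lambda>x\<in>carrier G. x}" by simp
    next
      fix x f assume x: "x \<in> carrier G" and "f \<in> {\<lambda>x\<in>carrier G. x}"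
      then show "f \<in> stabilizer (digraph_aut_group ?D) (\<lambda>f. f) x"
        by (simp add: stabilizer_def car aut id_Bij)
    qed
  qed
  finally show ?thesis
    by (auto simp: is_DRR_def generating_set_def)
qed

end

subsection \<open>Finite extensions\<close>

context group
begin

text \<open>If \<open>T\<close> is sparse then every element of \<open>K\<close> is in at least two ways a product of two elements
  of the complement \<open>D = K - {\<one>} - T\<close>, while a new element \<open>x\<close> is not such a product. The bounds
  are chosen such that \<open>D \<union> {x}\<close> is again sparse in any finite group generated by \<open>K\<close> and \<open>x\<close>.\<close>

definition sparse :: "'a set \<Rightarrow> 'a set \<Rightarrow> bool" where
  "sparse K T \<longleftrightarrow> subgroup K G \<and> finite K \<and> T \<subseteq> K \<and> \<one> \<notin> T \<and> rigid K T \<and>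
     2 \<le> card T \<and> 2 * card T + 4 \<le> card K"

definition asymmetric :: "'a set \<Rightarrow> bool" where
  "asymmetric T \<longleftrightarrow> (\<exists>a\<in>T. a \<otimes> a \<noteq> \<one> \<and> inv a \<notin> T)"

lemma subgrpI: "subgroup K G \<Longrightarrow> subgrp G K"
  by (intro subgrp.intro subgrp_axioms.intro is_group)

lemma generate_subgrp: "A \<subseteq> carrier G \<Longrightarrow> subgrp G (generate G A)"
  by (intro subgrpI generate_is_subgroup)

lemma generate_subset: "A \<subseteq> generate G A"
  by (auto intro: generate.incl)

lemma generate_subgroup_eq: "subgroup K G \<Longrightarrow> generate G K = K"
  using generate_subgroup_incl[of K K] generate_subset[of K] by blast

lemma generate_Un_absorb:
  assumes "A \<subseteq> carrier G" "B \<subseteq> carrier G"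
  shows "generate G (generate G A \<union> B) = generate G (A \<union> B)"
proof
  have "generate G A \<subseteq> generate G (A \<union> B)" by (rule mono_generate) auto
  moreover have "B \<subseteq> generate G (A \<union> B)" by (auto intro: generate.incl)
  ultimately show "generate G (generate G A \<union> B) \<subseteq> generate G (A \<union> B)"
    using generate_is_subgroup[of "A \<union> B"] assms by (intro generate_subgroup_incl) auto
  show "generate G (A \<union> B) \<subseteq> generate G (generate G A \<union> B)"
    by (rule mono_generate) (auto intro: generate.incl)
qed

text \<open>At most 2(|T| + 1) elements \<open>s\<close> are excluded because \<open>s\<close> or
  its cofactor lies in \<open>insert \<one> T\<close>, so at least two remain. One factorisation is
  enough for generation; the second one later separates \<open>D\<close> from a vertex with a single
  in-neighbour.\<close>

lemma dense_count:
  assumes K: "subgroup K G" "finite K" and T: "T \<subseteq> K" "2 * card T + 4 \<le> card K" and g: "g \<in> K"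
  defines "D \<equiv> K - {\<one>} - T"
  shows "2 \<le> card {s \<in> D. inv s \<otimes> g \<in> D}"
    "2 \<le> card {s \<in> D. inv g \<otimes> s \<in> D}"
proof -
  interpret subgrp G K by (rule subgrpI[OF K(1)])
  have fT: "finite T" using K(2) T(1) finite_subset by blast
  let ?E = "insert \<one> T"
  have cE: "card ?E \<le> card T + 1" using card_insert_le_m1[of "card T + 1" T \<one>] fT by simp
  have EK: "?E \<subseteq> K" using T K_closed by auto
  let ?A = "?E \<union> (\<lambda>e. g \<otimes> inv e) ` ?E" and ?B = "?E \<union> (\<lambda>e. g \<otimes> e) ` ?E"
  have "K - ?A \<subseteq> {s \<in> D. inv s \<otimes> g \<in> D}"
  proof
    fix s assume s: "s \<in> K - ?A"
    have sK: "s \<in> K" using s by blast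
    have "inv s \<otimes> g \<notin> ?E"
    proof
      assume e: "inv s \<otimes> g \<in> ?E"
      have "s = g \<otimes> inv (inv s \<otimes> g)" using sK g by (simp add: K_simps inv_mult_group)
      then have "s \<in> (\<lambda>e. g \<otimes> inv e) ` ?E" using e by (rule image_eqI)
      then show False using s by blast
    qed
    then show "s \<in> {s \<in> D. inv s \<otimes> g \<in> D}" using s g by (auto simp: D_def K_simps)
  qed
  moreover have "K - ?B \<subseteq> {s \<in> D. inv g \<otimes> s \<in> D}"
  proof
    fix s assume s: "s \<in> K - ?B"
    have sK: "s \<in> K" using s by blast
    have "inv g \<otimes> s \<notin> ?E"
    proof
      assume e: "inv g \<otimes> s \<in> ?E"
      have "s = g \<otimes> (inv g \<otimes> s)" using sK g by (simp add: K_simps)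
      then have "s \<in> (\<lambda>e. g \<otimes> e) ` ?E" using e by (rule image_eqI)
      then show False using s by blast
    qed
    then show "s \<in> {s \<in> D. inv g \<otimes> s \<in> D}" using s g by (auto simp: D_def K_simps)
  qed
  moreover have "2 \<le> card (K - ?A)" "2 \<le> card (K - ?B)"
  proof -
    have "card ?A \<le> card ?E + card ((\<lambda>e. g \<otimes> inv e) ` ?E)" by (rule card_Un_le)
    also have "\<dots> \<le> 2 * (card T + 1)" using cE card_image_le[of ?E "\<lambda>e. g \<otimes> inv e"] fT by simp
    finally show "2 \<le> card (K - ?A)" using T(2) fT diff_card_le_card_Diff[of ?A K] by simp
    have "card ?B \<le> card ?E + card ((\<lambda>e. g \<otimes> e) ` ?E)" by (rule card_Un_le)
    also have "\<dots> \<le> 2 * (card T + 1)" using cE card_image_le[of ?E "\<lambda>e. g \<otimes> e"] fT by simp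
    finally show "2 \<le> card (K - ?B)" using T(2) fT diff_card_le_card_Diff[of ?B K] by simp
  qed
  moreover have "finite D" using K(2) by (simp add: D_def)
  ultimately show "2 \<le> card {s \<in> D. inv s \<otimes> g \<in> D}"
    "2 \<le> card {s \<in> D. inv g \<otimes> s \<in> D}"
    using card_mono[of "{s \<in> D. inv s \<otimes> g \<in> D}" "K - ?A"]
      card_mono[of "{s \<in> D. inv g \<otimes> s \<in> D}" "K - ?B"] by auto
qed

lemma card2_ex: "2 \<le> card A \<Longrightarrow> \<exists>x. x \<in> A"
  by (metis all_not_in_conv card.empty not_numeral_le_zero)

text \<open>Each element of \<open>K\<close> is reached from the identity by two arcs with labels in
  \<open>K - {\<one>} - T\<close>, so \<open>f\<close> maps \<open>K\<close> into \<open>K\<close>,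
  and finiteness makes the restriction bijective. It is then an automorphism for the complement of a
  rigid set.\<close>

lemma dense_core_fixd:
  assumes K: "sparse K T" and H: "subgroup H G" "K \<subseteq> H"
    and inv: "invar H S (K - {\<one>} - T)"
  shows "K \<subseteq> fixd H S"
proof
  fix k assume k: "k \<in> K"
  interpret K: subgrp G K using K by (auto intro: subgrpI simp: sparse_def)
  interpret H: subgrp G H by (rule subgrpI[OF H(1)])
  let ?D = "K - {\<one>} - T"
  have fK: "finite K" and T: "T \<subseteq> K" "\<one> \<notin> T" "rigid K T" "2 * card T + 4 \<le> card K"
    using K by (auto simp: sparse_def)
  have "f k = k" if f: "f \<in> aut1 H S" for f
  proof -
    have fin: "f g \<in> K" if g: "g \<in> K" for g
    proof -
      obtain s where s: "s \<in> ?D" "inv s \<otimes> g \<in> ?D"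
        using card2_ex[OF dense_count(1)[OF K.subgroup_K fK T(1,4) g]] by blast
      have "inv (f s) \<otimes> f g \<in> ?D" using H.invar_arc[OF inv f, of s g] s g H(2) by auto
      moreover have "f s \<in> ?D" using H.invar_mem_iff[OF inv f, of s] s H(2) by auto
      moreover have "f g \<in> carrier G" using aut1D(4)[OF f, of g] g H(2) H.K_carrier by auto
      ultimately show ?thesis
        using K.K_closed(1)[of "f s" "inv (f s) \<otimes> f g"] K.K_carrier by auto
    qed
    have inj: "inj_on f K" using aut1D(1)[OF f] H(2) by (auto simp: bij_betw_def intro: inj_on_subset)
    then have "bij_betw f K K"
      using endo_inj_surj[OF fK _ inj] fin by (auto simp: bij_betw_def)
    moreover have "inv (f a) \<otimes> f b \<in> ?D \<longleftrightarrow> inv a \<otimes> b \<in> ?D" if "a \<in> K" "b \<in> K" for a b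
      using H.invar_arc[OF inv f, of a b] that H(2) by blast
    ultimately have "f \<in> aut1 K ?D"
      using aut1D(2)[OF f] unfolding aut1_def by blast
    then show ?thesis using K.rigid_compl[OF T(1,2,3)] k unfolding rigid_def by blast
  qed
  then show "k \<in> fixd H S" using k H(2) by (auto simp: fixd_def)
qed

lemma sparse_extend:
  assumes K: "sparse K T" and x: "x \<in> carrier G" "x \<notin> K"
  defines "H \<equiv> generate G (insert x K)" and "S \<equiv> insert x (K - {\<one>} - T)"
  assumes fin: "finite H"
  shows "sparse H S"
proof -
  interpret K: subgrp G K using K by (auto intro: subgrpI simp: sparse_def)
  let ?D = "K - {\<one>} - T"
  have fK: "finite K" and T: "T \<subseteq> K" "\<one> \<notin> T" "rigid K T" "2 * card T + 4 \<le> card K" "2 \<le> card T"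
    using K by (auto simp: sparse_def)
  have ins: "insert x K \<subseteq> carrier G" using x K.K_carrier by auto
  have sH: "subgroup H G" unfolding H_def by (rule generate_is_subgroup[OF ins])
  interpret H: subgrp G H by (rule subgrpI[OF sH])
  have KH: "K \<subseteq> H" "x \<in> H" by (auto simp: H_def intro: generate.incl)
  have SH: "S \<subseteq> H" using KH by (auto simp: S_def)
  have "{s \<in> S. \<exists>t\<in>S. inv t \<otimes> s \<in> S} = ?D"
  proof
    show "?D \<subseteq> {s \<in> S. \<exists>t\<in>S. inv t \<otimes> s \<in> S}"
    proof
      fix s assume s: "s \<in> ?D"
      then obtain t where "t \<in> ?D" "inv t \<otimes> s \<in> ?D"
        using card2_ex[OF dense_count(1)[OF K.subgroup_K fK T(1,4), of s]] by blast
      then show "s \<in> {s \<in> S. \<exists>t\<in>S. inv t \<otimes> s \<in> S}" using s by (auto simp: S_def)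
    qed
    have "inv t \<otimes> x \<notin> S" if t: "t \<in> S" for t
    proof
      assume e: "inv t \<otimes> x \<in> S"
      have tc: "t \<in> carrier G" using t SH H.K_carrier by blast
      consider "t = x" | "t \<in> ?D" using t by (auto simp: S_def)
      then show False
      proof cases
        case 1
        then show False using e x K.K_closed by (auto simp: S_def)
      next
        case 2
        then have "t \<otimes> (inv t \<otimes> x) = x" "t \<in> K" "t \<noteq> \<one>" using tc x by auto
        show False
        proof (cases "inv t \<otimes> x = x")
          case True
          then have "t = \<one>" using x tc
            by (metis inv_closed inv_eq_1_iff r_cancel_one')
          then show False using \<open>t \<noteq> \<one>\<close> by simp
        next
          case False
          then have "inv t \<otimes> x \<in> K" using e by (auto simp: S_def)
          then have "x \<in> K" using K.K_closed(1)[OF \<open>t \<in> K\<close>] \<open>t \<otimes> (inv t \<otimes> x) = x\<close> by metis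
          then show False using x by simp
        qed
      qed
    qed
    then show "{s \<in> S. \<exists>t\<in>S. inv t \<otimes> s \<in> S} \<subseteq> ?D" by (auto simp: S_def)
  qed
  then have invD: "invar H S ?D"
    using H.invar_in[OF H.invar_gens[OF SH] H.invar_gens[OF SH] H.invar_gens[OF SH]] by simp
  have "K \<subseteq> fixd H S" by (rule dense_core_fixd[OF K sH KH(1) invD])
  moreover have "S - ?D = {x}" using x by (auto simp: S_def)
  then have "x \<in> fixd H S"
    using H.invar_Diff[OF H.invar_gens[OF SH] invD] H.invar_singleton by simp
  ultimately have r: "rigid H S" by (intro H.rigidI[of "insert x K"]) (auto simp: H_def)
  have "K \<inter> (\<lambda>k. x \<otimes> k) ` K = {}"
  proof -
    have "x \<otimes> k \<notin> K" if "k \<in> K" for k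
    proof
      assume "x \<otimes> k \<in> K"
      then have "(x \<otimes> k) \<otimes> inv k \<in> K" using that K.K_closed by blast
      then show False using that x by (simp add: K.K_carrier m_assoc)
    qed
    then show ?thesis by auto
  qed
  moreover have "inj_on (\<lambda>k. x \<otimes> k) K" using x K.K_carrier by (auto simp: inj_on_def)
  ultimately have "card (K \<union> (\<lambda>k. x \<otimes> k) ` K) = 2 * card K"
    using fK by (simp add: card_Un_disjoint card_image)
  moreover have "K \<union> (\<lambda>k. x \<otimes> k) ` K \<subseteq> H" using KH H.K_closed by auto
  ultimately have N: "2 * card K \<le> card H" using card_mono[OF fin] by metis
  have fT: "finite T" using fK T(1) finite_subset by blast
  have "card ?D = card K - 1 - card T"
    using fT T(1,2) K.K_closed(3) fK by (simp add: card_Diff_subset subset_Diff_insert)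
  \<comment> \<open>Hence 2|S| + 4 = 2|K| - 2|T| + 4 \<le> 2|K| \<le> |H|, where the first
    inequality is the requirement \<open>2 \<le> card T\<close>.\<close>
  then have "card S = card K - card T"
    using x fK T(4) by (simp add: S_def)
  then show ?thesis
    using N T(4,5) sH fin SH r x K.K_closed by (auto simp: sparse_def S_def)
qed

text \<open>The witness changes from \<open>a\<close> to \<open>inv a\<close>: under complementation
  the one of the two that was missing becomes a member, and the other one drops out.\<close>

lemma asymmetric_extend:
  assumes K: "sparse K T" and x: "x \<in> carrier G" "x \<notin> K" and a: "asymmetric T"
  shows "asymmetric (insert x (K - {\<one>} - T))"
proof -
  interpret K: subgrp G K using K by (auto intro: subgrpI simp: sparse_def)
  obtain a where a: "a \<in> T" "a \<otimes> a \<noteq> \<one>" "inv a \<notin> T" using a by (auto simp: asymmetric_def)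
  have aK: "a \<in> K" using a K by (auto simp: sparse_def)
  then have "inv a \<in> K" "inv a \<noteq> \<one>" "inv a \<otimes> inv a \<noteq> \<one>"
    using a K.K_simps by (auto simp: inv_mult_group[symmetric])
  then show ?thesis using a x aK K.K_carrier
    by (auto simp: asymmetric_def intro!: bexI[of _ "inv a"])
qed

lemma sparse_DRR:
  assumes K: "sparse (carrier G) T"
  shows "is_DRR G (carrier G - {\<one>} - T)"
proof -
  interpret K: subgrp G "carrier G" using K by (auto intro: subgrpI simp: sparse_def)
  let ?D = "carrier G - {\<one>} - T"
  have "g \<in> generate G ?D" if g: "g \<in> carrier G" for g
  proof -
    obtain s where s: "s \<in> ?D" "inv s \<otimes> g \<in> ?D"
      using card2_ex[OF dense_count(1)[of "carrier G" T g]] K g by (auto simp: sparse_def)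
    then have "s \<otimes> (inv s \<otimes> g) \<in> generate G ?D" by (intro generate.eng generate.incl)
    then show ?thesis using s g by simp
  qed
  moreover have "generate G ?D \<subseteq> carrier G" by (rule generate_incl) auto
  ultimately show ?thesis
    using K.rigid_compl K by (auto simp: is_DRR_iff sparse_def)
qed

end

subsection \<open>Infinite extensions\<close>

context group
begin

text \<open>The elements \<open>x \<otimes> u\<close> with \<open>u \<in> U\<close> will be added to a connection set inside a subgroup that contains \<open>U\<close>.
  The three conditions prevent products among the connection set that involve them.\<close>

definition offset_ok :: "'a set \<Rightarrow> 'a set \<Rightarrow> 'a \<Rightarrow> 'a set \<Rightarrow> bool" where
  "offset_ok F B x U \<longleftrightarrow> U \<subseteq> B \<and> finite U \<and> card U = 3 \<and> (\<forall>u\<in>U. \<forall>v\<in>U. u \<noteq> v \<longrightarrow>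
     inv u \<otimes> v \<notin> F \<and> x \<otimes> u \<otimes> inv v \<otimes> inv x \<notin> F \<and> x \<otimes> u \<otimes> (x \<otimes> v) \<notin> F)"

text \<open>Two elements would not be enough, since translation by an involution may exchange them.
  Among the permutations of three elements, those with a fixed point come only from
  \<open>h = \<one>\<close>, so just the two 3-cycles have to be prevented.\<close>

lemma offset_triple:
  assumes B: "infinite B" "B \<subseteq> carrier G" and F: "finite F" and x: "x \<in> carrier G"
  shows "\<exists>U. offset_ok F B x U \<and> (\<forall>h\<in>carrier G. (\<lambda>u. h \<otimes> u) ` U \<subseteq> U \<longrightarrow> h = \<one>)"
proof -
  \<comment> \<open>Symmetric in \<open>u\<close> and \<open>v\<close>: the elements are chosen one
    after another, but the conditions concern ordered pairs.\<close>
  define bad where "bad u = {v \<in> carrier G.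
      inv u \<otimes> v \<in> F \<or> inv v \<otimes> u \<in> F \<or> x \<otimes> u \<otimes> inv v \<otimes> inv x \<in> F \<or>
      x \<otimes> v \<otimes> inv u \<otimes> inv x \<in> F \<or> x \<otimes> u \<otimes> (x \<otimes> v) \<in> F \<or> x \<otimes> v \<otimes> (x \<otimes> u) \<in> F}" for u
  have fin: "finite {v \<in> carrier G. p v \<in> F}" if "inj_on p (carrier G)" for p
    using finite_vimage_IntI[OF F that] by (rule back_subst[where P = finite]) auto
  have fbad: "finite (insert u (bad u))" if u: "u \<in> carrier G" for u
  proof -
    have "inj_on (\<lambda>v. inv u \<otimes> v) (carrier G)" "inj_on (\<lambda>v. inv v \<otimes> u) (carrier G)"
      "inj_on (\<lambda>v. x \<otimes> u \<otimes> inv v \<otimes> inv x) (carrier G)" "inj_on (\<lambda>v. x \<otimes> v \<otimes> inv u \<otimes> inv x) (carrier G)"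
      "inj_on (\<lambda>v. x \<otimes> u \<otimes> (x \<otimes> v)) (carrier G)" "inj_on (\<lambda>v. x \<otimes> v \<otimes> (x \<otimes> u)) (carrier G)"
      using u x by (auto simp: inj_on_def m_assoc)
    note f = this[THEN fin]
    show ?thesis
      by (rule finite_subset[OF _ finite.insertI[OF
        finite_UnI[OF finite_UnI[OF finite_UnI[OF f(1,2)] finite_UnI[OF f(3,4)]] finite_UnI[OF f(5,6)]], of u]])
        (auto simp: bad_def)
  qed
  have "\<exists>a. a \<in> B" using B(1) by (metis all_not_in_conv finite.emptyI)
  then obtain a where a: "a \<in> B" by blast
  have ac: "a \<in> carrier G" using a B by auto
  have "infinite (B - insert a (bad a))" using B(1) fbad[OF ac] by (simp only: Diff_infinite_finite not_False_eq_True)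
  then have "\<exists>b. b \<in> B - insert a (bad a)" by (metis all_not_in_conv finite.emptyI)
  then obtain b where b: "b \<in> B" "b \<noteq> a" "b \<notin> bad a" by blast
  have bc: "b \<in> carrier G" using b B by auto
  \<comment> \<open>The translation taking a to b and b to c forces the first value of c; the one
    taking b to a and a to c forces the second.\<close>
  let ?E = "{b \<otimes> inv a \<otimes> b, a \<otimes> inv b \<otimes> a}"
  have "infinite (B - (insert a (bad a) \<union> insert b (bad b) \<union> ?E))"
    using B(1) fbad[OF ac] fbad[OF bc] by (intro Diff_infinite_finite finite_UnI) auto
  then have "\<exists>c. c \<in> B - (insert a (bad a) \<union> insert b (bad b) \<union> ?E)"
    by (metis all_not_in_conv finite.emptyI)
  then obtain c where c: "c \<in> B" "c \<noteq> a" "c \<noteq> b" "c \<notin> bad a" "c \<notin> bad b"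
    "c \<noteq> b \<otimes> inv a \<otimes> b" "c \<noteq> a \<otimes> inv b \<otimes> a" by blast
  have cc: "c \<in> carrier G" using c B by auto
  have h1: "h = \<one>" if h: "h \<in> carrier G" "(\<lambda>u. h \<otimes> u) ` {a,b,c} \<subseteq> {a,b,c}" for h
  proof -
    have inj: "u = v" if "h \<otimes> u = h \<otimes> v" "u \<in> carrier G" "v \<in> carrier G" for u v
      using that h(1) by simp
    have one: "h \<otimes> u = u \<Longrightarrow> h = \<one>" if "u \<in> carrier G" for u using h(1) that r_cancel_one' by metis
    have div: "h \<otimes> u = v \<Longrightarrow> h = v \<otimes> inv u" if "u \<in> carrier G" "v \<in> carrier G" for u v
      using h(1) that by (auto simp: m_assoc)
    consider "h \<otimes> a = a" | "h \<otimes> a = b" | "h \<otimes> a = c" using h(2) by auto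
    then show ?thesis
    proof cases
      case 1 then show ?thesis using one ac by blast
    next
      case 2
      have "h \<otimes> b \<noteq> b" using inj[of a b] 2 ac bc b(2) by auto
      moreover have "h \<otimes> b \<noteq> c" using div[OF ac bc 2] c(6) by auto
      ultimately have hb: "h \<otimes> b = a" using h(2) by auto
      then have "h \<otimes> c \<noteq> a" "h \<otimes> c \<noteq> b" using inj[of b c] inj[of a c] 2 ac bc cc c b by auto
      then have "h \<otimes> c = c" using h(2) by auto
      then show ?thesis using one cc by blast
    next
      case 3
      have "h \<otimes> b \<noteq> c" using inj[of a b] 3 ac bc b(2) by auto
      moreover have "h \<otimes> b \<noteq> a"
      proof
        assume "h \<otimes> b = a"
        then have "h = a \<otimes> inv b" using div[OF bc ac] by blast
        then show False using 3 c(7) by simp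
      qed
      ultimately have "h \<otimes> b = b" using h(2) by auto
      then show ?thesis using one bc by blast
    qed
  qed
  have q: "\<forall>u\<in>{a,b,c}. \<forall>v\<in>{a,b,c}. u \<noteq> v \<longrightarrow>
       inv u \<otimes> v \<notin> F \<and> x \<otimes> u \<otimes> inv v \<otimes> inv x \<notin> F \<and> x \<otimes> u \<otimes> (x \<otimes> v) \<notin> F"
    using b c ac bc cc by (auto simp: bad_def)
  show ?thesis
    by (rule exI[of _ "{a,b,c}"]) (use a b c q h1 in \<open>auto simp: offset_ok_def\<close>)
qed

lemma offsets_exist:
  assumes "finite Y" "Y \<subseteq> carrier G" "\<And>x. x \<in> Y \<Longrightarrow> infinite (B x) \<and> B x \<subseteq> carrier G" and F: "finite F"
  shows "\<exists>U. (\<forall>x\<in>Y. offset_ok F (B x) x (U x)) \<and>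
    (\<forall>x\<in>Y. \<forall>y\<in>Y. \<forall>h\<in>carrier G. (\<lambda>u. h \<otimes> u) ` U x \<subseteq> U y \<longrightarrow> x = y \<and> h = \<one>)"
  using assms(1-3)
proof (induction Y)
  case (insert x Y)
  have "\<exists>U. (\<forall>x\<in>Y. offset_ok F (B x) x (U x)) \<and>
    (\<forall>x\<in>Y. \<forall>y\<in>Y. \<forall>h\<in>carrier G. (\<lambda>u. h \<otimes> u) ` U x \<subseteq> U y \<longrightarrow> x = y \<and> h = \<one>)"
    by (rule insert.IH) (use insert.prems in auto)
  then obtain U where ok: "\<And>y. y\<in>Y \<Longrightarrow> offset_ok F (B y) y (U y)"
    and T: "\<And>y z h. y\<in>Y \<Longrightarrow> z\<in>Y \<Longrightarrow> h\<in>carrier G \<Longrightarrow> (\<lambda>u. h \<otimes> u) ` U y \<subseteq> U z \<Longrightarrow> y = z \<and> h = \<one>"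
    by blast
  note U = ok[unfolded offset_ok_def]
  \<comment> \<open>Left translation preserves the quotients \<open>inv u \<otimes> v\<close>.
    Forbidding those of the earlier triples means that the new triple shares at most one element
    with any translate of them.\<close>
  define F' where "F' = F \<union> (\<Union>y\<in>Y. \<Union>u\<in>U y. \<Union>v\<in>U y. {inv u \<otimes> v})"
  have "finite F'" using F U insert.hyps by (auto simp: F'_def)
  then obtain W where okW: "offset_ok F' (B x) x W"
    and stab: "\<And>h. h\<in>carrier G \<Longrightarrow> (\<lambda>u. h \<otimes> u) ` W \<subseteq> W \<Longrightarrow> h = \<one>"
    using offset_triple[of "B x" F' x] insert.prems by blast
  have W: "W \<subseteq> B x" "finite W" "card W = 3"
    "\<And>u v. u\<in>W \<Longrightarrow> v\<in>W \<Longrightarrow> u \<noteq> v \<Longrightarrow> inv u \<otimes> v \<notin> F'"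
    using okW by (auto simp: offset_ok_def)
  have two: "\<exists>u\<in>A. \<exists>v\<in>A. u \<noteq> v" if "card A = 3" for A :: "'a set"
    using that by (auto simp: card_3_iff)
  have quot: "inv (h \<otimes> u) \<otimes> (h \<otimes> v) = inv u \<otimes> v"
    if "h \<in> carrier G" "u \<in> carrier G" "v \<in> carrier G" for h u v
    using that by (simp add: inv_mult_group m_assoc)
  have no: "\<not> (\<lambda>u. h \<otimes> u) ` U y \<subseteq> W" "\<not> (\<lambda>u. h \<otimes> u) ` W \<subseteq> U y"
    if y: "y \<in> Y" and h: "h \<in> carrier G" for y h
  proof -
    have Uc: "U y \<subseteq> carrier G" using U[OF y] insert.prems(2)[of y] y by auto
    have Wc: "W \<subseteq> carrier G" using W(1) insert.prems(2)[of x] by auto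
    obtain u v where uv: "u \<in> U y" "v \<in> U y" "u \<noteq> v" using two U[OF y] by blast
    have uvF: "inv u \<otimes> v \<in> F'" using uv y by (auto simp: F'_def)
    show "\<not> (\<lambda>u. h \<otimes> u) ` U y \<subseteq> W"
    proof
      assume "(\<lambda>u. h \<otimes> u) ` U y \<subseteq> W"
      then have "h \<otimes> u \<in> W" "h \<otimes> v \<in> W" using uv by auto
      moreover have "h \<otimes> u \<noteq> h \<otimes> v" using uv Uc h by (simp add: subset_iff)
      ultimately have "inv (h \<otimes> u) \<otimes> (h \<otimes> v) \<notin> F'" using W(4) by blast
      then show False using quot[OF h] uv Uc uvF by (metis subsetD)
    qed
    obtain p q where pq: "p \<in> W" "q \<in> W" "p \<noteq> q" using two W(3) by blast
    show "\<not> (\<lambda>u. h \<otimes> u) ` W \<subseteq> U y"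
    proof
      assume "(\<lambda>u. h \<otimes> u) ` W \<subseteq> U y"
      then have "h \<otimes> p \<in> U y" "h \<otimes> q \<in> U y" using pq by auto
      then have "inv (h \<otimes> p) \<otimes> (h \<otimes> q) \<in> F'" using y by (auto simp: F'_def)
      then have "inv p \<otimes> q \<in> F'" using quot[OF h, of p q] pq Wc by (metis subsetD)
      then show False using W(4)[OF pq] by blast
    qed
  qed
  let ?U = "U(x := W)"
  have "offset_ok F (B x) x W" using okW by (auto simp: offset_ok_def F'_def)
  then have "offset_ok F (B y) y (?U y)" if "y \<in> insert x Y" for y
    using ok that by auto
  moreover have "y = z \<and> h = \<one>" if "y \<in> insert x Y" "z \<in> insert x Y" "h \<in> carrier G"
    "(\<lambda>u. h \<otimes> u) ` ?U y \<subseteq> ?U z" for y z h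
  proof -
    have "y \<in> Y" if "y \<noteq> x" using that \<open>y \<in> insert x Y\<close> by blast
    moreover have "z \<in> Y" if "z \<noteq> x" using that \<open>z \<in> insert x Y\<close> by blast
    ultimately show ?thesis
      using that(3,4) stab T no by (cases "y = x"; cases "z = x") auto
  qed
  ultimately show ?case by (intro exI[of _ ?U]) blast
qed auto

end

section \<open>Adjoining all missing generators at once\<close>

locale offset_ext = subgrp G H for G (structure) and H +
  fixes Y :: "'a set" and U :: "'a \<Rightarrow> 'a set" and F :: "'a set"
  assumes Y: "Y \<subseteq> carrier G" "finite Y"
    and irr: "\<And>x. x \<in> Y \<Longrightarrow> x \<notin> generate G (H \<union> (Y - {x}))"
    and gen: "generate G (H \<union> Y) = carrier G"
    and UH: "\<And>x. x \<in> Y \<Longrightarrow> U x \<subseteq> H" and Ufin: "\<And>x. x \<in> Y \<Longrightarrow> finite (U x)"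
    and Une: "\<And>x. x \<in> Y \<Longrightarrow> U x \<noteq> {}"
    and sep: "\<And>x u v. x \<in> Y \<Longrightarrow> u \<in> U x \<Longrightarrow> v \<in> U x \<Longrightarrow> u \<noteq> v \<Longrightarrow>
       inv u \<otimes> v \<notin> F \<and> x \<otimes> u \<otimes> inv v \<otimes> inv x \<notin> F \<and> x \<otimes> u \<otimes> (x \<otimes> v) \<notin> F"
    and transl: "\<And>x y h. x \<in> Y \<Longrightarrow> y \<in> Y \<Longrightarrow> h \<in> carrier G \<Longrightarrow>
       (\<lambda>u. h \<otimes> u) ` U x \<subseteq> U y \<Longrightarrow> x = y \<and> h = \<one>"
begin

definition V :: "'a set" where "V = (\<Union>x\<in>Y. (\<lambda>u. x \<otimes> u) ` U x)"

text \<open>A subgroup that detects the generator \<open>x\<close>: by \<open>irr\<close> it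
  contains all elements of \<open>V\<close> except those that belong to \<open>x\<close>.\<close>

definition L :: "'a \<Rightarrow> 'a set" where "L x = generate G (H \<union> (Y - {x}))"

lemma L_subgroup: "subgroup (L x) G"
  unfolding L_def using Y K_carrier by (intro generate_is_subgroup) auto

lemma H_L: "H \<subseteq> L x" by (auto simp: L_def intro: generate.incl)

lemma V_L: "x \<in> Y \<Longrightarrow> y \<in> Y \<Longrightarrow> u \<in> H \<Longrightarrow> y \<otimes> u \<in> L x \<longleftrightarrow> y \<noteq> x"
proof -
  assume a: "x \<in> Y" "y \<in> Y" "u \<in> H"
  have uL: "u \<in> L x" using H_L a by blast
  show ?thesis
  proof
    assume "y \<otimes> u \<in> L x"
    then have "(y \<otimes> u) \<otimes> inv u \<in> L x"
      using uL L_subgroup by (simp add: subgroup.m_closed subgroup.m_inv_closed)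
    then have "y \<in> L x" using a Y K_carrier by (auto simp: m_assoc)
    then show "y \<noteq> x" using irr a by (auto simp: L_def)
  next
    assume "y \<noteq> x"
    then have "y \<in> L x" using a by (auto simp: L_def intro: generate.incl)
    then show "y \<otimes> u \<in> L x" using uL L_subgroup by (simp add: subgroup.m_closed)
  qed
qed

lemma VE:
  assumes "c \<in> V" obtains x u where "x \<in> Y" "u \<in> U x" "u \<in> H" "c = x \<otimes> u"
    "x \<in> carrier G" "u \<in> carrier G"
proof -
  from assms obtain x u where "x \<in> Y" "u \<in> U x" "c = x \<otimes> u" unfolding V_def by blast
  then show thesis using that UH[of x] Y K_carrier by blast
qed

lemma V_carrier: "V \<subseteq> carrier G"
  by (auto elim!: VE)

lemma V_finite: "finite V"
  using Y Ufin by (auto simp: V_def)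

lemma V_H: "c \<in> V \<Longrightarrow> c \<notin> H"
  by (metis H_L V_L VE subsetD)

text \<open>Suppose that the product is xu. Every factor lies in \<open>L x\<close> or has the form
  xw. Two factors in \<open>L x\<close> cannot give xu, exactly one outside contradicts
  \<open>sep\<close>, and two outside would put an element xw' into \<open>H\<close>.\<close>

lemma V_not_product:
  assumes T: "T \<subseteq> H" "\<one> \<notin> T" "T \<subseteq> F" and ab: "a \<in> T \<union> V" "b \<in> T \<union> V"
  shows "a \<otimes> b \<notin> V"
proof
  assume "a \<otimes> b \<in> V"
  then obtain x u where x: "x \<in> Y" "u \<in> U x" "u \<in> H" "a \<otimes> b = x \<otimes> u" "x \<in> carrier G" "u \<in> carrier G"
    by (rule VE)
  have abc: "a \<in> carrier G" "b \<in> carrier G" using ab T K_carrier V_carrier by auto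
  have mem: "c \<in> L x \<or> (\<exists>w\<in>U x. w \<in> H \<and> c = x \<otimes> w)" if "c \<in> T \<union> V" for c
    using that
  proof
    assume "c \<in> T" then show ?thesis using T H_L by blast
  next
    assume "c \<in> V"
    then obtain y w where y: "y \<in> Y" "w \<in> U y" "w \<in> H" "c = y \<otimes> w" by (rule VE)
    then show ?thesis using V_L[OF x(1) y(1) y(3)] by auto
  qed
  have xL: "x \<otimes> u \<notin> L x" using V_L[OF x(1) x(1) x(3)] by simp
  have mL: "p \<otimes> q \<in> L x" if "p \<in> L x" "q \<in> L x" for p q
    using that L_subgroup by (simp add: subgroup.m_closed)
  consider "a \<in> L x" "b \<in> L x" | w where "w \<in> U x" "w \<in> H" "a = x \<otimes> w" "b \<in> L x"
    | w where "w \<in> U x" "w \<in> H" "b = x \<otimes> w" "a \<in> L x"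
    | w w' where "w \<in> H" "w' \<in> H" "a = x \<otimes> w" "b = x \<otimes> w'"
    using mem[OF ab(1)] mem[OF ab(2)] by blast
  then show False
  proof cases
    case 1 then show ?thesis using mL xL x(4) by metis
  next
    case 2
    have wc: "w \<in> carrier G" using 2 K_carrier by blast
    have "w \<otimes> b = u" using x 2(3) wc abc by (simp add: m_assoc)
    then have b: "b = inv w \<otimes> u" using wc abc by auto
    then have "b \<in> H" using 2 x K_closed by blast
    then have "b \<in> T" using ab V_H by blast
    then have "w \<noteq> u" using b T wc by auto
    then show False using sep[OF x(1) 2(1) x(2)] b \<open>b \<in> T\<close> T by blast
  next
    case 3
    have wc: "w \<in> carrier G" using 3 K_carrier by blast
    have a: "a = x \<otimes> u \<otimes> inv w \<otimes> inv x"
      using x(4-6) 3(3) wc abc by (metis inv_mult_group inv_solve_right m_assoc m_closed inv_closed)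
    \<comment> \<open>\<open>sep\<close> only speaks about \<open>F\<close>, so \<open>a\<close> has
      to be placed in \<open>T\<close> first. An element yv of \<open>V\<close> with y different
      from x is not in \<open>L y\<close>, while x, u and w are.\<close>
    have "a \<notin> V"
    proof
      assume "a \<in> V"
      then obtain y v where y: "y \<in> Y" "v \<in> U y" "v \<in> H" "a = y \<otimes> v" by (rule VE)
      then have "y \<noteq> x" using 3(4) V_L[OF x(1)] by blast
      then have xy: "x \<in> L y" using x(1) by (auto simp: L_def intro: generate.incl)
      have "u \<in> L y" "w \<in> L y" using x(3) 3(2) H_L by auto
      then have "a \<in> L y" unfolding a using xy L_subgroup
        by (simp add: subgroup.m_closed subgroup.m_inv_closed)
      then show False using V_L[OF y(1) y(1) y(3)] y(4) by simp
    qed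
    then have aT: "a \<in> T" using ab by blast
    then have "w \<noteq> u" using a T x wc by (auto simp: m_assoc)
    then show False using sep[OF x(1) x(2) 3(1)] a aT T by auto
  next
    case 4
    have wc: "w \<in> carrier G" "w' \<in> carrier G" using 4 K_carrier by auto
    then have "x \<otimes> (w \<otimes> (x \<otimes> w')) = x \<otimes> u" using x 4 by (simp add: m_assoc)
    then have "w \<otimes> (x \<otimes> w') = u" using x wc by simp
    then have "x \<otimes> w' = inv w \<otimes> u" using x wc by auto
    moreover have "inv w \<otimes> u \<in> H" using 4 x K_closed by blast
    ultimately have "x \<otimes> w' \<in> L x" using H_L by auto
    then show False using V_L[OF x(1) x(1) 4(2)] by simp
  qed
qed

text \<open>As the product lies in \<open>H\<close>, both factors belong to the same generator;
  otherwise \<open>L x\<close> would contain the product and one factor but not the other. Then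
  \<open>sep\<close> makes the offsets equal, so squares are the only new source of arcs that end in
  \<open>T\<close>.\<close>

lemma product_in_core:
  assumes T: "T \<subseteq> H" "T \<subseteq> F" and ab: "a \<in> T \<union> V" "b \<in> T \<union> V" "a \<otimes> b \<in> T" "a \<in> V \<or> b \<in> V"
  shows "\<exists>x\<in>Y. \<exists>u\<in>U x. x \<otimes> u \<otimes> (x \<otimes> u) \<in> T"
proof -
  have abc: "a \<in> carrier G" "b \<in> carrier G" using ab T K_carrier V_carrier by auto
  have aH: "a \<in> H \<longleftrightarrow> b \<in> H"
  proof
    assume "a \<in> H"
    then have "inv a \<otimes> (a \<otimes> b) \<in> H" using ab(3) T K_closed by blast
    then show "b \<in> H" using abc by simp
  next
    assume "b \<in> H"
    then have "(a \<otimes> b) \<otimes> inv b \<in> H" using ab(3) T K_closed by blast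
    then show "a \<in> H" using abc by (simp add: m_assoc)
  qed
  then have "a \<in> V" "b \<in> V" using ab V_H T by auto
  then obtain x u y v where x: "x \<in> Y" "u \<in> U x" "u \<in> H" "a = x \<otimes> u"
    and y: "y \<in> Y" "v \<in> U y" "v \<in> H" "b = y \<otimes> v" by (metis VE)
  have "x = y"
  proof (rule ccontr)
    assume n: "x \<noteq> y"
    then have "b \<in> L x" using V_L[OF x(1) y(1) y(3)] y(4) by simp
    moreover have "a \<otimes> b \<in> L x" using ab(3) T H_L by blast
    ultimately have "(a \<otimes> b) \<otimes> inv b \<in> L x"
      using L_subgroup by (simp add: subgroup.m_closed subgroup.m_inv_closed)
    then have "a \<in> L x" using abc by (simp add: m_assoc)
    then show False using V_L[OF x(1) x(1) x(3)] x(4) by simp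
  qed
  moreover have "u = v" using sep[OF x(1,2), of v] y x(4) \<open>x = y\<close> ab(3) T by auto
  ultimately show ?thesis using x y ab(3) by auto
qed

lemma generate_H_V: "carrier G \<subseteq> generate G (H \<union> V)"
proof -
  have "x \<in> generate G (H \<union> V)" if x: "x \<in> Y" for x
  proof -
    obtain u where u: "u \<in> U x" using Une[OF x] by blast
    then have uH: "u \<in> H" using UH[OF x] by blast
    have "x \<otimes> u \<in> generate G (H \<union> V)" using u x by (auto simp: V_def intro!: generate.incl)
    moreover have "inv u \<in> generate G (H \<union> V)" using uH K_closed by (auto intro: generate.incl)
    ultimately have "(x \<otimes> u) \<otimes> inv u \<in> generate G (H \<union> V)" by (rule generate.eng)
    then show ?thesis using x Y uH K_carrier by (auto simp: m_assoc)
  qed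
  then have "H \<union> Y \<subseteq> generate G (H \<union> V)" by (auto intro: generate.incl)
  moreover have "subgroup (generate G (H \<union> V)) G"
    using V_carrier K_carrier by (intro generate_is_subgroup) auto
  ultimately show ?thesis using generate_subgroup_incl gen by blast
qed

text \<open>An automorphism commutes with right multiplication by the fixed subgroup
  \<open>H\<close>. If it sends xu to yw, it therefore moves all points of \<open>V\<close> in the
  coset xH along, and translation by \<open>w \<otimes> inv u\<close> maps \<open>U x\<close> into
  \<open>U y\<close>; \<open>transl\<close> leaves only x = y and w = u.\<close>

lemma rigid_of_core:
  assumes T: "T \<subseteq> H" and H: "H \<subseteq> fixd (carrier G) (T \<union> V)"
  shows "rigid (carrier G) (T \<union> V)"
proof -
  interpret C: subgrp G "carrier G" by (rule subgrpI[OF subgroup_self])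
  let ?S = "T \<union> V"
  have Sc: "?S \<subseteq> carrier G" using T K_carrier V_carrier by auto
  have "?S - T = V" using T V_H by auto
  moreover have "invar (carrier G) ?S (?S - T)"
    by (intro C.invar_Diff C.invar_gens[OF Sc] C.invar_fixd) (use T H in auto)
  ultimately have iV: "invar (carrier G) ?S V" by simp
  have "V \<subseteq> fixd (carrier G) ?S"
  proof
    fix c assume c: "c \<in> V"
    then obtain x u where x: "x \<in> Y" "u \<in> U x" "u \<in> H" "c = x \<otimes> u" "x \<in> carrier G" "u \<in> carrier G"
      by (rule VE)
    have "f c = c" if f: "f \<in> aut1 (carrier G) ?S" for f
    proof -
      have "f c \<in> V" using iV f c by (auto simp: invar_def)
      then obtain y w where y: "y \<in> Y" "w \<in> U y" "w \<in> H" "f c = y \<otimes> w" "y \<in> carrier G" "w \<in> carrier G"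
        by (rule VE)
      let ?h = "w \<otimes> inv u"
      have "(\<lambda>v. ?h \<otimes> v) ` U x \<subseteq> U y"
      proof (clarify)
        fix v assume v: "v \<in> U x"
        then have vH: "v \<in> H" and vc: "v \<in> carrier G" using UH[OF x(1)] K_carrier by auto
        have "inv u \<otimes> v \<in> fixd (carrier G) ?S" using H vH x(3) K_closed by blast
        from C.fixd_mult[OF this f, of c]
        have e: "f (c \<otimes> (inv u \<otimes> v)) = f c \<otimes> (inv u \<otimes> v)" using x by simp
        have "c \<otimes> (inv u \<otimes> v) = x \<otimes> v" using x vc by (simp add: m_assoc)
        then have "c \<otimes> (inv u \<otimes> v) \<in> V" using v x by (auto simp: V_def)
        then have "f (c \<otimes> (inv u \<otimes> v)) \<in> V" using iV f unfolding invar_def by blast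
        then have "f c \<otimes> (inv u \<otimes> v) \<in> V" using e by simp
        moreover have "f c \<otimes> (inv u \<otimes> v) = y \<otimes> (?h \<otimes> v)" using x y vc by (simp add: m_assoc)
        ultimately have "y \<otimes> (?h \<otimes> v) \<in> V" by simp
        then obtain z t where z: "z \<in> Y" "t \<in> U z" "t \<in> H" "y \<otimes> (?h \<otimes> v) = z \<otimes> t"
          "z \<in> carrier G" "t \<in> carrier G" by (rule VE)
        have hvH: "?h \<otimes> v \<in> H" by (intro K_closed y(3) x(3) vH)
        have "z = y" using V_L[OF y(1) y(1) hvH] V_L[OF y(1) z(1) z(3)] z(4) by metis
        have "y \<otimes> (?h \<otimes> v) = y \<otimes> t" using z(4) \<open>z = y\<close> by simp
        then have "?h \<otimes> v = t" using l_cancel z(6) y(5) K_carrier[OF hvH] by blast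
        then show "?h \<otimes> v \<in> U y" using z(2) \<open>z = y\<close> by simp
      qed
      moreover have "?h \<in> carrier G" using x y by simp
      ultimately have h: "x = y" "?h = \<one>" using transl[OF x(1) y(1)] by blast+
      have "w = ?h \<otimes> u" using x y by (simp add: m_assoc)
      then have "w = u" using h(2) x(6) by simp
      then show ?thesis using x(4) y(4) h(1) by simp
    qed
    then show "c \<in> fixd (carrier G) ?S" using c V_carrier by (auto simp: fixd_def)
  qed
  moreover note generate_H_V
  ultimately show ?thesis using H by (intro C.rigidI[of "H \<union> V"]) auto
qed

end

context offset_ext
begin

lemma DRR_of_core:
  assumes T: "T \<subseteq> H" "\<one> \<notin> T" "H \<subseteq> generate G T" and H: "H \<subseteq> fixd (carrier G) (T \<union> V)"
  shows "is_DRR G (T \<union> V)"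
proof -
  have Sc: "T \<union> V \<subseteq> carrier G" using T K_carrier V_carrier by auto
  have "H \<subseteq> generate G (T \<union> V)" using T(3) mono_generate[of T "T \<union> V"] by auto
  moreover have "V \<subseteq> generate G (T \<union> V)" by (auto intro: generate.incl)
  ultimately have "generate G (H \<union> V) \<subseteq> generate G (T \<union> V)"
    by (intro generate_subgroup_incl generate_is_subgroup Sc) auto
  then have "generate G (T \<union> V) = carrier G" using generate_H_V generate_incl[OF Sc] by blast
  then show ?thesis using Sc T V_H K_closed(3) rigid_of_core[OF T(1) H] by (auto simp: is_DRR_iff)
qed

end

context group
begin

lemma irredundant_extension:
  assumes H: "subgroup H G" and A: "finite A" "A \<subseteq> carrier G" "generate G (H \<union> A) = carrier G"
  shows "\<exists>Y. finite Y \<and> Y \<subseteq> carrier G \<and> generate G (H \<union> Y) = carrier G \<and>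
    (\<forall>x\<in>Y. x \<notin> generate G (H \<union> (Y - {x})))"
  using A
proof (induction A rule: finite_psubset_induct)
  case (psubset A)
  show ?case
  proof (cases "\<forall>x\<in>A. x \<notin> generate G (H \<union> (A - {x}))")
    case False
    then obtain x where x: "x \<in> A" "x \<in> generate G (H \<union> (A - {x}))" by blast
    have c: "H \<union> (A - {x}) \<subseteq> carrier G" using psubset.prems subgroup.subset[OF H] by auto
    have "H \<union> A \<subseteq> generate G (H \<union> (A - {x}))" using x by (auto intro: generate.incl)
    then have "generate G (H \<union> A) \<subseteq> generate G (H \<union> (A - {x}))"
      by (rule generate_subgroup_incl[OF _ generate_is_subgroup[OF c]])
    then have "generate G (H \<union> (A - {x})) = carrier G" using psubset.prems generate_incl[OF c] by auto
    then show ?thesis using psubset.IH[of "A - {x}"] x psubset.prems by auto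
  qed (use psubset in blast)
qed

lemma offset_ext_exists:
  assumes H: "subgroup H G" and B: "\<And>x. x \<in> carrier G \<Longrightarrow> infinite (B x) \<and> B x \<subseteq> H" and F: "finite F"
    and A: "finite A" "A \<subseteq> carrier G" "generate G A = carrier G"
  shows "\<exists>Y U. offset_ext G H Y U F \<and> (\<forall>x\<in>Y. U x \<subseteq> B x)"
proof -
  have "generate G (H \<union> A) = carrier G"
    using mono_generate[of A "H \<union> A"] A generate_incl[of "H \<union> A"] subgroup.subset[OF H] by auto
  then obtain Y where Y: "finite Y" "Y \<subseteq> carrier G" "generate G (H \<union> Y) = carrier G"
    "\<And>x. x\<in>Y \<Longrightarrow> x \<notin> generate G (H \<union> (Y - {x}))"
    using irredundant_extension[OF H A(1,2)] by blast
  have Bc: "infinite (B x) \<and> B x \<subseteq> carrier G" if "x \<in> Y" for x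
    using B[of x] Y(2) that subgroup.subset[OF H] by blast
  obtain U where U: "\<forall>x\<in>Y. offset_ok F (B x) x (U x)"
    "\<forall>x\<in>Y. \<forall>y\<in>Y. \<forall>h\<in>carrier G. (\<lambda>u. h \<otimes> u) ` U x \<subseteq> U y \<longrightarrow> x = y \<and> h = \<one>"
    using offsets_exist[of Y B F, OF Y(1,2) Bc F] by blast
  have UB: "U x \<subseteq> B x" "finite (U x)" "card (U x) = 3" if "x \<in> Y" for x
    using U(1) that by (auto simp: offset_ok_def)
  have "offset_ext G H Y U F"
  proof (intro offset_ext.intro offset_ext_axioms.intro subgrpI[OF H])
    fix x assume x: "x \<in> Y"
    show "U x \<subseteq> H" using UB[OF x] B[of x] Y(2) x by blast
    show "finite (U x)" using UB[OF x] by simp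
    show "U x \<noteq> {}" using UB(3)[OF x] by auto
    fix u v assume "u \<in> U x" "v \<in> U x" "u \<noteq> v"
    then show "inv u \<otimes> v \<notin> F \<and> x \<otimes> u \<otimes> inv v \<otimes> inv x \<notin> F \<and> x \<otimes> u \<otimes> (x \<otimes> v) \<notin> F"
      using U(1) x by (auto simp: offset_ok_def)
  qed (use Y U(2) in blast)+
  then show ?thesis using UB by blast
qed

text \<open>The hypothesis \<open>core\<close> is required for all supersets of \<open>T\<close>
  whose inner products stay in \<open>T\<close>, because \<open>V\<close> is known only through its
  existence. The condition on cubes serves to avoid squares of new elements in
  \<open>T\<close>.\<close>

theorem DRR_of_infinite_subgroup:
  assumes H: "subgroup H G" "infinite H"
    and T: "finite T" "T \<subseteq> H" "\<one> \<notin> T" "H \<subseteq> generate G T" "\<And>t. t \<in> T \<Longrightarrow> t \<otimes> (t \<otimes> t) \<notin> T"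
    and core: "\<And>S. S \<subseteq> carrier G \<Longrightarrow> T \<subseteq> S \<Longrightarrow>
       (\<And>a b. a \<in> S \<Longrightarrow> b \<in> S \<Longrightarrow> a \<otimes> b \<in> S \<Longrightarrow> a \<in> T \<and> b \<in> T \<and> a \<otimes> b \<in> T) \<Longrightarrow>
       T \<subseteq> fixd (carrier G) S"
    and A: "finite A" "A \<subseteq> carrier G" "generate G A = carrier G"
  shows "\<exists>S. finite S \<and> is_DRR G S"
proof -
  interpret H: subgrp G H by (rule subgrpI[OF H(1)])
  interpret C: subgrp G "carrier G" by (rule subgrpI[OF subgroup_self])
  define B where "B x = {u \<in> H. x \<otimes> u \<otimes> (x \<otimes> u) \<notin> T}" for x
  (* If the square t of x u lies in T then x (u t) has square t^3, which is not in T. *)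
  have infB: "infinite (B x)" if x: "x \<in> carrier G" for x
  proof
    assume fin: "finite (B x)"
    let ?N = "B x \<union> (\<Union>t\<in>T. (\<lambda>b. b \<otimes> inv t) ` B x)"
    have "infinite (H - ?N)" using H(2) fin T(1) by (intro Diff_infinite_finite) auto
    then have "\<exists>u. u \<in> H - ?N" by (metis all_not_in_conv finite.emptyI)
    then obtain u where u: "u \<in> H" "u \<notin> ?N" by blast
    let ?g = "x \<otimes> u" let ?t = "?g \<otimes> ?g"
    have uc: "u \<in> carrier G" using u H.K_carrier by blast
    have t: "?t \<in> T" using u by (auto simp: B_def)
    have "u \<otimes> ?t \<notin> B x"
    proof
      assume "u \<otimes> ?t \<in> B x"
      moreover have "u = u \<otimes> ?t \<otimes> inv ?t" using x uc by (simp add: m_assoc)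
      ultimately show False using u(2) t by blast
    qed
    moreover have "u \<otimes> ?t \<in> H" by (rule H.K_closed(1)[OF u(1) subsetD[OF T(2) t]])
    ultimately have "x \<otimes> (u \<otimes> ?t) \<otimes> (x \<otimes> (u \<otimes> ?t)) \<in> T" by (auto simp: B_def)
    moreover have "x \<otimes> (u \<otimes> ?t) \<otimes> (x \<otimes> (u \<otimes> ?t)) = ?t \<otimes> (?t \<otimes> ?t)"
      using x uc by (simp add: m_assoc)
    ultimately show False using T(5)[OF t] by simp
  qed
  obtain Y U where ext: "offset_ext G H Y U T" and UB: "\<And>x. x\<in>Y \<Longrightarrow> U x \<subseteq> B x"
    using offset_ext_exists[OF H(1) _ T(1) A, of B] infB by (auto simp: B_def)
  interpret offset_ext G H Y U T by (rule ext)
  have Sc: "T \<union> V \<subseteq> carrier G" using T H.K_carrier V_carrier by auto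
  have "T \<subseteq> fixd (carrier G) (T \<union> V)"
  proof (rule core[OF Sc])
    fix a b assume ab: "a \<in> T \<union> V" "b \<in> T \<union> V" "a \<otimes> b \<in> T \<union> V"
    then have p: "a \<otimes> b \<in> T" using V_not_product[OF T(2,3) subset_refl] by blast
    have "\<not> (a \<in> V \<or> b \<in> V)"
    proof
      assume "a \<in> V \<or> b \<in> V"
      then obtain x u where "x \<in> Y" "u \<in> U x" "x \<otimes> u \<otimes> (x \<otimes> u) \<in> T"
        using product_in_core[OF T(2) subset_refl ab(1,2) p] by blast
      then show False using UB by (auto simp: B_def)
    qed
    then show "a \<in> T \<and> b \<in> T \<and> a \<otimes> b \<in> T" using ab p by blast
  qed auto
  then have "H \<subseteq> fixd (carrier G) (T \<union> V)" using T(4) C.generate_fixd by blast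
  then have "is_DRR G (T \<union> V)" by (rule DRR_of_core[OF T(2,3,4)])
  then show ?thesis using T(1) V_finite by blast
qed

text \<open>Otherwise xKx is contained in \<open>K\<close>; with k = 1 this gives that x^2 is in
  \<open>K\<close>, and then that x normalises \<open>K\<close>. So \<open>K\<close> together with
  the coset xK would be a finite subgroup containing x.\<close>

lemma square_outside:
  assumes K: "subgroup K G" "finite K" and x: "x \<in> carrier G" and inf: "infinite (generate G (insert x K))"
  shows "\<exists>k\<in>K. x \<otimes> k \<otimes> (x \<otimes> k) \<notin> K"
proof (rule ccontr)
  assume neg: "\<not> ?thesis"
  interpret K: subgrp G K by (rule subgrpI[OF K(1)])
  have xkx: "x \<otimes> (k \<otimes> x) \<in> K" if k: "k \<in> K" for k
  proof -
    have "x \<otimes> k \<otimes> (x \<otimes> k) \<in> K" using neg k by auto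
    then have "(x \<otimes> k \<otimes> (x \<otimes> k)) \<otimes> inv k \<in> K" by (rule K.K_closed(1)[OF _ K.K_closed(2)[OF k]])
    then show ?thesis using x k K.K_carrier by (simp add: m_assoc)
  qed
  have xx: "x \<otimes> x \<in> K" using xkx[OF K.K_closed(3)] x by simp
  have cx: "inv x \<otimes> (k \<otimes> x) \<in> K" if k: "k \<in> K" for k
  proof -
    have "inv (x \<otimes> x) \<otimes> (x \<otimes> (k \<otimes> x)) \<in> K" using xkx[OF k] xx K.K_closed by blast
    then show ?thesis using x K.K_carrier[OF k] by (simp add: m_assoc inv_mult_group)
  qed
  let ?M = "K \<union> (\<lambda>k. x \<otimes> k) ` K"
  have left: "k \<otimes> (x \<otimes> k') \<in> ?M" if k: "k \<in> K" "k' \<in> K" for k k'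
  proof -
    have "k \<otimes> (x \<otimes> k') = x \<otimes> ((inv x \<otimes> (k \<otimes> x)) \<otimes> k')" using x k K.K_carrier by (simp add: m_assoc)
    then show ?thesis using cx[OF k(1)] k(2) K.K_closed(1) by blast
  qed
  have "subgroup ?M G"
  proof (rule subgroupI)
    show "?M \<subseteq> carrier G" using x K.K_carrier by auto
    show "?M \<noteq> {}" using K.K_closed by auto
  next
    fix a assume "a \<in> ?M"
    then consider "a \<in> K" | k where "k \<in> K" "a = x \<otimes> k" by blast
    then show "inv a \<in> ?M"
    proof cases
      case 2
      have "inv a = x \<otimes> ((inv x \<otimes> (inv k \<otimes> x)) \<otimes> inv (x \<otimes> x))"
        using 2 x K.K_carrier by (simp add: m_assoc inv_mult_group)
      then show ?thesis using cx[of "inv k"] xx 2 K.K_closed by blast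
    qed (use K.K_closed in auto)
  next
    fix a b assume "a \<in> ?M" and b: "b \<in> ?M"
    then consider "a \<in> K" | k where "k \<in> K" "a = x \<otimes> k" by blast
    then show "a \<otimes> b \<in> ?M"
    proof cases
      case 1
      then show ?thesis using b left K.K_closed(1) by blast
    next
      case 2
      have bb: "b \<in> K \<or> (\<exists>k'\<in>K. b = x \<otimes> k')" using b by blast
      show ?thesis
      proof (cases "b \<in> K")
        case True
        then have "a \<otimes> b = x \<otimes> (k \<otimes> b)" using 2 x K.K_carrier by (simp add: m_assoc)
        then show ?thesis using True 2 K.K_closed(1) by blast
      next
        case False
        then obtain k' where k': "k' \<in> K" "b = x \<otimes> k'" using bb by blast
        then have "a \<otimes> b = (x \<otimes> (k \<otimes> x)) \<otimes> k'" using 2 x K.K_carrier by (simp add: m_assoc)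
        then show ?thesis using xkx[OF 2(1)] k'(1) K.K_closed(1) by simp
      qed
    qed
  qed
  moreover have "x \<in> ?M" using K.K_closed(3) x by (metis UnI2 image_eqI r_one)
  ultimately have "generate G (insert x K) \<subseteq> ?M" by (intro generate_subgroup_incl) auto
  moreover have "finite ?M" using K(2) by simp
  ultimately show False using inf finite_subset by blast
qed

text \<open>The connection set consists of \<open>D = K - {\<one>} - T'\<close>, two elements \<open>p\<close> and \<open>q = p \<otimes> l\<close> outside \<open>K\<close> that
  lie in one coset of \<open>K\<close>, and further elements in pairwise different cosets. Asymmetry of \<open>T'\<close>
  provides an \<open>l \<in> D\<close> whose inverse is not in \<open>D\<close>, so that there is no arc from \<open>q\<close> to \<open>p\<close>.\<close>

theorem DRR_of_finite_subgroup:
  assumes K: "sparse K T'" "asymmetric T'" and x0: "x0 \<in> carrier G"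
    and inf: "infinite (generate G (insert x0 K))"
    and A: "finite A" "A \<subseteq> carrier G" "generate G A = carrier G"
  shows "\<exists>S. finite S \<and> is_DRR G S"
proof -
  have sK: "subgroup K G" "finite K" and T': "T' \<subseteq> K" "2 * card T' + 4 \<le> card K"
    using K by (auto simp: sparse_def)
  interpret K: subgrp G K by (rule subgrpI[OF sK(1)])
  interpret C: subgrp G "carrier G" by (rule subgrpI[OF subgroup_self])
  define H where "H = generate G (insert x0 K)"
  have sH: "subgroup H G" unfolding H_def using x0 K.K_carrier by (intro generate_is_subgroup) auto
  interpret H: subgrp G H by (rule subgrpI[OF sH])
  have KH: "K \<subseteq> H" "x0 \<in> H" by (auto simp: H_def intro: generate.incl)
  define D where "D = K - {\<one>} - T'"
  have DK: "D \<subseteq> K" "\<one> \<notin> D" by (auto simp: D_def)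
  obtain a where a: "a \<in> T'" "a \<otimes> a \<noteq> \<one>" "inv a \<notin> T'" using K(2) by (auto simp: asymmetric_def)
  have aK: "a \<in> K" and ac: "a \<in> carrier G" using a T' K.K_carrier by auto
  define l where "l = inv a"
  have l: "l \<in> D" "inv l \<notin> D" "l \<in> K" "l \<in> carrier G" "l \<otimes> l \<noteq> \<one>" "inv l \<in> K"
    using a aK ac K.K_closed by (auto simp: D_def l_def inv_mult_group[symmetric])
  \<comment> \<open>If q^2 were in \<open>K\<close>, then q could have arcs to q^2 or to qp = q^2
    l^{-1} inside \<open>D\<close>; with q^2 outside \<open>K\<close> it has no out-neighbour in
    \<open>S1\<close>.\<close>
  obtain k where k: "k \<in> K" "x0 \<otimes> k \<otimes> (x0 \<otimes> k) \<notin> K"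
    using square_outside[OF sK x0 inf] by blast
  define q where "q = x0 \<otimes> k"
  define p where "p = q \<otimes> inv l"
  have q: "q \<in> H" "q \<in> carrier G" "q \<otimes> q \<notin> K"
    using k KH H.K_closed H.K_carrier by (auto simp: q_def)
  then have qK: "q \<notin> K" using K.K_closed by blast
  have p: "p \<in> H" "p \<in> carrier G" using q l KH H.K_closed H.K_carrier by (auto simp: p_def)
  have pl: "p \<otimes> l = q" using q l by (simp add: p_def m_assoc)
  have pK: "p \<notin> K" using pl qK l K.K_closed(1) by blast
  have pq1: "inv p \<otimes> q = l" unfolding pl[symmetric] using p l by simp
  have "inv q \<otimes> p = inv l" unfolding p_def using q l by simp
  note pq = pq1 this
  have pneq: "p \<noteq> q" using pq(1) l p q by auto
  define T where "T = insert p (insert q D)"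
  have T: "T \<subseteq> H" "\<one> \<notin> T" "finite T" using DK KH p q pK qK sK K.K_closed by (auto simp: T_def D_def)
  have KT: "t \<in> T \<Longrightarrow> t \<in> K \<longleftrightarrow> t \<in> D" for t using DK pK qK by (auto simp: T_def)
  have "\<And>x. infinite H \<and> H \<subseteq> H" using inf by (simp add: H_def)
  then obtain Y U where ext: "offset_ext G H Y U (T \<union> K)"
    using offset_ext_exists[OF sH _ _ A, of "\<lambda>_. H" "T \<union> K"] T(3) sK(2) by blast
  interpret offset_ext G H Y U "T \<union> K" by (rule ext)
  let ?C = "carrier G" let ?S = "T \<union> V"
  have Sc: "?S \<subseteq> ?C" using T H.K_carrier V_carrier by auto
  have SH: "s \<in> ?S \<Longrightarrow> s \<in> H \<longleftrightarrow> s \<in> T" for s using T V_H by auto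
  note iS = C.invar_gens[OF Sc]
  have Hq: "inv s \<otimes> t \<in> H" if "s \<in> T" "t \<in> T" for s t
    using that T(1) H.K_closed by blast
  have Tq: "inv s \<otimes> t \<in> T" if "s \<in> T" "t \<in> T" "inv s \<otimes> t \<in> ?S" for s t
    using that Hq SH by blast
  have Tc: "t \<in> carrier G" if "t \<in> T" for t using that Sc by blast
  define S1 where "S1 = {s \<in> ?S. \<exists>t\<in>?S. inv t \<otimes> s \<in> ?S}"
  have iS1: "invar ?C ?S S1" unfolding S1_def by (rule C.invar_in[OF iS iS iS])
  have S1T: "S1 \<subseteq> T"
  proof
    fix s assume "s \<in> S1"
    then obtain t where t: "s \<in> ?S" "t \<in> ?S" "inv t \<otimes> s \<in> ?S" by (auto simp: S1_def)
    have "t \<otimes> (inv t \<otimes> s) \<notin> V" using V_not_product[OF T(1,2) _ t(2,3)] by blast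
    then show "s \<in> T" using t Sc by (auto simp: subset_iff)
  qed
  have cnt: "2 \<le> card {s \<in> D. inv s \<otimes> g \<in> D}" "2 \<le> card {s \<in> D. inv g \<otimes> s \<in> D}" if "g \<in> K" for g
    using dense_count[OF sK T' that] by (simp_all add: D_def)
  have DS1: "D \<subseteq> S1"
  proof
    fix s assume s: "s \<in> D"
    then obtain t where "t \<in> D" "inv t \<otimes> s \<in> D" using card2_ex[OF cnt(1)[of s]] DK by auto
    then show "s \<in> S1" using s by (auto simp: S1_def T_def)
  qed
  (* Inside S1, the vertex p has at most one in-neighbour and q has no out-neighbour. *)
  define W where "W = {s \<in> {s \<in> S1. 2 \<le> card {t \<in> S1. inv t \<otimes> s \<in> ?S}}. \<exists>t\<in>S1. inv s \<otimes> t \<in> ?S}"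
  have iW: "invar ?C ?S W" unfolding W_def
    by (intro C.invar_out[OF _ iS1 iS] C.invar_count_in[OF iS1 iS1 iS])
  have "D \<subseteq> W"
  proof
    fix s assume s: "s \<in> D"
    have sK: "s \<in> K" using s DK by blast
    have "card {t \<in> D. inv t \<otimes> s \<in> D} \<le> card {t \<in> S1. inv t \<otimes> s \<in> ?S}"
      using DS1 finite_subset[OF S1T T(3)] by (intro card_mono) (auto simp: T_def)
    moreover obtain t where "t \<in> D" "inv s \<otimes> t \<in> D" using card2_ex[OF cnt(2)[OF sK]] by auto
    ultimately show "s \<in> W" using cnt(1)[OF sK] s DS1 by (auto simp: W_def T_def)
  qed
  moreover have "p \<notin> W"
  proof -
    \<comment> \<open>The one in-neighbour that cannot be ruled out is the solution of tq = p, hence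
      the threshold 2 in \<open>W\<close>.\<close>
    have "{t \<in> S1. inv t \<otimes> p \<in> ?S} \<subseteq> {p \<otimes> inv q}"
    proof
      fix t assume "t \<in> {t \<in> S1. inv t \<otimes> p \<in> ?S}"
      then have t: "t \<in> T" "inv t \<otimes> p \<in> ?S" using S1T by auto
      then have "inv t \<otimes> p \<in> T" using Tq[of t p] by (simp add: T_def)
      moreover have tc: "t \<in> carrier G" using t Tc by blast
      moreover have "inv t \<otimes> p \<notin> D" if "t \<in> D"
      proof
        assume "inv t \<otimes> p \<in> D"
        then have "t \<otimes> (inv t \<otimes> p) \<in> K" using that DK K.K_closed(1) by blast
        then show False using pK tc p by simp
      qed
      moreover have "inv t \<otimes> p \<noteq> p" if "t \<in> D"
      proof
        assume "inv t \<otimes> p = p"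
        then have "inv t = \<one>" using tc p by simp
        then show False using that DK tc by (metis inv_eq_1_iff)
      qed
      moreover have "t = p \<otimes> inv q" if "inv t \<otimes> p = q"
      proof -
        have "p = t \<otimes> q" using tc p that by auto
        then show ?thesis using tc q by (simp add: m_assoc)
      qed
      moreover have "t \<noteq> q" using \<open>inv t \<otimes> p \<in> T\<close> pq(2) l KT[of "inv l"] by auto
      moreover have "t \<noteq> p" using \<open>inv t \<otimes> p \<in> T\<close> p T(2) by auto
      ultimately show "t \<in> {p \<otimes> inv q}" using t(1) by (auto simp: T_def)
    qed
    then have "card {t \<in> S1. inv t \<otimes> p \<in> ?S} \<le> 1" using card_mono[of "{p \<otimes> inv q}"] by fastforce
    then show ?thesis by (auto simp: W_def)
  qed
  moreover have "q \<notin> W"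
  proof
    assume "q \<in> W"
    then obtain t where t: "t \<in> T" "inv q \<otimes> t \<in> ?S" using S1T by (auto simp: W_def)
    then have r: "inv q \<otimes> t \<in> T" using Tq[of q t] by (simp add: T_def)
    have tc: "t \<in> carrier G" using t Tc by blast
    have tr: "t = q \<otimes> (inv q \<otimes> t)" using tc q by simp
    have "t \<noteq> q" using r q T(2) by auto
    moreover have "t \<noteq> p" using r pq(2) l KT[of "inv l"] by auto
    ultimately have tD: "t \<in> D" using t by (auto simp: T_def)
    have "inv q \<otimes> t \<notin> K"
    proof
      assume "inv q \<otimes> t \<in> K"
      then have "t \<otimes> inv (inv q \<otimes> t) \<in> K" using tD DK K.K_closed by blast
      then show False using qK tc q by (simp add: inv_mult_group)
    qed
    then have "inv q \<otimes> t = q \<or> inv q \<otimes> t = p" using r DK by (auto simp: T_def)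
    then show False
    proof
      assume "inv q \<otimes> t = q"
      then show False using tr tD DK q(3) by auto
    next
      assume "inv q \<otimes> t = p"
      then have "t = q \<otimes> p" using tr by simp
      then have "t \<otimes> l = q \<otimes> q" using q p l pl by (simp add: m_assoc)
      moreover have "t \<otimes> l \<in> K" using tD DK l K.K_closed(1) by blast
      ultimately show False using q(3) by simp
    qed
  qed
  moreover have "W \<subseteq> T" using S1T by (auto simp: W_def)
  ultimately have WD: "W = D" by (auto simp: T_def)
  have Kf: "K \<subseteq> fixd ?C ?S"
    using dense_core_fixd[OF K(1) subgroup_self _ iW[unfolded WD D_def]] K.K_carrier by blast
  \<comment> \<open>With \<open>K\<close> fixed, its elements may be used as arc labels. The
    forbidden set for the offsets contains \<open>K\<close>, so p and q are the only elements
    outside \<open>D\<close> that share a left coset of \<open>K\<close> with another such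
    element.\<close>
  define P where "P = {s \<in> ?S - D. \<exists>t\<in>?S - D. inv s \<otimes> t \<in> K - {\<one>}}"
  have iP: "invar ?C ?S P" unfolding P_def
    using Kf DK by (intro C.invar_out C.invar_Diff iS C.invar_fixd) auto
  have "p \<in> ?S - D" "q \<in> ?S - D" using DK pK qK by (auto simp: T_def)
  moreover have "inv p \<otimes> q \<in> K - {\<one>}" "inv q \<otimes> p \<in> K - {\<one>}"
    unfolding pq using l by auto
  ultimately have "p \<in> P" "q \<in> P" unfolding P_def by blast+
  moreover have "s \<notin> V" if "s \<in> P" for s
  proof
    assume s: "s \<in> V"
    obtain t where t: "t \<in> ?S" "t \<notin> D" "inv s \<otimes> t \<in> K" "inv s \<otimes> t \<noteq> \<one>"
      using \<open>s \<in> P\<close> by (auto simp: P_def)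
    have sc: "s \<in> carrier G" "t \<in> carrier G" using s t Sc by auto
    have "t \<notin> H"
    proof
      assume "t \<in> H"
      moreover have "inv s \<otimes> t \<in> H" using t(3) KH by blast
      ultimately have "t \<otimes> inv (inv s \<otimes> t) \<in> H" by (rule H.K_closed(1)[OF _ H.K_closed(2)])
      then show False using sc V_H[OF s] by (simp add: inv_mult_group)
    qed
    then have tV: "t \<in> V" using t SH by blast
    obtain x u where x: "x \<in> Y" "u \<in> U x" "u \<in> H" "s = x \<otimes> u" "x \<in> carrier G" "u \<in> carrier G"
      using s by (rule VE)
    obtain y v where y: "y \<in> Y" "v \<in> U y" "v \<in> H" "t = y \<otimes> v" "y \<in> carrier G" "v \<in> carrier G"
      using tV by (rule VE)
    have "t = x \<otimes> (u \<otimes> (inv s \<otimes> t))" using x sc by (simp add: inv_mult_group m_assoc)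
    moreover have "u \<otimes> (inv s \<otimes> t) \<in> H" using x(3) t(3) KH H.K_closed(1) by blast
    ultimately have xy: "y = x" using V_L[OF x(1) y(1) y(3)] V_L[OF x(1) x(1)] y(4) by metis
    have e: "inv s \<otimes> t = inv u \<otimes> v" using x y xy by (simp add: inv_mult_group m_assoc)
    then have "u \<noteq> v" using t(4) x(6) by auto
    moreover have "v \<in> U x" "inv u \<otimes> v \<in> T \<union> K" using y(2) xy e t(3) by simp_all
    ultimately show False using sep[OF x(1,2), of v] by blast
  qed
  moreover have "P \<subseteq> ?S - D" unfolding P_def by blast
  ultimately have Ppq: "P = {p, q}" unfolding T_def by blast
  have "{s \<in> P. \<exists>t\<in>P. inv s \<otimes> t \<in> {l}} = {p}"
  proof -
    have "inv l \<noteq> l" using l by (metis r_inv)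
    moreover have "l \<noteq> \<one>" using l by auto
    ultimately show ?thesis unfolding Ppq using pq p q pneq by auto
  qed
  moreover have "invar ?C ?S {s \<in> P. \<exists>t\<in>P. inv s \<otimes> t \<in> {l}}"
    using Kf l by (intro C.invar_out iP C.invar_fixd) auto
  ultimately have ip: "invar ?C ?S {p}" by simp
  have "P - {p} = {q}" using Ppq pneq by auto
  then have qf: "q \<in> fixd ?C ?S" using C.invar_Diff[OF iP ip] C.invar_singleton by simp
  have sub: "x0 \<in> M" if "subgroup M G" "K \<subseteq> M" "q \<in> M" for M
  proof -
    have "q \<otimes> inv k \<in> M" using that k by (auto intro!: subgroup.m_closed subgroup.m_inv_closed)
    then show ?thesis using x0 k K.K_carrier by (simp add: q_def m_assoc)
  qed
  have "insert x0 K \<subseteq> fixd ?C ?S" using sub[OF C.fixd_subgroup Kf qf] Kf by blast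
  then have Hf: "H \<subseteq> fixd ?C ?S" unfolding H_def by (rule C.generate_fixd)
  have gT: "subgroup (generate G T) G" using T(1) H.K_carrier by (intro generate_is_subgroup) auto
  have "K \<subseteq> generate G T"
  proof
    fix g assume g: "g \<in> K"
    obtain s where s: "s \<in> D" "inv s \<otimes> g \<in> D" using card2_ex[OF cnt(1)[OF g]] by blast
    then have "s \<otimes> (inv s \<otimes> g) \<in> generate G T" by (intro generate.eng generate.incl) (auto simp: T_def)
    then show "g \<in> generate G T" using s g DK K.K_carrier by (auto simp: subset_iff)
  qed
  then have "insert x0 K \<subseteq> generate G T" using sub[OF gT] by (auto simp: T_def intro: generate.incl)
  then have "H \<subseteq> generate G T" unfolding H_def by (rule generate_subgroup_incl[OF _ gT])
  then have "is_DRR G ?S" using DRR_of_core[OF T(1,2) _ Hf] by blast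
  then show ?thesis using T(3) V_finite by blast
qed

text \<open>Generators are adjoined singly only as long as the subgroup remains finite; at the first
  infinite one the induction is abandoned and the whole set \<open>A\<close> is used again. The
  alternative of a finite group accommodates exponent two, where \<open>asymmetric\<close> never
  holds.\<close>

theorem DRR_of_sparse_subgroup:
  assumes "finite A" "A \<subseteq> carrier G" "generate G A = carrier G"
    and "sparse K T" "asymmetric T \<or> finite (carrier G)"
  shows "\<exists>S. finite S \<and> is_DRR G S"
proof -
  have "\<exists>S. finite S \<and> is_DRR G S" if "finite B" "B \<subseteq> carrier G" "generate G (K \<union> B) = carrier G"
    "sparse K T" "asymmetric T \<or> finite (carrier G)" for B
    using that
  proof (induction B arbitrary: K T rule: finite_induct)
    case empty
    then have "subgroup K G" by (simp add: sparse_def)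
    then have "K = carrier G" using empty generate_subgroup_eq by auto
    then have "finite (carrier G)" "is_DRR G (carrier G - {\<one>} - T)"
      using sparse_DRR[of T] empty(3) by (auto simp: sparse_def)
    then show ?case by (intro exI[of _ "carrier G - {\<one>} - T"]) simp
  next
    case (insert x B)
    have K: "subgroup K G" "finite K" using insert.prems by (auto simp: sparse_def)
    have xc: "x \<in> carrier G" using insert.prems by auto
    let ?H = "generate G (Set.insert x K)"
    have Kc: "K \<subseteq> carrier G" using subgroup.subset[OF K(1)] .
    show ?case
    proof (cases "x \<in> K")
      case True
      then show ?thesis using insert.IH[of K T] insert.prems by (simp add: insert_absorb)
    next
      case x: False
      show ?thesis
      proof (cases "finite ?H")
        case fin: True
        have "generate G (?H \<union> B) = generate G (Set.insert x K \<union> B)"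
          using generate_Un_absorb[of "Set.insert x K" B] xc Kc insert.prems by auto
        then have "generate G (?H \<union> B) = carrier G" using insert.prems by simp
        then show ?thesis
          using insert.IH[OF _ _ sparse_extend[OF insert.prems(3) xc x fin]]
            asymmetric_extend[OF insert.prems(3) xc x] insert.prems by auto
      next
        case inf: False
        have "?H \<subseteq> carrier G" by (rule generate_incl) (use xc Kc in auto)
        then have "infinite (carrier G)" using inf finite_subset by blast
        then have "asymmetric T" using insert.prems by blast
        then show ?thesis
          using DRR_of_finite_subgroup[OF insert.prems(3) _ xc inf assms(1-3)] by blast
      qed
    qed
  qed
  moreover have "generate G (K \<union> A) = carrier G"
    using mono_generate[of A "K \<union> A"] assms generate_incl[of "K \<union> A"]
    by (auto simp: sparse_def subgroup.subset)
  ultimately show ?thesis using assms by blast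
qed

end

subsection \<open>Groups with an infinite subgroup generated by two elements\<close>

context subgrp
begin

text \<open>All arcs inside \<open>S\<close> start at \<open>x\<close>, and there is one, from
  \<open>x\<close> to its square.\<close>

lemma fixd_of_square:
  assumes S: "S \<subseteq> K" "x \<in> S" "x \<otimes> x \<in> S"
    and prod: "\<And>a b. a \<in> S \<Longrightarrow> b \<in> S \<Longrightarrow> a \<otimes> b \<in> S \<Longrightarrow> a = x"
  shows "x \<in> fixd K S"
proof -
  have xc: "x \<in> carrier G" and Sc: "S \<subseteq> carrier G" using S K_carrier by auto
  have "{s \<in> S. \<exists>t\<in>S. inv s \<otimes> t \<in> S} = {x}"
  proof
    show "{x} \<subseteq> {s \<in> S. \<exists>t\<in>S. inv s \<otimes> t \<in> S}"
      using S xc by (auto intro!: bexI[of _ "x \<otimes> x"])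
    show "{s \<in> S. \<exists>t\<in>S. inv s \<otimes> t \<in> S} \<subseteq> {x}"
    proof
      fix s assume "s \<in> {s \<in> S. \<exists>t\<in>S. inv s \<otimes> t \<in> S}"
      then obtain t where t: "s \<in> S" "t \<in> S" "inv s \<otimes> t \<in> S" by blast
      then have "s \<otimes> (inv s \<otimes> t) \<in> S" using Sc by (auto simp: subset_iff)
      then show "s \<in> {x}" using prod[OF t(1,3)] by simp
    qed
  qed
  moreover have "invar K S {s \<in> S. \<exists>t\<in>S. inv s \<otimes> t \<in> S}"
    by (intro invar_out invar_gens S(1))
  ultimately show ?thesis by (simp add: invar_singleton)
qed

text \<open>The possible arcs inside \<open>S\<close> are x \<rightarrow> xy, which is always
  present, y \<rightarrow> x and xy \<rightarrow> y. With at most one of the latter two they form a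
  directed path, whose vertices are told apart by having in-neighbours or out-neighbours. With both
  they form a directed triangle, which \<open>DF\<close> excludes.\<close>

lemma fixd_of_triple:
  assumes S: "S \<subseteq> K" "x \<in> S" "y \<in> S" "x \<otimes> y \<in> S"
    and ne: "x \<noteq> y" "x \<noteq> \<one>" "y \<noteq> \<one>"
    and prod: "\<And>a b. a \<in> S \<Longrightarrow> b \<in> S \<Longrightarrow> a \<otimes> b \<in> S \<Longrightarrow> (a = x \<and> b = y) \<or>
      (a = y \<and> b = x \<otimes> y \<and> y \<otimes> (x \<otimes> y) = x) \<or> (a = x \<otimes> y \<and> b = x \<and> x \<otimes> y \<otimes> x = y)"
    and DF: "\<not> (y \<otimes> (x \<otimes> y) = x \<and> x \<otimes> y \<otimes> x = y)"
  shows "{x, y} \<subseteq> fixd K S"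
proof -
  have c: "x \<in> carrier G" "y \<in> carrier G" using S K_carrier by auto
  let ?w = "x \<otimes> y"
  have arc: "(s = x \<and> t = ?w) \<or> (s = y \<and> t = x \<and> y \<otimes> ?w = x) \<or> (s = ?w \<and> t = y \<and> ?w \<otimes> x = y)"
    if "s \<in> S" "t \<in> S" "inv s \<otimes> t \<in> S" for s t
  proof -
    have sc: "s \<in> carrier G" "t \<in> carrier G" using that S K_carrier by auto
    then have e: "s \<otimes> (inv s \<otimes> t) = t" by simp
    have "s \<otimes> (inv s \<otimes> t) \<in> S" using e that by simp
    from prod[OF that(1,3) this] show ?thesis using e by metis
  qed
  define O1 where "O1 = {s \<in> S. \<exists>t\<in>S. inv s \<otimes> t \<in> S}"
  define I1 where "I1 = {s \<in> S. \<exists>t\<in>S. inv t \<otimes> s \<in> S}"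
  have iv: "invar K S O1" "invar K S I1" unfolding O1_def I1_def
    by (intro invar_out invar_in invar_gens S(1))+
  have w: "?w \<noteq> x" "?w \<noteq> y" using c ne by simp_all
  have "x \<in> O1" using S c by (auto simp: O1_def intro!: bexI[of _ ?w])
  moreover have "?w \<in> I1" using S c by (auto simp: I1_def intro!: bexI[of _ x])
  ultimately have mem: "x \<in> O1" "?w \<in> I1" .
  have sub: "O1 \<subseteq> {x, y, ?w}" "I1 \<subseteq> {x, y, ?w}" using arc by (auto simp: O1_def I1_def)
  have y: "y \<in> O1 \<longleftrightarrow> y \<otimes> ?w = x" "x \<in> I1 \<longleftrightarrow> y \<otimes> ?w = x"
    "?w \<in> O1 \<longleftrightarrow> ?w \<otimes> x = y" "y \<in> I1 \<longleftrightarrow> ?w \<otimes> x = y"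
  proof -
    have D: "inv y \<otimes> x = ?w" if "y \<otimes> ?w = x" using c that by (metis m_inv_cancel(1) m_closed)
    have F: "inv ?w \<otimes> y = x" if "?w \<otimes> x = y" using c that by (metis m_inv_cancel(1) m_closed)
    have out: "s \<in> O1 \<longleftrightarrow> (\<exists>t\<in>S. inv s \<otimes> t \<in> S)" if "s \<in> S" for s using that by (simp add: O1_def)
    have inn: "s \<in> I1 \<longleftrightarrow> (\<exists>t\<in>S. inv t \<otimes> s \<in> S)" if "s \<in> S" for s using that by (simp add: I1_def)
    note w' = w w[symmetric] ne(1) ne(1)[symmetric]
    show "y \<in> O1 \<longleftrightarrow> y \<otimes> ?w = x" unfolding out[OF S(3)]
      using arc[OF S(3)] D S(2,4) w' by metis
    show "x \<in> I1 \<longleftrightarrow> y \<otimes> ?w = x" unfolding inn[OF S(2)]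
      using arc[OF _ S(2)] D S(3,4) w' by metis
    show "?w \<in> O1 \<longleftrightarrow> ?w \<otimes> x = y" unfolding out[OF S(4)]
      using arc[OF S(4)] F S(2,3) w' by metis
    show "y \<in> I1 \<longleftrightarrow> ?w \<otimes> x = y" unfolding inn[OF S(3)]
      using arc[OF _ S(3)] F S(2,4) w' by metis
  qed
  have "invar K S {x} \<and> invar K S {?w}"
  proof (cases "y \<otimes> ?w = x")
    case True
    then have "O1 = {x, y}" "I1 = {x, ?w}" using sub mem y DF by auto
    then have "O1 \<inter> I1 = {x}" "I1 - O1 = {?w}" using w ne by auto
    then show ?thesis using invar_Int[OF iv] invar_Diff[OF iv(2,1)] by simp
  next
    case D: False
    show ?thesis
    proof (cases "?w \<otimes> x = y")
      case True
      then have "O1 = {x, ?w}" "I1 = {y, ?w}" using sub mem y D by auto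
      then have "O1 \<inter> I1 = {?w}" "O1 - I1 = {x}" using w ne by auto
      then show ?thesis using invar_Int[OF iv] invar_Diff[OF iv] by simp
    next
      case False
      then have "O1 = {x}" "I1 = {?w}" using sub mem y D by auto
      then show ?thesis using iv by simp
    qed
  qed
  then have xw: "x \<in> fixd K S" "?w \<in> fixd K S" by (simp_all add: invar_singleton)
  then have "inv x \<otimes> ?w \<in> fixd K S"
    using fixd_subgroup by (simp add: subgroup.m_closed subgroup.m_inv_closed)
  then show ?thesis using xw c by simp
qed

end

context group
begin

lemma mult_eq_right_iffs:
  assumes "a \<in> carrier G" "b \<in> carrier G" "c \<in> carrier G" "d \<in> carrier G" "e \<in> carrier G"
  shows "a \<otimes> c = c \<longleftrightarrow> a = \<one>"
    "a \<otimes> (b \<otimes> c) = c \<longleftrightarrow> a \<otimes> b = \<one>"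
    "a \<otimes> (b \<otimes> (d \<otimes> c)) = c \<longleftrightarrow> a \<otimes> (b \<otimes> d) = \<one>"
    "a \<otimes> (b \<otimes> c) = d \<otimes> c \<longleftrightarrow> a \<otimes> b = d"
    "a \<otimes> (b \<otimes> (d \<otimes> c)) = e \<otimes> c \<longleftrightarrow> a \<otimes> (b \<otimes> d) = e"
    "a \<otimes> c = a \<longleftrightarrow> c = \<one>"
proof -
  show "a \<otimes> c = c \<longleftrightarrow> a = \<one>"
    "a \<otimes> c = a \<longleftrightarrow> c = \<one>" using assms by simp_all
  have r: "p \<otimes> c = q \<otimes> c \<longleftrightarrow> p = q" if "p \<in> carrier G" "q \<in> carrier G" for p q
    using that assms by simp
  show "a \<otimes> (b \<otimes> c) = c \<longleftrightarrow> a \<otimes> b = \<one>"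
    using r[of "a \<otimes> b" \<one>] assms by (simp add: m_assoc)
  show "a \<otimes> (b \<otimes> (d \<otimes> c)) = c \<longleftrightarrow> a \<otimes> (b \<otimes> d) = \<one>"
    using r[of "a \<otimes> (b \<otimes> d)" \<one>] assms by (simp add: m_assoc)
  show "a \<otimes> (b \<otimes> c) = d \<otimes> c \<longleftrightarrow> a \<otimes> b = d"
    using r[of "a \<otimes> b" d] assms by (simp add: m_assoc)
  show "a \<otimes> (b \<otimes> (d \<otimes> c)) = e \<otimes> c \<longleftrightarrow> a \<otimes> (b \<otimes> d) = e"
    using r[of "a \<otimes> (b \<otimes> d)" e] assms by (simp add: m_assoc)
qed

lemma noncommuting_facts:
  assumes c: "x \<in> carrier G" "y \<in> carrier G" and nc: "x \<otimes> y \<noteq> y \<otimes> x"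
  shows "x \<noteq> \<one>"
    "y \<noteq> \<one>"
    "x \<noteq> y"
    "x \<otimes> y \<noteq> \<one>"
    "y \<otimes> x \<noteq> \<one>"
    "x \<otimes> x \<noteq> y"
    "y \<otimes> y \<noteq> x"
    "y \<otimes> (x \<otimes> y) \<noteq> \<one>" "x \<otimes> (y \<otimes> x) \<noteq> \<one>"
proof -
  show "x \<noteq> \<one>" "y \<noteq> \<one>" "x \<noteq> y" using c nc by auto
  show "x \<otimes> x \<noteq> y" "y \<otimes> y \<noteq> x" using c nc by (auto simp: m_assoc)
  show "x \<otimes> y \<noteq> \<one>" using c nc by (metis inv_comm)
  show "y \<otimes> x \<noteq> \<one>" using c nc by (metis inv_comm)
  show "y \<otimes> (x \<otimes> y) \<noteq> \<one>"
  proof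
    assume a: "y \<otimes> (x \<otimes> y) = \<one>"
    then have "(x \<otimes> y) \<otimes> y = \<one>" using c inv_comm[of y "x \<otimes> y"] by simp
    then have "x \<otimes> y = inv y" "y \<otimes> x = inv y"
      using c a inv_equality[of "x \<otimes> y" y] inv_equality[of "y \<otimes> x" y] by (simp_all add: m_assoc)
    then show False using nc by simp
  qed
  show "x \<otimes> (y \<otimes> x) \<noteq> \<one>"
  proof
    assume a: "x \<otimes> (y \<otimes> x) = \<one>"
    then have "(y \<otimes> x) \<otimes> x = \<one>" using c inv_comm[of x "y \<otimes> x"] by simp
    then have "y \<otimes> x = inv x" "x \<otimes> y = inv x"
      using c a inv_equality[of "y \<otimes> x" x] inv_equality[of "x \<otimes> y" x] by (simp_all add: m_assoc)
    then show False using nc by simp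
  qed
qed

text \<open>There are 27 equations expressing a product of two members as a member. Cancellation
  turns all but three of them into relations that are excluded by noncommutativity or by the two
  squares.\<close>

lemma triple_products:
  assumes c: "x \<in> carrier G" "y \<in> carrier G" and nc: "x \<otimes> y \<noteq> y \<otimes> x"
    and sq: "x \<otimes> x \<noteq> \<one>" "y \<otimes> y \<noteq> \<one>"
    and ab: "a \<in> {x, y, x \<otimes> y}" "b \<in> {x, y, x \<otimes> y}" "a \<otimes> b \<in> {x, y, x \<otimes> y}"
  shows "(a = x \<and> b = y) \<or>
      (a = y \<and> b = x \<otimes> y \<and> y \<otimes> (x \<otimes> y) = x) \<or> (a = x \<otimes> y \<and> b = x \<and> x \<otimes> y \<otimes> x = y)"
proof -
  note f = noncommuting_facts[OF c nc]
  have f': "\<one> \<noteq> x" "\<one> \<noteq> y" "y \<noteq> x" "y \<noteq> x \<otimes> x" "x \<noteq> y \<otimes> y" "y \<otimes> x \<noteq> x \<otimes> y" using f nc by metis+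
  have n: "x \<otimes> x \<noteq> x" "x \<otimes> x \<noteq> x \<otimes> y" "x \<otimes> (x \<otimes> y) \<noteq> x" "x \<otimes> (x \<otimes> y) \<noteq> y"
    "x \<otimes> (x \<otimes> y) \<noteq> x \<otimes> y" "y \<otimes> x \<noteq> x" "y \<otimes> x \<noteq> y" "y \<otimes> y \<noteq> y" "y \<otimes> y \<noteq> x \<otimes> y"
    "y \<otimes> (x \<otimes> y) \<noteq> y" "y \<otimes> (x \<otimes> y) \<noteq> x \<otimes> y" "x \<otimes> (y \<otimes> x) \<noteq> x" "x \<otimes> (y \<otimes> x) \<noteq> x \<otimes> y"
    "x \<otimes> (y \<otimes> y) \<noteq> x" "x \<otimes> (y \<otimes> y) \<noteq> y" "x \<otimes> (y \<otimes> y) \<noteq> x \<otimes> y"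
    "x \<otimes> (y \<otimes> (x \<otimes> y)) \<noteq> x" "x \<otimes> (y \<otimes> (x \<otimes> y)) \<noteq> y" "x \<otimes> (y \<otimes> (x \<otimes> y)) \<noteq> x \<otimes> y"
    using c f f' sq by (simp_all add: mult_eq_right_iffs)
  have assoc: "x \<otimes> y \<otimes> x = x \<otimes> (y \<otimes> x)" "x \<otimes> y \<otimes> y = x \<otimes> (y \<otimes> y)"
    "x \<otimes> y \<otimes> (x \<otimes> y) = x \<otimes> (y \<otimes> (x \<otimes> y))" using c by (simp_all add: m_assoc)
  show ?thesis using ab unfolding insert_iff empty_iff
    by (elim disjE FalseE; simp add: assoc n f f' nc)
qed

lemma square_eq_oneD: "a \<in> carrier G \<Longrightarrow> a \<otimes> a = \<one> \<Longrightarrow> inv a = a"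
  by (simp add: inv_equality)

lemma generate_singleton_nat:
  assumes y: "y \<in> carrier G" and fin: "finite (generate G {y})" and g: "g \<in> generate G {y}"
  shows "\<exists>i::nat. g = y [^] i"
proof -
  have "ord y \<noteq> 0"
  proof -
    have "card (generate G {y}) \<noteq> 0" using fin g by auto
    then show ?thesis using generate_pow_card[OF y] by simp
  qed
  then show ?thesis using generate_pow_nat[OF y] g by blast
qed

text \<open>The products of \<open>C\<close> with powers of \<open>y\<close> form a finite subgroup.
  One inclusion under conjugation is enough, as negative powers of \<open>y\<close> are also
  positive powers.\<close>

lemma finite_generate_insert:
  assumes C: "subgroup C G" "finite C" and y: "y \<in> carrier G" "finite (generate G {y})"
    and norm: "\<And>c. c \<in> C \<Longrightarrow> y \<otimes> c \<otimes> inv y \<in> C"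
  shows "finite (generate G (insert y C))"
proof -
  interpret C: subgrp G C by (rule subgrpI[OF C(1)])
  interpret Y: subgrp G "generate G {y}" using y by (intro subgrpI generate_is_subgroup) auto
  let ?Y = "generate G {y}"
  have norm_pow: "y [^] i \<otimes> c \<otimes> inv (y [^] i) \<in> C" if "c \<in> C" for c and i :: nat
    using that
  proof (induction i arbitrary: c)
    case (Suc i)
    have "y [^] Suc i \<otimes> c \<otimes> inv (y [^] Suc i) = y [^] i \<otimes> (y \<otimes> c \<otimes> inv y) \<otimes> inv (y [^] i)"
      using Suc.prems C.K_carrier y by (simp add: m_assoc inv_mult_group)
    then show ?case using Suc.IH[OF norm[OF Suc.prems]] by simp
  qed (use C.K_carrier in auto)
  have norm_Y: "g \<otimes> c \<otimes> inv g \<in> C" if "g \<in> ?Y" "c \<in> C" for g c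
    using generate_singleton_nat[OF y that(1)] norm_pow[OF that(2)] by auto
  let ?M = "(\<lambda>(c, g). c \<otimes> g) ` (C \<times> ?Y)"
  have MI: "c \<otimes> g \<in> ?M" if "c \<in> C" "g \<in> ?Y" for c g using that by auto
  have "subgroup ?M G"
  proof (rule subgroupI)
    show "?M \<subseteq> carrier G" using C.K_carrier Y.K_carrier by auto
    show "?M \<noteq> {}" using C.K_closed Y.K_closed by auto
  next
    fix a assume "a \<in> ?M"
    then obtain c g where a: "c \<in> C" "g \<in> ?Y" "a = c \<otimes> g" by auto
    have m: "inv g \<otimes> inv c \<otimes> inv (inv g) \<in> C" by (rule norm_Y) (use a C.K_closed Y.K_closed in auto)
    have "inv a = (inv g \<otimes> inv c \<otimes> inv (inv g)) \<otimes> inv g"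
      using a C.K_carrier Y.K_carrier by (simp add: inv_mult_group m_assoc)
    then show "inv a \<in> ?M" using MI[OF m Y.K_closed(2)[OF a(2)]] by simp
  next
    fix a b assume "a \<in> ?M" "b \<in> ?M"
    then obtain c g d h where a: "c \<in> C" "g \<in> ?Y" "a = c \<otimes> g" "d \<in> C" "h \<in> ?Y" "b = d \<otimes> h" by auto
    have "a \<otimes> b = (c \<otimes> (g \<otimes> d \<otimes> inv g)) \<otimes> (g \<otimes> h)"
      using a C.K_carrier Y.K_carrier by (simp add: m_assoc)
    then show "a \<otimes> b \<in> ?M" using MI[OF C.K_closed(1)[OF a(1) norm_Y[OF a(2,4)]] Y.K_closed(1)[OF a(2,5)]] by simp
  qed
  moreover have "c \<in> ?M" if "c \<in> C" for c
    using MI[OF that Y.K_closed(3)] that C.K_carrier by simp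
  moreover have "y \<in> ?M" using MI[OF C.K_closed(3), of y] y by (simp add: generate.incl)
  ultimately have "generate G (insert y C) \<subseteq> ?M" by (intro generate_subgroup_incl) auto
  moreover have "finite ?M" using C(2) y(2) by simp
  ultimately show ?thesis by (rule finite_subset)
qed

lemma generate_mono2:
  assumes "A \<subseteq> generate G B" "B \<subseteq> carrier G" shows "generate G A \<subseteq> generate G B"
  using assms by (intro generate_subgroup_incl generate_is_subgroup)

lemma conj_generate:
  assumes A: "A \<subseteq> carrier G" and y: "y \<in> carrier G"
    and conj: "\<And>a. a \<in> A \<Longrightarrow> y \<otimes> a \<otimes> inv y \<in> generate G A" and g: "g \<in> generate G A"
  shows "y \<otimes> g \<otimes> inv y \<in> generate G A"
proof -
  interpret K: subgrp G "generate G A" by (rule generate_subgrp[OF A])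
  show ?thesis using g
  proof (induction g rule: generate.induct)
    case one
    then show ?case using y K.K_closed by simp
  next
    case (incl h)
    then show ?case by (rule conj)
  next
    case (inv h)
    then have "h \<in> carrier G" using A by auto
    then have "y \<otimes> inv h \<otimes> inv y = inv (y \<otimes> h \<otimes> inv y)" using y by (simp add: m_assoc inv_mult_group)
    then show ?case using K.K_closed(2)[OF conj[OF inv]] by simp
  next
    case (eng h1 h2)
    then have "h1 \<in> carrier G" "h2 \<in> carrier G" using K.K_carrier by auto
    then have "y \<otimes> (h1 \<otimes> h2) \<otimes> inv y = (y \<otimes> h1 \<otimes> inv y) \<otimes> (y \<otimes> h2 \<otimes> inv y)"
      using y by (simp add: m_assoc)
    then show ?case using eng K.K_closed(1) by simp
  qed
qed

lemma finite_generate_pair: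
  assumes xy: "x \<in> carrier G" "y \<in> carrier G"
    and fin: "finite (generate G {x})" "finite (generate G {y})"
    and norm: "y \<otimes> x \<otimes> inv y \<in> generate G {x}"
  shows "finite (generate G {x, y})"
proof -
  have sub: "subgroup (generate G {x}) G" using xy by (intro generate_is_subgroup) auto
  have pw: "y \<otimes> x [^] i \<otimes> inv y = (y \<otimes> x \<otimes> inv y) [^] i" for i :: nat
  proof (induction i)
    case (Suc i)
    have "y \<otimes> x [^] Suc i \<otimes> inv y = (y \<otimes> x [^] i \<otimes> inv y) \<otimes> (y \<otimes> x \<otimes> inv y)"
      using xy by (simp add: m_assoc)
    then show ?case using Suc by simp
  qed (use xy in simp)
  have "finite (generate G (insert y (generate G {x})))"
  proof (rule finite_generate_insert[OF sub fin(1) xy(2) fin(2)])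
    fix c assume "c \<in> generate G {x}"
    then obtain i :: nat where "c = x [^] i" using generate_singleton_nat[OF xy(1) fin(1)] by blast
    then have "y \<otimes> c \<otimes> inv y = (y \<otimes> x \<otimes> inv y) [^] i" using pw by simp
    moreover have "(y \<otimes> x \<otimes> inv y) [^] i \<in> generate G {x}"
      using norm sub by (induction i) (auto simp: subgroup.one_closed subgroup.m_closed)
    ultimately show "y \<otimes> c \<otimes> inv y \<in> generate G {x}" by simp
  qed
  moreover have "generate G {x, y} \<subseteq> generate G (insert y (generate G {x}))"
    by (rule mono_generate) (auto intro: generate.incl)
  ultimately show ?thesis using finite_subset by blast
qed

lemma generate_pair_eqI:
  assumes "x \<in> carrier G" "y \<in> carrier G" "z \<in> carrier G"
    and "y \<in> generate G {x, z}" "z \<in> generate G {x, y}"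
  shows "generate G {x, z} = generate G {x, y}"
  using assms generate_mono2[of "{x, z}" "{x, y}"] generate_mono2[of "{x, y}" "{x, z}"]
  by (auto intro: generate.incl)

lemma generate_pair_mult:
  assumes "x \<in> carrier G" "y \<in> carrier G"
  shows "generate G {x, x \<otimes> y} = generate G {x, y}"
proof (rule generate_pair_eqI)
  show "x \<otimes> y \<in> generate G {x, y}" by (intro generate.eng generate.incl) auto
  have "inv x \<otimes> (x \<otimes> y) \<in> generate G {x, x \<otimes> y}" by (intro generate.eng generate.incl generate.inv) auto
  then show "y \<in> generate G {x, x \<otimes> y}" using assms by simp
qed (use assms in auto)

lemma inverts_of_square:
  assumes "x \<in> carrier G" "w \<in> carrier G" "w \<otimes> w = \<one>" "(x \<otimes> w) \<otimes> (x \<otimes> w) = \<one>"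
  shows "w \<otimes> x \<otimes> inv w = inv x"
proof -
  have "x \<otimes> (w \<otimes> x \<otimes> w) = \<one>" using assms by (simp add: m_assoc)
  then have "inv x = w \<otimes> x \<otimes> w" using assms(1,2) by (metis inv_char inv_comm m_closed)
  then show ?thesis using square_eq_oneD[OF assms(2,3)] by simp
qed

text \<open>If w is an involution and a, w generate an infinite torsion group, then aw is not an
  involution: otherwise w would invert a, and the group would be finite (\<open>no_inv\<close>). So
  involutions can be traded for products.\<close>

lemma infinite_pair_generators:
  assumes tors: "\<And>g. g \<in> carrier G \<Longrightarrow> finite (generate G {g})"
    and xy: "x \<in> carrier G" "y \<in> carrier G" and inf: "infinite (generate G {x, y})"
  shows "\<exists>a\<in>carrier G. \<exists>b\<in>carrier G. generate G {a, b} = generate G {x, y} \<and>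
    a \<otimes> a \<noteq> \<one> \<and> b \<otimes> b \<noteq> \<one> \<and> (a \<otimes> b) \<otimes> (a \<otimes> b) \<noteq> \<one>"
proof -
  have inv_gen: "inv g \<in> generate G {g}" for g by (rule generate.inv) simp
  have no_inv: "(a \<otimes> w) \<otimes> (a \<otimes> w) \<noteq> \<one>"
    if "a \<in> carrier G" "w \<in> carrier G" "w \<otimes> w = \<one>" "generate G {a, w} = generate G {x, y}" for a w
    using finite_generate_pair[OF that(1,2) tors[OF that(1)] tors[OF that(2)]] inv_gen
      inverts_of_square[OF that(1-3)] inf that(4) by auto
  have "\<exists>a\<in>carrier G. \<exists>b\<in>carrier G. generate G {a, b} = generate G {x, y} \<and> a \<otimes> a \<noteq> \<one> \<and> b \<otimes> b \<noteq> \<one>"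
  proof -
    have *: "\<exists>a\<in>carrier G. \<exists>b\<in>carrier G. generate G {a, b} = generate G {x, y} \<and> a \<otimes> a \<noteq> \<one> \<and> b \<otimes> b \<noteq> \<one>"
      if uv: "u \<in> carrier G" "v \<in> carrier G" "generate G {u, v} = generate G {x, y}" "u \<otimes> u \<noteq> \<one>" for u v
    proof (cases "v \<otimes> v = \<one>")
      case True
      then have "(u \<otimes> v) \<otimes> (u \<otimes> v) \<noteq> \<one>" using no_inv uv by blast
      then show ?thesis using generate_pair_mult[OF uv(1,2)] uv m_closed by metis
    qed (use uv in blast)
    show ?thesis
    proof (cases "x \<otimes> x = \<one>")
      case x1: True
      show ?thesis
      proof (cases "y \<otimes> y = \<one>")
        case False
        then show ?thesis using *[of y x] xy by (simp add: insert_commute)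
      next
        case True
        have "generate G {x \<otimes> y, y} = generate G {x, y}"
        proof -
          have "x \<otimes> y \<in> generate G {y, x}" by (intro generate.eng generate.incl) auto
          moreover have "(x \<otimes> y) \<otimes> inv y \<in> generate G {y, x \<otimes> y}"
            by (intro generate.eng generate.incl generate.inv) auto
          then have "x \<in> generate G {y, x \<otimes> y}" using xy by (simp add: m_assoc)
          ultimately show ?thesis using generate_pair_eqI[of y x "x \<otimes> y"] xy by (simp add: insert_commute)
        qed
        moreover have "(x \<otimes> y \<otimes> y) \<otimes> (x \<otimes> y \<otimes> y) = \<one>" using xy x1 True by (simp add: m_assoc)
        ultimately show ?thesis using no_inv[of "x \<otimes> y" y] xy True by auto
      qed
    qed (use *[of x y] xy in auto)
  qed
  then obtain a b where ab: "a \<in> carrier G" "b \<in> carrier G" "generate G {a, b} = generate G {x, y}"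
    "a \<otimes> a \<noteq> \<one>" "b \<otimes> b \<noteq> \<one>" by blast
  show ?thesis
  proof (cases "(a \<otimes> b) \<otimes> (a \<otimes> b) = \<one>")
    case True
    \<comment> \<open>If ab is an involution, the pair a, aw is used instead, whose product is a^2
      w.\<close>
    define w where "w = a \<otimes> b"
    have w: "w \<in> carrier G" "w \<otimes> w = \<one>" "generate G {a, w} = generate G {x, y}"
      using True ab generate_pair_mult[OF ab(1,2)] by (auto simp: w_def)
    have aw: "generate G {a, a \<otimes> w} = generate G {x, y}" using generate_pair_mult[OF ab(1) w(1)] w(3) by simp
    have n1: "(a \<otimes> w) \<otimes> (a \<otimes> w) \<noteq> \<one>" by (rule no_inv[OF ab(1) w])
    \<comment> \<open>Otherwise w inverts a^2. Then aw normalises the cyclic group of a^2, and w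
      normalises the finite group \<open>?M\<close> generated by a^2 and aw, so that everything
      would be finite.\<close>
    have "(a \<otimes> (a \<otimes> w)) \<otimes> (a \<otimes> (a \<otimes> w)) \<noteq> \<one>"
    proof
      let ?N = "generate G {a \<otimes> a}" and ?g = "a \<otimes> w"
      assume "(a \<otimes> (a \<otimes> w)) \<otimes> (a \<otimes> (a \<otimes> w)) = \<one>"
      then have wN: "w \<otimes> (a \<otimes> a) \<otimes> inv w = inv (a \<otimes> a)"
        using inverts_of_square[of "a \<otimes> a" w] ab w by (simp add: m_assoc)
      have aN: "a \<otimes> (a \<otimes> a) \<otimes> inv a = a \<otimes> a" using ab by (simp add: m_assoc)
      have "?g \<otimes> (a \<otimes> a) \<otimes> inv ?g = a \<otimes> (w \<otimes> (a \<otimes> a) \<otimes> inv w) \<otimes> inv a"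
        using ab w by (simp add: m_assoc inv_mult_group)
      also have "\<dots> = inv (a \<otimes> a)" unfolding wN using ab by (simp add: m_assoc inv_mult_group)
      finally have gN: "?g \<otimes> (a \<otimes> a) \<otimes> inv ?g \<in> ?N" using inv_gen by simp
      let ?M = "generate G {a \<otimes> a, ?g}"
      have fM: "finite ?M" using finite_generate_pair[OF _ _ tors tors gN] ab w by simp
      have Mc: "{a \<otimes> a, ?g} \<subseteq> carrier G" using ab w by auto
      have sM: "subgroup ?M G" by (rule generate_is_subgroup[OF Mc])
      have inM: "a \<otimes> a \<in> ?M" "?g \<in> ?M" by (auto intro: generate.incl)
      have wa: "w \<otimes> (a \<otimes> a) \<otimes> inv w \<in> ?M" unfolding wN using inM sM by (simp add: subgroup.m_inv_closed)
      have "w \<otimes> ?g \<otimes> inv w = inv ?g \<otimes> (a \<otimes> a)"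
        using ab w square_eq_oneD[OF w(1,2)] by (simp add: m_assoc inv_mult_group)
      then have wg: "w \<otimes> ?g \<otimes> inv w \<in> ?M" using inM sM by (simp add: subgroup.m_closed subgroup.m_inv_closed)
      have "w \<otimes> c \<otimes> inv w \<in> ?M" if "c \<in> ?M" for c
        using conj_generate[OF Mc w(1) _ that] wa wg by auto
      then have "finite (generate G (insert w ?M))"
        by (intro finite_generate_insert[OF sM fM w(1) tors[OF w(1)]])
      moreover have "generate G {a, w} \<subseteq> generate G (insert w ?M)"
      proof (rule generate_mono2)
        have "?g \<otimes> inv w \<in> generate G (insert w ?M)"
          using inM by (intro generate.eng generate.inv generate.incl) auto
        then show "{a, w} \<subseteq> generate G (insert w ?M)"
          using ab w by (auto simp: m_assoc intro: generate.incl)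
        show "insert w ?M \<subseteq> carrier G" using w generate_incl[OF Mc] by auto
      qed
      ultimately show False using inf w(3) finite_subset by auto
    qed
    moreover have "a \<otimes> w \<in> carrier G" using ab(1) w(1) by simp
    ultimately show ?thesis using ab(1,4) n1 aw by blast
  qed (use ab in blast)
qed

text \<open>The relations yxy = x and xyx = y present the quaternion group; the conclusions are its
  familiar relations.\<close>

lemma mutual_inversion:
  assumes c: "x \<in> carrier G" "y \<in> carrier G" and D: "y \<otimes> (x \<otimes> y) = x" and F: "x \<otimes> y \<otimes> x = y"
  shows "y \<otimes> x = inv x \<otimes> y"
    "y \<otimes> y = x \<otimes> x"
    "(x \<otimes> x) \<otimes> (x \<otimes> x) = \<one>"
proof -
  show yx: "y \<otimes> x = inv x \<otimes> y" using c F by (metis inv_solve_left m_assoc m_closed)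
  have "inv x \<otimes> (y \<otimes> y) = x"
  proof -
    have "x = (y \<otimes> x) \<otimes> y" using D c by (simp add: m_assoc)
    then show ?thesis unfolding yx using c by (simp add: m_assoc)
  qed
  then show yy: "y \<otimes> y = x \<otimes> x" using c by (metis inv_solve_left m_closed)
  have "y \<otimes> (x \<otimes> x) = inv x \<otimes> inv x \<otimes> y" using yx c by (metis m_assoc m_closed inv_closed)
  moreover have "y \<otimes> (x \<otimes> x) = (x \<otimes> x) \<otimes> y" unfolding yy[symmetric] using c by (simp add: m_assoc)
  ultimately have "x \<otimes> x = inv (x \<otimes> x)" using c by (simp add: inv_mult_group)
  then show "(x \<otimes> x) \<otimes> (x \<otimes> x) = \<one>" using c by (metis r_inv m_closed)
qed

text \<open>An element g of infinite order provides the core g, g^2. In a torsion group the core is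
  a, b, ab for generators whose squares, and that of the product, are nontrivial.\<close>

theorem DRR_of_infinite_pair:
  assumes xy: "x \<in> carrier G" "y \<in> carrier G" and inf: "infinite (generate G {x, y})"
    and A: "finite A" "A \<subseteq> carrier G" "generate G A = carrier G"
  shows "\<exists>S. finite S \<and> is_DRR G S"
proof (cases "\<exists>g\<in>carrier G. infinite (generate G {g})")
  case True
  then obtain g where g: "g \<in> carrier G" "infinite (generate G {g})" by blast
  interpret C: subgrp G "carrier G" by (rule subgrpI[OF subgroup_self])
  have "ord g = 0" using generate_pow_card[OF g(1)] g(2) by simp
  then have pw: "g [^] n \<noteq> \<one>" if "n \<noteq> 0" for n :: nat using ord_eq_0[OF g(1)] that by blast
  \<comment> \<open>Exponent 5 occurs because the cube of g^2 is g^6, which has to differ from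
    g.\<close>
  have n: "g \<noteq> \<one>" "g \<otimes> g \<noteq> \<one>" "g \<otimes> (g \<otimes> g) \<noteq> \<one>" "g \<otimes> (g \<otimes> (g \<otimes> g)) \<noteq> \<one>"
    "g \<otimes> (g \<otimes> (g \<otimes> (g \<otimes> g))) \<noteq> \<one>"
    using pw[of 1] pw[of 2] pw[of 3] pw[of 4] pw[of 5] g(1) by (auto simp: numeral_eq_Suc m_assoc)
  let ?T = "{g, g \<otimes> g}"
  have cancel: "a \<otimes> b = a \<longleftrightarrow> b = \<one>" if "a \<in> carrier G" "b \<in> carrier G" for a b using that by simp
  show ?thesis
  proof (rule DRR_of_infinite_subgroup[OF _ g(2) _ _ _ _ _ _ A, of ?T])
    show "subgroup (generate G {g}) G" using g by (intro generate_is_subgroup) auto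
    show "?T \<subseteq> generate G {g}" by (auto intro: generate.incl generate.eng)
    show "\<one> \<notin> ?T" by (simp add: n(1,2)[symmetric])
    show "generate G {g} \<subseteq> generate G ?T" by (rule mono_generate) auto
    show "t \<otimes> (t \<otimes> t) \<notin> ?T" if "t \<in> ?T" for t
      using that g(1) n by (auto simp: m_assoc cancel)
    fix S assume S: "S \<subseteq> carrier G" "?T \<subseteq> S"
      and pr: "\<And>a b. a \<in> S \<Longrightarrow> b \<in> S \<Longrightarrow> a \<otimes> b \<in> S \<Longrightarrow> a \<in> ?T \<and> b \<in> ?T \<and> a \<otimes> b \<in> ?T"
    have "g \<in> fixd (carrier G) S"
    proof (rule C.fixd_of_square)
      fix a b assume "a \<in> S" "b \<in> S" "a \<otimes> b \<in> S"
      from pr[OF this] show "a = g" using g(1) n by (auto simp: m_assoc cancel)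
    qed (use S in auto)
    then show "?T \<subseteq> fixd (carrier G) S" using C.fixd_subgroup by (simp add: subgroup.m_closed)
  qed auto
next
  case False
  then have tors: "\<And>g. g \<in> carrier G \<Longrightarrow> finite (generate G {g})" by blast
  interpret C: subgrp G "carrier G" by (rule subgrpI[OF subgroup_self])
  obtain a b where ab: "a \<in> carrier G" "b \<in> carrier G" "generate G {a, b} = generate G {x, y}"
    "a \<otimes> a \<noteq> \<one>" "b \<otimes> b \<noteq> \<one>" "(a \<otimes> b) \<otimes> (a \<otimes> b) \<noteq> \<one>"
    using infinite_pair_generators[OF tors xy inf] by blast
  \<comment> \<open>In a torsion group a normalised cyclic subgroup would make the pair finite. This
    excludes commuting generators as well as the directed triangle.\<close>
  have nofin: "b \<otimes> a \<otimes> inv b \<notin> generate G {a}"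
    using finite_generate_pair[OF ab(1,2) tors[OF ab(1)] tors[OF ab(2)]] inf ab(3) by auto
  have nc: "a \<otimes> b \<noteq> b \<otimes> a"
  proof
    assume "a \<otimes> b = b \<otimes> a"
    then have "b \<otimes> a \<otimes> inv b = a" using ab by (metis inv_solve_right m_closed)
    then show False using nofin by (auto intro: generate.incl)
  qed
  have DF: "\<not> (b \<otimes> (a \<otimes> b) = a \<and> a \<otimes> b \<otimes> a = b)"
  proof
    assume "b \<otimes> (a \<otimes> b) = a \<and> a \<otimes> b \<otimes> a = b"
    then have "b \<otimes> a = inv a \<otimes> b" using mutual_inversion(1)[OF ab(1,2)] by blast
    then have "b \<otimes> a \<otimes> inv b = inv a" using ab by (simp add: m_assoc)
    then show False using nofin by (auto intro: generate.inv)
  qed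
  let ?T = "{a, b, a \<otimes> b}"
  note f = noncommuting_facts[OF ab(1,2) nc]
  show ?thesis
  proof (rule DRR_of_infinite_subgroup[OF _ _ _ _ _ _ _ _ A, of "generate G {a, b}" ?T])
    show "subgroup (generate G {a, b}) G" using ab by (intro generate_is_subgroup) auto
    show "infinite (generate G {a, b})" using inf ab by simp
    show "?T \<subseteq> generate G {a, b}" by (auto intro: generate.incl generate.eng)
    show "\<one> \<notin> ?T" using f by auto
    show "generate G {a, b} \<subseteq> generate G ?T" by (rule mono_generate) auto
    show "t \<otimes> (t \<otimes> t) \<notin> ?T" if t: "t \<in> ?T" for t
    proof
      assume m: "t \<otimes> (t \<otimes> t) \<in> ?T"
      have tc: "t \<in> carrier G" using t ab by auto
      have tt: "t \<otimes> t \<noteq> \<one>" using t ab by auto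
      let ?s = "t \<otimes> (t \<otimes> t)"
      \<comment> \<open>A cube commutes with its root, but no two distinct members of
        \<open>?T\<close> commute; and the cube differs from the root because all three squares are
        nontrivial.\<close>
      have "?s \<otimes> t = t \<otimes> ?s" using tc by (simp add: m_assoc)
      moreover have "?s \<noteq> t" using tc tt by simp
      moreover have "(a \<otimes> b) \<otimes> a \<noteq> a \<otimes> (a \<otimes> b)"
        using ab(1,2) nc[symmetric] by (simp add: m_assoc)
      moreover have "(a \<otimes> b) \<otimes> b \<noteq> b \<otimes> (a \<otimes> b)"
        using ab(1,2) nc by (simp flip: m_assoc)
      ultimately show False using m t nc unfolding insert_iff empty_iff by metis
    qed
    fix S assume S: "S \<subseteq> carrier G" "?T \<subseteq> S"
      and pr: "\<And>p q. p \<in> S \<Longrightarrow> q \<in> S \<Longrightarrow> p \<otimes> q \<in> S \<Longrightarrow> p \<in> ?T \<and> q \<in> ?T \<and> p \<otimes> q \<in> ?T"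
    have "{a, b} \<subseteq> fixd (carrier G) S"
    proof (rule C.fixd_of_triple[OF S(1) _ _ _ f(3,1,2) _ DF])
      fix p q assume "p \<in> S" "q \<in> S" "p \<otimes> q \<in> S"
      note P = pr[OF this]
      show "(p = a \<and> q = b) \<or> (p = b \<and> q = a \<otimes> b \<and> b \<otimes> (a \<otimes> b) = a) \<or>
          (p = a \<otimes> b \<and> q = a \<and> a \<otimes> b \<otimes> a = b)"
        by (rule triple_products[OF ab(1,2) nc ab(4,5) conjunct1[OF P]
          conjunct1[OF conjunct2[OF P]] conjunct2[OF conjunct2[OF P]]])
    qed (use S in auto)
    then show "?T \<subseteq> fixd (carrier G) S" using C.fixd_subgroup by (simp add: subgroup.m_closed)
  qed auto
qed

end

subsection \<open>Sparse sets in groups generated by two elements\<close>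

context group
begin

lemma card_cosets:
  assumes C: "subgroup C G" "C \<subseteq> K" and K: "subgroup K G" "finite K" and R: "R \<subseteq> K"
    and sep: "\<And>g h. g \<in> R \<Longrightarrow> h \<in> R \<Longrightarrow> g \<noteq> h \<Longrightarrow> g \<otimes> inv h \<notin> C"
  shows "card C * card R \<le> card K"
proof -
  interpret C: subgrp G C by (rule subgrpI[OF C(1)])
  interpret K: subgrp G K by (rule subgrpI[OF K(1)])
  have "inj_on (\<lambda>(c, g). c \<otimes> g) (C \<times> R)"
  proof (rule inj_onI, clarify)
    fix c g d h assume a: "c \<in> C" "g \<in> R" "d \<in> C" "h \<in> R" "c \<otimes> g = d \<otimes> h"
    have m: "c \<in> carrier G" "g \<in> carrier G" "d \<in> carrier G" "h \<in> carrier G"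
      using a R C.K_carrier K.K_carrier by auto
    have "g = inv c \<otimes> (d \<otimes> h)" using a(5) m by (metis m_inv_cancel(1))
    then have "g \<otimes> inv h = inv c \<otimes> d" using m by (simp add: m_assoc)
    moreover have "inv c \<otimes> d \<in> C" using a C.K_closed by blast
    ultimately have "g = h" using sep[OF a(2,4)] by metis
    then show "c = d \<and> g = h" using a m by simp
  qed
  then have "card C * card R = card ((\<lambda>(c, g). c \<otimes> g) ` (C \<times> R))"
    by (simp add: card_image card_cartesian_product)
  also have "\<dots> \<le> card K" using C(2) R K.K_closed by (intro card_mono[OF K(2)]) auto
  finally show ?thesis .
qed

text \<open>\<open>y\<close> is the only member whose inverse is a member too.\<close>

lemma rigid_pair:
  assumes c: "x \<in> carrier G" "y \<in> carrier G" and xy: "x \<otimes> x \<noteq> \<one>" "y \<otimes> y = \<one>" "y \<noteq> \<one>"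
  shows "rigid (generate G {x, y}) {x, y}"
proof -
  let ?K = "generate G {x, y}" and ?S = "{x, y}"
  interpret subgrp G ?K using c by (intro generate_subgrp) auto
  have iS: "invar ?K ?S ?S" by (rule invar_gens) (auto intro: generate.incl)
  have y: "inv y = y" using square_eq_oneD c xy by blast
  have "inv x \<noteq> x" using c xy by (metis r_inv)
  moreover have "inv x \<noteq> y" using c y calculation by (metis inv_inv)
  ultimately have e: "{s \<in> ?S. inv s \<in> ?S} = {y}" using y by auto
  have iy: "invar ?K ?S {y}" using invar_inv[OF iS iS] e by simp
  moreover have "?S - {y} = {x}" using xy by auto
  ultimately have "invar ?K ?S {x}" using invar_Diff[OF iS] by metis
  with iy show ?thesis by (intro rigidI[of ?S]) (auto simp: invar_singleton)
qed

lemma sparse_pair: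
  assumes c: "x \<in> carrier G" "y \<in> carrier G" and xy: "x \<otimes> x \<noteq> \<one>" "y \<otimes> y = \<one>" "y \<noteq> \<one>"
    and K: "finite (generate G {x, y})" "8 \<le> card (generate G {x, y})"
  shows "sparse (generate G {x, y}) {x, y}" "asymmetric {x, y}"
proof -
  have "x \<noteq> y" "x \<noteq> \<one>" using xy c by auto
  then show "sparse (generate G {x, y}) {x, y}"
    using rigid_pair[OF c xy] K xy c
    by (auto simp: sparse_def intro: generate.incl generate_is_subgroup)
  have "inv x \<noteq> x" "inv x \<noteq> y" using c xy square_eq_oneD[OF c(2) xy(2)] by (metis r_inv inv_inv)+
  then show "asymmetric {x, y}" using xy by (auto simp: asymmetric_def)
qed

lemma sparse_triple:
  assumes c: "x \<in> carrier G" "y \<in> carrier G" and nc: "x \<otimes> y \<noteq> y \<otimes> x"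
    and sq: "x \<otimes> x \<noteq> \<one>" "y \<otimes> y \<noteq> \<one>" and DF: "\<not> (y \<otimes> (x \<otimes> y) = x \<and> x \<otimes> y \<otimes> x = y)"
    and K: "finite (generate G {x, y})" "10 \<le> card (generate G {x, y})"
  shows "sparse (generate G {x, y}) {x, y, x \<otimes> y}" "asymmetric {x, y, x \<otimes> y}"
proof -
  let ?K = "generate G {x, y}" and ?S = "{x, y, x \<otimes> y}"
  note f = noncommuting_facts[OF c nc]
  interpret subgrp G ?K using c by (intro generate_subgrp) auto
  have S: "?S \<subseteq> ?K" by (auto intro: generate.incl generate.eng)
  have "{x, y} \<subseteq> fixd ?K ?S"
  proof (rule fixd_of_triple[OF S _ _ _ f(3,1,2) _ DF])
    fix a b assume "a \<in> ?S" "b \<in> ?S" "a \<otimes> b \<in> ?S"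
    then show "(a = x \<and> b = y) \<or> (a = y \<and> b = x \<otimes> y \<and> y \<otimes> (x \<otimes> y) = x) \<or>
        (a = x \<otimes> y \<and> b = x \<and> x \<otimes> y \<otimes> x = y)"
      by (rule triple_products[OF c nc sq])
  qed auto
  then have r: "rigid ?K ?S" by (intro rigidI[of "{x, y}"]) auto
  have "card ?S = 3" using f c by auto
  then show "sparse ?K ?S" using r S K f subgroup_K by (auto simp: sparse_def)
  have "inv x \<noteq> x" using c sq by (metis r_inv)
  moreover have "inv x \<noteq> y" using c f by (metis r_inv)
  moreover have "inv x \<noteq> x \<otimes> y" using c f(9) by (metis l_inv m_assoc)
  ultimately show "asymmetric ?S" using sq by (auto simp: asymmetric_def)
qed

text \<open>For commuting elements the triple x, y, xy is unsuitable, and x^2 replaces xy. The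
  hypotheses exclude all arcs inside the set that start at y or at x^2, so x is the only starting
  point, and y is what remains besides x and x^2.\<close>

lemma sparse_square:
  assumes c: "x \<in> carrier G" "y \<in> carrier G"
    and x: "x \<otimes> x \<noteq> \<one>" "x \<otimes> (x \<otimes> x) \<noteq> \<one>" and y: "y \<otimes> y \<noteq> \<one>" "y \<otimes> y \<noteq> x \<otimes> x"
    and ind: "y \<notin> generate G {x}" "x \<notin> generate G {y}"
    and K: "finite (generate G {x, y})" "10 \<le> card (generate G {x, y})"
  shows "sparse (generate G {x, y}) {x, x \<otimes> x, y}" "asymmetric {x, x \<otimes> x, y}"
proof -
  let ?K = "generate G {x, y}" and ?S = "{x, x \<otimes> x, y}"
  interpret subgrp G ?K using c by (intro generate_subgrp) auto
  interpret X: subgrp G "generate G {x}" using c by (intro generate_subgrp) auto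
  interpret Y: subgrp G "generate G {y}" using c by (intro generate_subgrp) auto
  have S: "?S \<subseteq> ?K" by (auto intro: generate.incl generate.eng)
  have xX: "x \<in> generate G {x}" and yY: "y \<in> generate G {y}" by (auto intro: generate.incl)
  have n: "x \<otimes> (x \<otimes> x) \<noteq> y" "x \<otimes> (x \<otimes> (x \<otimes> x)) \<noteq> y" "inv x \<noteq> y" "x \<noteq> y" "x \<otimes> x \<noteq> y"
    "y \<otimes> y \<noteq> x" "x \<noteq> \<one>" "y \<noteq> \<one>"
    using ind xX yY X.K_closed Y.K_closed by auto
  have xy: "x \<otimes> y \<noteq> \<one>" using c n by (metis inv_equality inv_comm)
  then have yx: "y \<otimes> x \<noteq> \<one>" using c by (metis inv_comm)
  have n': "y \<otimes> (x \<otimes> x) \<noteq> x"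
    using yx c by (simp add: mult_eq_right_iffs)
  have n'': "x \<otimes> (x \<otimes> y) \<noteq> x" "x \<otimes> (x \<otimes> y) \<noteq> y"
    using xy x c by (simp_all add: mult_eq_right_iffs)
  have "x \<in> fixd ?K ?S"
  proof (rule fixd_of_square[OF S])
    fix a b assume ab: "a \<in> ?S" "b \<in> ?S" "a \<otimes> b \<in> ?S"
    show "a = x"
    proof (rule ccontr)
      assume "a \<noteq> x"
      then consider "a = x \<otimes> x" | "a = y" using ab by auto
      then show False
      proof cases
        case 1
        consider "b = x" | "b = x \<otimes> x" | "b = y" using ab by auto
        then show False
          by cases (use ab(3) 1 c x n n'' in \<open>auto simp: m_assoc\<close>)
      next
        case 2
        consider "b = x" | "b = x \<otimes> x" | "b = y" using ab by auto
        then show False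
          by cases (use ab(3) 2 c x y n n' in \<open>auto simp: mult_eq_right_iffs\<close>)
      qed
    qed
  qed auto
  then have iy: "{x, x \<otimes> x} \<subseteq> fixd ?K ?S" using fixd_subgroup by (simp add: subgroup.m_closed)
  have "invar ?K ?S (?S - {x, x \<otimes> x})" by (intro invar_Diff invar_gens S invar_fixd iy)
  moreover have "?S - {x, x \<otimes> x} = {y}" using n by auto
  ultimately have "y \<in> fixd ?K ?S" by (simp add: invar_singleton)
  then have r: "rigid ?K ?S" using iy by (intro rigidI[of "{x, y}"]) auto
  have "card ?S = 3" using n c by auto
  then show "sparse ?K ?S" using r S K n x subgroup_K by (auto simp: sparse_def)
  have "inv x \<noteq> x" using c x by (metis r_inv)
  moreover have "inv x \<noteq> x \<otimes> x" using c x by (metis r_inv)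
  ultimately show "asymmetric ?S" using x n by (auto simp: asymmetric_def)
qed

lemma pow_neq_one:
  assumes "x \<in> carrier G" "k < card (generate G {x})" "0 < k"
  shows "x [^] k \<noteq> \<one>"
  using assms pow_eq_id[of x k] generate_pow_card[of x] by (auto dest: dvd_imp_le)

lemma sparse_cyclic:
  assumes c: "x \<in> carrier G" and K: "finite (generate G {x})" "8 \<le> card (generate G {x})"
  shows "sparse (generate G {x}) {x, x \<otimes> x}" "asymmetric {x, x \<otimes> x}"
proof -
  let ?K = "generate G {x}" and ?S = "{x, x \<otimes> x}"
  interpret subgrp G ?K using c by (intro generate_subgrp) auto
  have S: "?S \<subseteq> ?K" by (auto intro: generate.incl generate.eng)
  have n: "x \<noteq> \<one>" "x \<otimes> x \<noteq> \<one>" "x \<otimes> (x \<otimes> x) \<noteq> \<one>"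
    using pow_neq_one[OF c, of 1] pow_neq_one[OF c, of 2] pow_neq_one[OF c, of 3] K c
    by (auto simp: numeral_eq_Suc m_assoc)
  have f: "x \<in> fixd ?K ?S"
  proof (rule fixd_of_square[OF S])
    fix a b assume "a \<in> ?S" "b \<in> ?S" "a \<otimes> b \<in> ?S"
    then show "a = x" using c n by (auto simp: m_assoc)
  qed auto
  have r: "rigid ?K ?S" using f by (intro rigidI[of "{x}"]) auto
  show "sparse ?K ?S" using r S K n c subgroup_K by (auto simp: sparse_def)
  have "inv x \<noteq> x" using c n by (metis r_inv)
  moreover have "inv x \<noteq> x \<otimes> x" using c n by (metis r_inv)
  ultimately show "asymmetric ?S" using n by (auto simp: asymmetric_def)
qed

text \<open>Here s inverts the abelian group of a and b. The element a is the only member without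
  inverse in the set, as is its only out-neighbour in the set, s is their quotient, and bs
  remains.\<close>

lemma sparse_dihedral:
  assumes c: "a \<in> carrier G" "b \<in> carrier G" "s \<in> carrier G" and comm: "a \<otimes> b = b \<otimes> a"
    and a: "a \<noteq> \<one>" "a \<otimes> (a \<otimes> a) = \<one>" and b: "b \<otimes> (b \<otimes> b) = \<one>" "b \<notin> generate G {a}"
    and s: "s \<noteq> \<one>" "s \<otimes> s = \<one>" "s \<otimes> a = inv a \<otimes> s" "s \<otimes> b = inv b \<otimes> s"
    and sab: "s \<notin> generate G {a, b}" and K: "finite (generate G {a, b, s})" "12 \<le> card (generate G {a, b, s})"
  shows "sparse (generate G {a, b, s}) {a, s, a \<otimes> s, b \<otimes> s}"
    "asymmetric {a, s, a \<otimes> s, b \<otimes> s}"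
proof -
  let ?K = "generate G {a, b, s}" and ?S = "{a, s, a \<otimes> s, b \<otimes> s}"
  interpret subgrp G ?K using c by (intro generate_subgrp) auto
  interpret A: subgrp G "generate G {a}" using c by (intro generate_subgrp) auto
  interpret B: subgrp G "generate G {a, b}" using c by (intro generate_subgrp) auto
  have S: "?S \<subseteq> ?K" by (auto intro: generate.incl generate.eng)
  have aA: "a \<in> generate G {a}" and abB: "a \<in> generate G {a, b}" "b \<in> generate G {a, b}"
    by (auto intro: generate.incl)
  have outB: "g \<otimes> s \<notin> generate G {a, b}" if "g \<in> generate G {a, b}" for g
  proof
    assume "g \<otimes> s \<in> generate G {a, b}"
    then have "inv g \<otimes> (g \<otimes> s) \<in> generate G {a, b}" using that B.K_closed by blast
    then show False using sab that c B.K_carrier by simp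
  qed
  have aa: "inv a = a \<otimes> a" using a c by (intro inv_equality) (auto simp: m_assoc)
  have aa1: "a \<otimes> a \<noteq> \<one>" using a c by (metis r_one)
  have is1: "inv s = s" by (rule square_eq_oneD[OF c(3) s(2)])
  have conj: "s \<otimes> inv g = g \<otimes> s" if g: "g \<in> carrier G" "s \<otimes> g = inv g \<otimes> s" for g
  proof -
    have "(g \<otimes> s) \<otimes> g = s" using g c by (simp add: m_assoc)
    then show ?thesis using g(1) c inv_solve_right[of s "g \<otimes> s" g] by (metis inv_solve_right m_closed)
  qed
  have inv_as: "inv (a \<otimes> s) = a \<otimes> s" using c s is1 conj by (simp add: inv_mult_group)
  have inv_bs: "inv (b \<otimes> s) = b \<otimes> s" using c s is1 conj by (simp add: inv_mult_group)
  have anS: "inv a \<notin> ?S"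
  proof -
    have "inv a \<in> generate G {a, b}" using abB B.K_closed by blast
    moreover have "inv a \<noteq> a" using aa1 c by (metis r_inv)
    moreover have "inv a \<noteq> s" using sab calculation(1) by metis
    moreover have "inv a \<noteq> a \<otimes> s" "inv a \<noteq> b \<otimes> s" using outB abB calculation(1) by metis+
    ultimately show ?thesis by simp
  qed
  have bne: "b \<noteq> \<one>" "b \<noteq> a" "b \<noteq> inv a" "b \<noteq> a \<otimes> a" "inv a \<noteq> b" using b aA A.K_closed by auto
  have oneS: "\<one> \<notin> ?S"
  proof -
    have "\<one> \<noteq> a \<otimes> s" "\<one> \<noteq> b \<otimes> s" using outB abB B.K_closed(3) by metis+
    then show ?thesis using a(1) s(1) by simp
  qed
  have iS: "invar ?K ?S ?S" by (rule invar_gens[OF S])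
  have e1: "{t \<in> ?S. inv t \<in> ?S} = ?S - {a}"
  proof -
    have "a \<noteq> s" "a \<noteq> a \<otimes> s" "a \<noteq> b \<otimes> s" using sab outB abB by metis+
    then show ?thesis using anS is1 inv_as inv_bs by auto
  qed
  have iJ: "invar ?K ?S (?S - {a})" using invar_inv[OF iS iS] e1 by simp
  have "?S - (?S - {a}) = {a}" by auto
  then have fa: "a \<in> fixd ?K ?S" using invar_Diff[OF iS iJ] invar_singleton by metis
  have "{t \<in> ?S. \<exists>u\<in>{a}. inv u \<otimes> t \<in> ?S} = {a \<otimes> s}"
  proof -
    have "inv a \<otimes> a \<notin> ?S" using oneS c by simp
    moreover have "inv a \<otimes> s \<notin> ?S"
    proof -
      have "inv a \<otimes> s \<noteq> a" using outB abB B.K_closed by metis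
      moreover have "inv a \<otimes> s \<noteq> s" using c a by simp
      moreover have "inv a \<otimes> s \<noteq> a \<otimes> s" using c aa1 by (metis inv_closed r_cancel r_inv)
      moreover have "inv a \<otimes> s \<noteq> b \<otimes> s" using c bne by simp
      ultimately show ?thesis by auto
    qed
    moreover have "inv a \<otimes> (b \<otimes> s) \<notin> ?S"
    proof -
      have r: "inv a \<otimes> (b \<otimes> s) = (inv a \<otimes> b) \<otimes> s" using c by (simp add: m_assoc)
      have "inv a \<otimes> b \<in> generate G {a, b}" using abB B.K_closed by blast
      then have "(inv a \<otimes> b) \<otimes> s \<noteq> a" using outB abB by metis
      moreover have "(inv a \<otimes> b) \<otimes> s \<noteq> s"
      proof
        assume "(inv a \<otimes> b) \<otimes> s = s"
        then have "inv a \<otimes> b = \<one>" using c by simp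
        then have "b = a" using c m_inv_cancel(2)[of a b] by simp
        then show False using bne by simp
      qed
      moreover have "(inv a \<otimes> b) \<otimes> s \<noteq> a \<otimes> s"
      proof
        assume "(inv a \<otimes> b) \<otimes> s = a \<otimes> s"
        then have "inv a \<otimes> b = a" using c by simp
        then have "b = a \<otimes> a" using c m_inv_cancel(2)[of a b] by simp
        then show False using bne by simp
      qed
      moreover have "(inv a \<otimes> b) \<otimes> s \<noteq> b \<otimes> s" using c a by simp
      ultimately show ?thesis unfolding r by auto
    qed
    moreover have "inv a \<otimes> (a \<otimes> s) \<in> ?S" using c by simp
    ultimately show ?thesis by auto
  qed
  then have fas: "a \<otimes> s \<in> fixd ?K ?S"
    using invar_in[OF iS, of "{a}" ?S] iS fa by (simp add: invar_singleton)
  then have "inv a \<otimes> (a \<otimes> s) \<in> fixd ?K ?S" 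
    by (rule subgroup.m_closed[OF fixd_subgroup subgroup.m_inv_closed[OF fixd_subgroup fa]])
  then have fs: "s \<in> fixd ?K ?S" using c by simp
  have "?S - {a, s, a \<otimes> s} = {b \<otimes> s}"
  proof -
    have "b \<otimes> s \<noteq> a" using outB abB by metis
    moreover have "b \<otimes> s \<noteq> s" "b \<otimes> s \<noteq> a \<otimes> s" using c bne by simp_all
    ultimately show ?thesis by auto
  qed
  then have fbs: "b \<otimes> s \<in> fixd ?K ?S"
    using invar_Diff[OF iS invar_fixd[of "{a, s, a \<otimes> s}"]] fa fs fas by (simp add: invar_singleton)
  then have "(b \<otimes> s) \<otimes> inv s \<in> fixd ?K ?S" 
    by (rule subgroup.m_closed[OF fixd_subgroup _ subgroup.m_inv_closed[OF fixd_subgroup fs]])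
  then have "b \<in> fixd ?K ?S" using c by (simp add: m_assoc)
  then have r: "rigid ?K ?S" using fa fs by (intro rigidI[of "{a, b, s}"]) auto
  have "card ?S \<le> 4" "2 \<le> card ?S"
  proof -
    show "card ?S \<le> 4" by (simp add: card_insert_if)
    have "a \<noteq> s" using sab abB by auto
    then have "card {a, s} = 2" by simp
    moreover have "card {a, s} \<le> card ?S" by (rule card_mono) auto
    ultimately show "2 \<le> card ?S" by simp
  qed
  then show "sparse ?K ?S" using r S K subgroup_K oneS by (auto simp: sparse_def)
  show "asymmetric ?S" using anS aa1 by (auto simp: asymmetric_def)
qed

end

subsection \<open>Elementary abelian groups\<close>

text \<open>Coordinates are lists with reduced entries, so that statements about explicit connection
  sets can be evaluated.\<close>

definition vecs :: "nat \<Rightarrow> nat \<Rightarrow> int list set" where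
  "vecs p n = {v. set v \<subseteq> {0..<int p} \<and> length v = n}"

definition vsub :: "nat \<Rightarrow> int list \<Rightarrow> int list \<Rightarrow> int list" where
  "vsub p u v = map2 (\<lambda>x y. (x - y) mod int p) u v"

text \<open>The executable counterpart of \<open>invar_count_in\<close> in additive notation, for
  the predicate of being equal to \<open>n\<close>.\<close>

definition vstep :: "nat \<Rightarrow> int list list \<Rightarrow> int list list \<Rightarrow> int list list \<Rightarrow> nat \<Rightarrow> int list list" where
  "vstep p P Q R n = filter (\<lambda>s. length (filter (\<lambda>t. vsub p s t \<in> set R) Q) = n) P"

definition vdiff :: "int list list \<Rightarrow> int list list \<Rightarrow> int list list" where
  "vdiff P A = filter (\<lambda>s. s \<notin> set A) P"

lemma card_vecs: "card (vecs p n) = p ^ n"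
  unfolding vecs_def by (subst card_lists_length_eq) auto

lemma vecs_nth: "v \<in> vecs p n \<Longrightarrow> i < n \<Longrightarrow> v ! i \<in> {0..<int p}"
proof -
  assume v: "v \<in> vecs p n" "i < n"
  then have "v ! i \<in> set v" by (intro nth_mem) (simp add: vecs_def)
  then show ?thesis using v(1) unfolding vecs_def by blast
qed

lemma finite_vecs: "finite (vecs p n)"
  unfolding vecs_def by (rule finite_lists_length_eq) auto

lemma vsub_vecs: "0 < p \<Longrightarrow> length u = n \<Longrightarrow> length v = n \<Longrightarrow> vsub p u v \<in> vecs p n"
  by (auto simp: vsub_def vecs_def dest!: set_zip_leftD)

locale elementary = comm_group +
  fixes p :: nat
  assumes p: "Factorial_Ring.prime p" and exponent: "\<And>g. g \<in> carrier G \<Longrightarrow> g [^] p = \<one>"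
begin

fun comb :: "'a list \<Rightarrow> int list \<Rightarrow> 'a" where
  "comb (e # es) (v # vs) = e [^] v \<otimes> comb es vs"
| "comb [] _ = \<one>"
| "comb _ [] = \<one>"

text \<open>Each entry is compared only with the later ones. This amounts to linear independence
  because the exponent is prime.\<close>

primrec indep :: "'a list \<Rightarrow> bool" where
  "indep [] = True"
| "indep (e # es) = (e \<notin> generate G (set es) \<and> indep es)"

lemma p_pos: "0 < p" using p by (simp add: prime_gt_0_nat)

lemma int_pow_mod: "e \<in> carrier G \<Longrightarrow> e [^] (x mod int p) = e [^] (x::int)"
proof -
  assume e: "e \<in> carrier G"
  have "ord e dvd p" using pow_eq_id[OF e] exponent[OF e] by simp
  then have "int (ord e) dvd x - x mod int p"
    by (metis dvd_minus_mod dvd_trans int_dvd_int_iff)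
  then show ?thesis using int_pow_eq[OF e] by blast
qed

lemma comb_closed: "set es \<subseteq> carrier G \<Longrightarrow> comb es v \<in> carrier G"
  by (induction es v rule: comb.induct) auto

lemma comb_generate:
  assumes "set es \<subseteq> carrier G" shows "comb es v \<in> generate G (set es)"
  using assms
proof (induction es v rule: comb.induct)
  case (1 e es v vs)
  have s: "subgroup (generate G (set (e # es))) G" using 1 by (intro generate_is_subgroup) auto
  have "comb es vs \<in> generate G (set (e # es))"
    using 1 mono_generate[of "set es" "set (e # es)"] by auto
  moreover have "e [^] v \<in> generate G (set (e # es))"
    by (rule subgroup_int_pow_closed[OF s]) (auto intro: generate.incl)
  ultimately show ?case using s by (simp add: subgroup.m_closed)
qed (auto intro: generate.one)

lemma comb_add:
  assumes "set es \<subseteq> carrier G" "length u = length es" "length v = length es"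
  shows "comb es (map2 (+) u v) = comb es u \<otimes> comb es v"
  using assms
proof (induction es arbitrary: u v)
  case (Cons e es)
  then obtain x u' y v' where "u = x # u'" "v = y # v'" by (metis length_Suc_conv list.size(4) add.right_neutral add_Suc_right)
  then show ?case using Cons comb_closed[of es] by (simp add: int_pow_mult m_ac)
qed auto

lemma comb_diff:
  assumes "set es \<subseteq> carrier G" "length u = length es" "length v = length es"
  shows "inv (comb es u) \<otimes> comb es v = comb es (map2 (-) v u)"
proof -
  have "comb es u \<otimes> comb es (map2 (-) v u) = comb es (map2 (+) u (map2 (-) v u))"
    using comb_add[of es u "map2 (-) v u"] assms by simp
  also have "map2 (+) u (map2 (-) v u) = v" using assms(2,3) by (auto simp: list_eq_iff_nth_eq)
  finally show ?thesis using comb_closed assms by (metis m_inv_cancel(1))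
qed

lemma comb_mod: "set es \<subseteq> carrier G \<Longrightarrow> comb es (map (\<lambda>x. x mod int p) v) = comb es v"
  by (induction es v rule: comb.induct) (auto simp: int_pow_mod)

lemma comb_vsub:
  assumes "set es \<subseteq> carrier G" "length u = length es" "length v = length es"
  shows "inv (comb es u) \<otimes> comb es v = comb es (vsub p v u)"
proof -
  have "vsub p v u = map (\<lambda>x. x mod int p) (map2 (-) v u)" by (auto simp: vsub_def)
  then show ?thesis using comb_diff[OF assms] comb_mod[OF assms(1)] by metis
qed

lemma comb_zero: "comb es (replicate n 0) = \<one>" if "set es \<subseteq> carrier G"
  using that
proof (induction es arbitrary: n)
  case (Cons e es)
  then show ?case by (cases n) auto
qed simp

lemma comb_eq_one:
  assumes "set es \<subseteq> carrier G" "indep es" "length v = length es" "comb es v = \<one>"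
  shows "\<forall>x\<in>set v. int p dvd x"
  using assms
proof (induction es arbitrary: v)
  case (Cons e es)
  then obtain x w where v: "v = x # w" "length w = length es" by (metis length_Suc_conv list.size(4) add.right_neutral add_Suc_right)
  have ec: "e \<in> carrier G" "set es \<subseteq> carrier G" using Cons.prems by auto
  interpret E: subgrp G "generate G (set es)" by (rule generate_subgrp[OF ec(2)])
  have "e [^] x \<otimes> comb es w = \<one>" using Cons.prems v by simp
  then have ex: "e [^] x = inv (comb es w)"
    using ec comb_closed[OF ec(2), of w] by (metis inv_equality int_pow_closed)
  then have m: "e [^] x \<in> generate G (set es)" using comb_generate[OF ec(2)] E.K_closed(2) by simp
  have dvd: "int p dvd x"
  proof (rule ccontr)
    assume nd: "\<not> int p dvd x"
    then have "gcd x (int p) = 1" using p prime_imp_coprime[of "int p" x]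
      by (simp add: coprime_iff_gcd_eq_1 gcd.commute)
    \<comment> \<open>A coefficient prime to p is invertible modulo p, so that e itself would be a
      power of e^x and lie in the span of the later entries.\<close>
    then obtain a b where ab: "a * x + b * int p = 1" using bezout_int[of x "int p"] by auto
    have "a * x = (1::int) + (- b) * int p" using ab by simp
    then have "e [^] (a * x) = e [^] ((1::int) + (- b) * int p)" by (rule arg_cong)
    also have "\<dots> = e [^] (1::int) \<otimes> e [^] ((- b) * int p)" using ec int_pow_mult by blast
    also have "e [^] ((- b) * int p) = e [^] (((- b) * int p) mod int p)" using int_pow_mod[OF ec(1)] by metis
    also have "((- b) * int p) mod int p = 0" by simp
    finally have "e = e [^] (a * x)" using ec by simp
    also have "\<dots> = (e [^] x) [^] a" using ec by (simp add: int_pow_pow mult.commute)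
    also have "\<dots> \<in> generate G (set es)" by (rule subgroup_int_pow_closed[OF E.subgroup_K m])
    finally show False using Cons.prems by simp
  qed
  then have "e [^] x = \<one>" using int_pow_mod[OF ec(1), of x] by simp
  then have "comb es w = \<one>" using \<open>e [^] x \<otimes> comb es w = \<one>\<close> comb_closed[OF ec(2), of w] by simp
  then show ?case using Cons.IH[OF ec(2) _ v(2)] Cons.prems dvd v by simp
qed simp

lemma comb_inj:
  assumes "set es \<subseteq> carrier G" "indep es"
  shows "inj_on (comb es) (vecs p (length es))"
proof (rule inj_onI)
  fix u v assume uv: "u \<in> vecs p (length es)" "v \<in> vecs p (length es)" "comb es u = comb es v"
  then have l: "length u = length es" "length v = length es" by (auto simp: vecs_def)
  have "comb es (map2 (-) v u) = \<one>" using comb_diff[OF assms(1) l] uv(3) comb_closed[OF assms(1)] by simp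
  then have d: "\<forall>x\<in>set (map2 (-) v u). int p dvd x"
    by (intro comb_eq_one[OF assms]) (use l in simp)
  have "u ! i = v ! i" if i: "i < length es" for i
  proof -
    have "map2 (-) v u ! i \<in> set (map2 (-) v u)" using i l by (intro nth_mem) simp
    then have "int p dvd v ! i - u ! i" using d i l by auto
    then have "v ! i mod int p = u ! i mod int p" by (simp add: mod_eq_dvd_iff)
    moreover have "v ! i \<in> {0..<int p}" "u ! i \<in> {0..<int p}"
      using uv(1,2) i by (simp_all only: vecs_nth)
    ultimately show ?thesis by simp
  qed
  then show "u = v" using l by (simp add: list_eq_iff_nth_eq)
qed

text \<open>Combinations with arbitrary integer coefficients are easily seen to form a subgroup;
  reduction modulo p comes afterwards.\<close>

lemma generate_comb:
  assumes es: "set es \<subseteq> carrier G"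
  shows "generate G (set es) = comb es ` vecs p (length es)"
proof
  show "comb es ` vecs p (length es) \<subseteq> generate G (set es)" using comb_generate[OF es] by auto
  let ?M = "comb es ` {v. length v = length es}"
  have "subgroup ?M G"
  proof (rule subgroupI)
    show "?M \<subseteq> carrier G" using comb_closed[OF es] by auto
    show "?M \<noteq> {}" by (auto intro: exI[of _ "replicate (length es) 0"])
  next
    fix a assume "a \<in> ?M"
    then obtain u where u: "length u = length es" "a = comb es u" by auto
    have "inv a = inv (comb es u) \<otimes> comb es (replicate (length es) 0)"
      using u comb_zero[OF es] comb_closed[OF es] by simp
    also have "\<dots> = comb es (map2 (-) (replicate (length es) 0) u)"
      by (rule comb_diff[OF es u(1)]) simp
    finally show "inv a \<in> ?M" using u by auto
  next
    fix a b assume "a \<in> ?M" "b \<in> ?M"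
    then obtain u v where "length u = length es" "a = comb es u" "length v = length es" "b = comb es v" by auto
    then have "a \<otimes> b = comb es (map2 (+) u v)" "length (map2 (+) u v) = length es"
      using comb_add[OF es] by auto
    then show "a \<otimes> b \<in> ?M" by blast
  qed
  moreover have "set es \<subseteq> ?M"
    using es
  proof (induction es)
    case (Cons e es)
    have "e = comb (e # es) (1 # replicate (length es) 0)" using Cons.prems comb_zero by simp
    then have "e \<in> comb (e # es) ` {v. length v = length (e # es)}" by (metis (mono_tags) imageI length_Cons length_replicate mem_Collect_eq)
    moreover have "set es \<subseteq> comb (e # es) ` {v. length v = length (e # es)}"
    proof
      fix g assume "g \<in> set es"
      then obtain v where v: "length v = length es" "g = comb es v" using Cons by auto
      then have "g = comb (e # es) (0 # v)" using Cons.prems comb_closed[of es v] by simp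
      then show "g \<in> comb (e # es) ` {v. length v = length (e # es)}" 
        using v by (intro image_eqI[of _ _ "0 # v"]) auto
    qed
    ultimately show ?case by simp
  qed simp
  ultimately have "generate G (set es) \<subseteq> ?M" by (rule generate_subgroup_incl[rotated])
  also have "?M \<subseteq> comb es ` vecs p (length es)"
  proof clarify
    fix v :: "int list" assume v: "length v = length es"
    have "comb es v = comb es (map (\<lambda>x. x mod int p) v)" using comb_mod[OF es] by simp
    moreover have "map (\<lambda>x. x mod int p) v \<in> vecs p (length es)" using v p_pos by (auto simp: vecs_def)
    ultimately show "comb es v \<in> comb es ` vecs p (length es)" by blast
  qed
  finally show "generate G (set es) \<subseteq> comb es ` vecs p (length es)" .
qed

lemma card_generate_indep:
  "set es \<subseteq> carrier G \<Longrightarrow> indep es \<Longrightarrow> card (generate G (set es)) = p ^ length es"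
  using generate_comb comb_inj by (simp add: card_image card_vecs)

lemma finite_generate_list: "set es \<subseteq> carrier G \<Longrightarrow> finite (generate G (set es))"
  using generate_comb by (simp add: finite_vecs)

theorem iso_cyclic_power:
  assumes es: "set es \<subseteq> carrier G" "indep es" "generate G (set es) = carrier G"
  shows "G \<cong> cyclic_power p (length es)"
proof -
  let ?n = "length es" and ?C = "cyclic_power p (length es)"
  have p1: "p \<noteq> 0" "p \<noteq> 1" using p by auto
  have C: "carrier ?C = (\<Pi>\<^sub>E i\<in>{..<?n}. {0..<int p})"
    using p1 by (simp add: cyclic_power_def carrier_integer_mod_group)
  let ?l = "\<lambda>f::nat \<Rightarrow> int. map f [0..<?n]"
  have inj: "inj_on ?l (carrier ?C)"
  proof (rule inj_onI)
    fix f g assume fg: "f \<in> carrier ?C" "g \<in> carrier ?C" "?l f = ?l g"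
    show "f = g"
    proof (rule PiE_ext[OF fg(1,2)[unfolded C]])
      fix i assume "i \<in> {..<?n}"
      then show "f i = g i" using fg(3) by (auto simp: map_eq_conv)
    qed
  qed
  have im: "?l ` carrier ?C = vecs p ?n"
  proof
    show "?l ` carrier ?C \<subseteq> vecs p ?n"
    proof (rule image_subsetI)
      fix f assume "f \<in> carrier ?C"
      then have "f i \<in> {0..<int p}" if "i < ?n" for i using that PiE_mem[of f "{..<?n}"] unfolding C by blast
      then have "f ` {0..<?n} \<subseteq> {0..<int p}" by (intro image_subsetI) simp
      then show "?l f \<in> vecs p ?n" unfolding vecs_def by simp
    qed
    show "vecs p ?n \<subseteq> ?l ` carrier ?C"
    proof
      fix v assume v: "v \<in> vecs p ?n"
      let ?f = "\<lambda>i\<in>{..<?n}. v ! i"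
      have "length v = ?n" using v by (simp add: vecs_def)
      then have "?l ?f = v" by (intro nth_equalityI) simp_all
      moreover have "v ! i \<in> {0..<int p}" if "i < ?n" for i by (rule vecs_nth[OF v that])
      then have "?f \<in> carrier ?C" unfolding C by (intro restrict_PiE_iff[THEN iffD2]) simp
      ultimately show "v \<in> ?l ` carrier ?C" by (metis imageI)
    qed
  qed
  have b: "bij_betw (comb es \<circ> ?l) (carrier ?C) (carrier G)"
    using bij_betw_trans[of ?l "carrier ?C" "vecs p ?n" "comb es" "carrier G"] inj im comb_inj[OF es(1,2)]
      generate_comb[OF es(1)] es(3) by (auto simp: bij_betw_def)
  have h: "comb es (?l (f \<otimes>\<^bsub>?C\<^esub> g)) = comb es (?l f) \<otimes> comb es (?l g)"
    if "f \<in> carrier ?C" "g \<in> carrier ?C" for f g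
  proof -
    have "?l (f \<otimes>\<^bsub>?C\<^esub> g) = map (\<lambda>x. x mod int p) (map2 (+) (?l f) (?l g))"
      by (rule nth_equalityI) (simp_all add: cyclic_power_def)
    then have "comb es (?l (f \<otimes>\<^bsub>?C\<^esub> g)) = comb es (map2 (+) (?l f) (?l g))"
      using comb_mod[OF es(1)] by metis
    also have "\<dots> = comb es (?l f) \<otimes> comb es (?l g)" by (rule comb_add[OF es(1)]) simp_all
    finally show ?thesis .
  qed
  have "comb es \<circ> ?l \<in> iso ?C G"
    using b h comb_closed[OF es(1)] by (auto simp: iso_def hom_def)
  moreover have "group ?C" by (simp add: cyclic_power_def)
  ultimately show ?thesis using group.iso_sym[of ?C G] unfolding is_iso_def by blast
qed

text \<open>Since \<open>comb es\<close> is injective on \<open>vecs\<close>, coordinate vectors can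
  be counted in place of group elements; \<open>distinct Q\<close> turns the length of a filtered
  list into a cardinality.\<close>

lemma invar_vstep:
  assumes K: "subgroup K G" and es: "set es \<subseteq> carrier G" "indep es"
    and P: "invar K S (comb es ` set P)" and Q: "invar K S (comb es ` set Q)" and R: "invar K S (comb es ` set R)"
    and v: "set P \<subseteq> vecs p (length es)" "set Q \<subseteq> vecs p (length es)" "set R \<subseteq> vecs p (length es)" "distinct Q"
  shows "invar K S (comb es ` set (vstep p P Q R n))"
proof -
  interpret subgrp G K by (rule subgrpI[OF K])
  let ?V = "vecs p (length es)"
  note inj = comb_inj[OF es]
  have len: "w \<in> ?V \<Longrightarrow> length w = length es" for w by (simp add: vecs_def)
  have cnt: "card {t \<in> comb es ` set Q. inv t \<otimes> comb es s \<in> comb es ` set R}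
      = length (filter (\<lambda>t. vsub p s t \<in> set R) Q)" if s: "s \<in> ?V" for s
  proof -
    have m: "inv (comb es t) \<otimes> comb es s \<in> comb es ` set R \<longleftrightarrow> vsub p s t \<in> set R" if t: "t \<in> ?V" for t
    proof -
      have "vsub p s t \<in> ?V" using s t by (intro vsub_vecs p_pos) (auto simp: len)
      then show ?thesis using comb_vsub[OF es(1)] inj_on_image_mem_iff[OF inj _ v(3)] s t len by auto
    qed
    have "{t \<in> comb es ` set Q. inv t \<otimes> comb es s \<in> comb es ` set R} = comb es ` {t \<in> set Q. vsub p s t \<in> set R}"
      using m v(2) by blast
    moreover have "inj_on (comb es) {t \<in> set Q. vsub p s t \<in> set R}"
      by (rule inj_on_subset[OF inj]) (use v(2) in auto)
    ultimately show ?thesis using v(4) by (simp add: card_image distinct_length_filter Int_def conj_commute)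
  qed
  have "{x \<in> comb es ` set P. card {t \<in> comb es ` set Q. inv t \<otimes> x \<in> comb es ` set R} = n}
      = comb es ` set (vstep p P Q R n)"
    using cnt v(1) by (auto simp: vstep_def)
  then show ?thesis using invar_count_in[OF P Q R, of "\<lambda>k. k = n"] by simp
qed

lemma invar_vdiff:
  assumes K: "subgroup K G" and es: "set es \<subseteq> carrier G" "indep es"
    and P: "invar K S (comb es ` set P)" and A: "invar K S (comb es ` set A)"
    and v: "set P \<subseteq> vecs p (length es)" "set A \<subseteq> vecs p (length es)"
  shows "invar K S (comb es ` set (vdiff P A))"
proof -
  interpret subgrp G K by (rule subgrpI[OF K])
  have "comb es ` set P - comb es ` set A = comb es ` set (vdiff P A)"
    using inj_on_image_mem_iff[OF comb_inj[OF es] _ v(2)] v(1) by (auto simp: vdiff_def subset_iff)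
  then show ?thesis using invar_Diff[OF P A] by simp
qed

lemma fixd_vsub:
  assumes K: "subgroup K G" and es: "set es \<subseteq> carrier G"
    and uv: "comb es u \<in> fixd K S" "comb es v \<in> fixd K S" "length u = length es" "length v = length es"
  shows "comb es (vsub p v u) \<in> fixd K S"
proof -
  interpret subgrp G K by (rule subgrpI[OF K])
  have "inv (comb es u) \<otimes> comb es v \<in> fixd K S"
    by (rule subgroup.m_closed[OF fixd_subgroup subgroup.m_inv_closed[OF fixd_subgroup uv(1)] uv(2)])
  then show ?thesis using comb_vsub[OF es uv(3,4)] by simp
qed

end

text \<open>The connection sets \<open>rigid_2_5\<close> and \<open>rigid_3_3\<close> were found by a computer search. The lists
  derived from them are the classes of a partition that is refined by counting arcs until
  sufficiently many classes are singletons.\<close>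

definition rigid_2_5 :: "int list list" where
  "rigid_2_5 = [[1, 0, 0, 0, 0], [0, 1, 0, 0, 0], [0, 0, 1, 0, 0], [0, 1, 1, 0, 0],
    [0, 0, 0, 1, 0], [1, 0, 0, 1, 0], [0, 0, 1, 1, 0], [0, 0, 0, 0, 1], [0, 0, 1, 0, 1],
    [1, 0, 1, 0, 1], [0, 1, 1, 0, 1], [0, 1, 0, 1, 1]]"

definition rigid_2_5_A1 :: "int list list" where "rigid_2_5_A1 = [[1, 0, 0, 0, 0], [0, 1, 0, 0, 0],
    [0, 1, 1, 0, 0], [0, 0, 0, 1, 0], [0, 0, 1, 1, 0], [0, 0, 0, 0, 1]]"
definition rigid_2_5_B1 :: "int list list" where "rigid_2_5_B1 = [[0, 0, 1, 0, 0], [1, 0, 0, 1, 0],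
    [0, 0, 1, 0, 1], [1, 0, 1, 0, 1], [0, 1, 1, 0, 1], [0, 1, 0, 1, 1]]"
definition rigid_2_5_A2 :: "int list list" where "rigid_2_5_A2 = [[0, 0, 1, 0, 0], [0, 0, 1, 0, 1], [0, 1, 1, 0, 1]]"
definition rigid_2_5_B2 :: "int list list" where "rigid_2_5_B2 = [[1, 0, 0, 1, 0], [1, 0, 1, 0, 1], [0, 1, 0, 1, 1]]"
definition rigid_2_5_A3 :: "int list list" where "rigid_2_5_A3 = [[0, 1, 0, 0, 0], [0, 1, 1, 0, 0], [0, 0, 0, 0, 1]]"
definition rigid_2_5_A4 :: "int list list" where "rigid_2_5_A4 = [[0, 0, 1, 0, 0]]"
definition rigid_2_5_B4 :: "int list list" where "rigid_2_5_B4 = [[0, 0, 1, 0, 1], [0, 1, 1, 0, 1]]"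
definition rigid_2_5_A5 :: "int list list" where "rigid_2_5_A5 = [[0, 0, 1, 0, 1]]"
definition rigid_2_5_B5 :: "int list list" where "rigid_2_5_B5 = [[0, 1, 1, 0, 1]]"
definition rigid_2_5_A6 :: "int list list" where "rigid_2_5_A6 = [[1, 0, 0, 1, 0]]"
definition rigid_2_5_B6 :: "int list list" where "rigid_2_5_B6 = [[1, 0, 1, 0, 1], [0, 1, 0, 1, 1]]"
definition rigid_2_5_A7 :: "int list list" where "rigid_2_5_A7 = [[1, 0, 1, 0, 1]]"

lemmas rigid_2_5_defs = rigid_2_5_def rigid_2_5_A1_def rigid_2_5_B1_def rigid_2_5_A2_def rigid_2_5_B2_def rigid_2_5_A3_def rigid_2_5_A4_def rigid_2_5_B4_def rigid_2_5_A5_def rigid_2_5_B5_def rigid_2_5_A6_def rigid_2_5_B6_def rigid_2_5_A7_def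

lemma rigid_2_5_steps:
  shows "vstep 2 rigid_2_5 rigid_2_5 rigid_2_5 4 = rigid_2_5_A1"
    "vdiff rigid_2_5 rigid_2_5_A1 = rigid_2_5_B1"
    "vstep 2 rigid_2_5_B1 rigid_2_5 rigid_2_5 6 = rigid_2_5_A2"
    "vdiff rigid_2_5_B1 rigid_2_5_A2 = rigid_2_5_B2"
    "vstep 2 rigid_2_5_A1 rigid_2_5 rigid_2_5_B2 0 = rigid_2_5_A3"
    "vstep 2 rigid_2_5_A2 rigid_2_5 rigid_2_5_A1 5 = rigid_2_5_A4"
    "vdiff rigid_2_5_A2 rigid_2_5_A4 = rigid_2_5_B4"
    "vstep 2 rigid_2_5_B4 rigid_2_5 rigid_2_5_A1 3 = rigid_2_5_A5"
    "vdiff rigid_2_5_B4 rigid_2_5_A5 = rigid_2_5_B5"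
    "vstep 2 rigid_2_5_B2 rigid_2_5 rigid_2_5_A1 2 = rigid_2_5_A6"
    "vdiff rigid_2_5_B2 rigid_2_5_A6 = rigid_2_5_B6"
    "vstep 2 rigid_2_5_B6 rigid_2_5 rigid_2_5_A5 1 = rigid_2_5_A7"
  by code_simp+

lemma rigid_2_5_vecs:
  shows "set rigid_2_5 \<subseteq> vecs 2 5" "distinct rigid_2_5"
    "set rigid_2_5_A1 \<subseteq> vecs 2 5" "distinct rigid_2_5_A1"
    "set rigid_2_5_B1 \<subseteq> vecs 2 5" "distinct rigid_2_5_B1"
    "set rigid_2_5_A2 \<subseteq> vecs 2 5" "distinct rigid_2_5_A2"
    "set rigid_2_5_B2 \<subseteq> vecs 2 5" "distinct rigid_2_5_B2"
    "set rigid_2_5_A3 \<subseteq> vecs 2 5" "distinct rigid_2_5_A3"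
    "set rigid_2_5_A4 \<subseteq> vecs 2 5" "distinct rigid_2_5_A4"
    "set rigid_2_5_B4 \<subseteq> vecs 2 5" "distinct rigid_2_5_B4"
    "set rigid_2_5_A5 \<subseteq> vecs 2 5" "distinct rigid_2_5_A5"
    "set rigid_2_5_B5 \<subseteq> vecs 2 5" "distinct rigid_2_5_B5"
    "set rigid_2_5_A6 \<subseteq> vecs 2 5" "distinct rigid_2_5_A6"
    "set rigid_2_5_B6 \<subseteq> vecs 2 5" "distinct rigid_2_5_B6"
    "set rigid_2_5_A7 \<subseteq> vecs 2 5" "distinct rigid_2_5_A7"
  by (auto simp: rigid_2_5_defs vecs_def)

text \<open>Each counting step splits a class by the number of arcs that arrive from the whole set
  with labels in a class found before. The five vectors isolated in this way span the group.\<close>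

lemma (in elementary) rigid_2_5_fixd:
  assumes pm: "p = 2" "length es = 5" and es: "set es \<subseteq> carrier G" "indep es"
  defines "K \<equiv> generate G (set es)" and "S \<equiv> comb es ` set rigid_2_5"
  shows "comb es [0, 0, 1, 0, 0] \<in> fixd K S"
    "comb es [0, 0, 1, 0, 1] \<in> fixd K S"
    "comb es [0, 1, 1, 0, 1] \<in> fixd K S"
    "comb es [1, 0, 0, 1, 0] \<in> fixd K S"
    "comb es [1, 0, 1, 0, 1] \<in> fixd K S"
proof -
  have K: "subgroup K G" unfolding K_def by (rule generate_is_subgroup[OF es(1)])
  interpret subgrp G K by (rule subgrpI[OF K])
  note v = rigid_2_5_vecs
  have "S \<subseteq> K" unfolding S_def K_def using generate_comb[OF es(1)] v(1) pm by auto
  then have i0: "invar K S (comb es ` set rigid_2_5)" using invar_gens by (simp add: S_def)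
  note step = invar_vstep[OF K es, unfolded pm] and diff = invar_vdiff[OF K es, unfolded pm]
  have iA1: "invar K S (comb es ` set rigid_2_5_A1)"
    using step[OF i0 i0 i0 v(1) v(1) v(1) v(2), of 4] by (simp only: rigid_2_5_steps)
  have iB1: "invar K S (comb es ` set rigid_2_5_B1)"
    using diff[OF i0 iA1 v(1) v(3)] by (simp only: rigid_2_5_steps)
  have iA2: "invar K S (comb es ` set rigid_2_5_A2)"
    using step[OF iB1 i0 i0 v(5) v(1) v(1) v(2), of 6] by (simp only: rigid_2_5_steps)
  have iB2: "invar K S (comb es ` set rigid_2_5_B2)"
    using diff[OF iB1 iA2 v(5) v(7)] by (simp only: rigid_2_5_steps)
  have iA3: "invar K S (comb es ` set rigid_2_5_A3)"
    using step[OF iA1 i0 iB2 v(3) v(1) v(9) v(2), of 0] by (simp only: rigid_2_5_steps)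
  have iA4: "invar K S (comb es ` set rigid_2_5_A4)"
    using step[OF iA2 i0 iA1 v(7) v(1) v(3) v(2), of 5] by (simp only: rigid_2_5_steps)
  have iB4: "invar K S (comb es ` set rigid_2_5_B4)"
    using diff[OF iA2 iA4 v(7) v(13)] by (simp only: rigid_2_5_steps)
  have iA5: "invar K S (comb es ` set rigid_2_5_A5)"
    using step[OF iB4 i0 iA1 v(15) v(1) v(3) v(2), of 3] by (simp only: rigid_2_5_steps)
  have iB5: "invar K S (comb es ` set rigid_2_5_B5)"
    using diff[OF iB4 iA5 v(15) v(17)] by (simp only: rigid_2_5_steps)
  have iA6: "invar K S (comb es ` set rigid_2_5_A6)"
    using step[OF iB2 i0 iA1 v(9) v(1) v(3) v(2), of 2] by (simp only: rigid_2_5_steps)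
  have iB6: "invar K S (comb es ` set rigid_2_5_B6)"
    using diff[OF iB2 iA6 v(9) v(21)] by (simp only: rigid_2_5_steps)
  have iA7: "invar K S (comb es ` set rigid_2_5_A7)"
    using step[OF iB6 i0 iA5 v(23) v(1) v(17) v(2), of 1] by (simp only: rigid_2_5_steps)
  show "comb es [0, 0, 1, 0, 0] \<in> fixd K S"
    "comb es [0, 0, 1, 0, 1] \<in> fixd K S"
    "comb es [0, 1, 1, 0, 1] \<in> fixd K S"
    "comb es [1, 0, 0, 1, 0] \<in> fixd K S"
    "comb es [1, 0, 1, 0, 1] \<in> fixd K S"
    using iA4 iA5 iB5 iA6 iA7 by (simp_all add: rigid_2_5_defs invar_singleton)
qed

definition rigid_3_3 :: "int list list" where
  "rigid_3_3 = [[1, 0, 0], [0, 1, 0], [0, 0, 1], [0, 1, 2], [2, 1, 2], [1, 1, 0]]"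

definition rigid_3_3_A1 :: "int list list" where "rigid_3_3_A1 = [[1, 0, 0], [0, 0, 1], [2, 1, 2]]"
definition rigid_3_3_B1 :: "int list list" where "rigid_3_3_B1 = [[0, 1, 0], [0, 1, 2], [1, 1, 0]]"
definition rigid_3_3_A2 :: "int list list" where "rigid_3_3_A2 = [[0, 1, 0], [1, 1, 0]]"
definition rigid_3_3_B2 :: "int list list" where "rigid_3_3_B2 = [[0, 1, 2]]"
definition rigid_3_3_A3 :: "int list list" where "rigid_3_3_A3 = [[0, 1, 0]]"
definition rigid_3_3_B3 :: "int list list" where "rigid_3_3_B3 = [[1, 1, 0]]"

lemmas rigid_3_3_defs = rigid_3_3_def rigid_3_3_A1_def rigid_3_3_B1_def rigid_3_3_A2_def rigid_3_3_B2_def rigid_3_3_A3_def rigid_3_3_B3_def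

lemma rigid_3_3_steps:
  shows "vstep 3 rigid_3_3 rigid_3_3 rigid_3_3 0 = rigid_3_3_A1"
    "vdiff rigid_3_3 rigid_3_3_A1 = rigid_3_3_B1"
    "vstep 3 rigid_3_3_B1 rigid_3_3 rigid_3_3_A1 1 = rigid_3_3_A2"
    "vdiff rigid_3_3_B1 rigid_3_3_A2 = rigid_3_3_B2"
    "vstep 3 rigid_3_3_A2 rigid_3_3 rigid_3_3_A2 0 = rigid_3_3_A3"
    "vdiff rigid_3_3_A2 rigid_3_3_A3 = rigid_3_3_B3"
  by code_simp+

lemma rigid_3_3_vecs:
  shows "set rigid_3_3 \<subseteq> vecs 3 3" "distinct rigid_3_3"
    "set rigid_3_3_A1 \<subseteq> vecs 3 3" "distinct rigid_3_3_A1"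
    "set rigid_3_3_B1 \<subseteq> vecs 3 3" "distinct rigid_3_3_B1"
    "set rigid_3_3_A2 \<subseteq> vecs 3 3" "distinct rigid_3_3_A2"
    "set rigid_3_3_B2 \<subseteq> vecs 3 3" "distinct rigid_3_3_B2"
    "set rigid_3_3_A3 \<subseteq> vecs 3 3" "distinct rigid_3_3_A3"
    "set rigid_3_3_B3 \<subseteq> vecs 3 3" "distinct rigid_3_3_B3"
  by (auto simp: rigid_3_3_defs vecs_def)

lemma (in elementary) rigid_3_3_fixd:
  assumes pm: "p = 3" "length es = 3" and es: "set es \<subseteq> carrier G" "indep es"
  defines "K \<equiv> generate G (set es)" and "S \<equiv> comb es ` set rigid_3_3"
  shows "comb es [0, 1, 2] \<in> fixd K S"
    "comb es [0, 1, 0] \<in> fixd K S"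
    "comb es [1, 1, 0] \<in> fixd K S"
proof -
  have K: "subgroup K G" unfolding K_def by (rule generate_is_subgroup[OF es(1)])
  interpret subgrp G K by (rule subgrpI[OF K])
  note v = rigid_3_3_vecs
  have "S \<subseteq> K" unfolding S_def K_def using generate_comb[OF es(1)] v(1) pm by auto
  then have i0: "invar K S (comb es ` set rigid_3_3)" using invar_gens by (simp add: S_def)
  note step = invar_vstep[OF K es, unfolded pm] and diff = invar_vdiff[OF K es, unfolded pm]
  have iA1: "invar K S (comb es ` set rigid_3_3_A1)"
    using step[OF i0 i0 i0 v(1) v(1) v(1) v(2), of 0] by (simp only: rigid_3_3_steps)
  have iB1: "invar K S (comb es ` set rigid_3_3_B1)"
    using diff[OF i0 iA1 v(1) v(3)] by (simp only: rigid_3_3_steps)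
  have iA2: "invar K S (comb es ` set rigid_3_3_A2)"
    using step[OF iB1 i0 iA1 v(5) v(1) v(3) v(2), of 1] by (simp only: rigid_3_3_steps)
  have iB2: "invar K S (comb es ` set rigid_3_3_B2)"
    using diff[OF iB1 iA2 v(5) v(7)] by (simp only: rigid_3_3_steps)
  have iA3: "invar K S (comb es ` set rigid_3_3_A3)"
    using step[OF iA2 i0 iA2 v(7) v(1) v(7) v(2), of 0] by (simp only: rigid_3_3_steps)
  have iB3: "invar K S (comb es ` set rigid_3_3_B3)"
    using diff[OF iA2 iA3 v(7) v(11)] by (simp only: rigid_3_3_steps)
  show "comb es [0, 1, 2] \<in> fixd K S"
    "comb es [0, 1, 0] \<in> fixd K S"
    "comb es [1, 1, 0] \<in> fixd K S"
    using iB2 iA3 iB3 by (simp_all add: rigid_3_3_defs invar_singleton)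
qed

context elementary
begin

lemma sparse_comb:
  assumes es: "set es \<subseteq> carrier G" "indep es" and L: "set L \<subseteq> vecs p (length es)" "distinct L"
    and zero: "replicate (length es) 0 \<notin> set L" and card: "2 \<le> length L" "2 * length L + 4 \<le> p ^ length es"
    and fx: "set es \<subseteq> fixd (generate G (set es)) (comb es ` set L)"
  shows "sparse (generate G (set es)) (comb es ` set L)"
proof -
  let ?K = "generate G (set es)"
  interpret subgrp G ?K by (rule generate_subgrp[OF es(1)])
  have z: "replicate (length es) 0 \<in> vecs p (length es)" using p_pos by (auto simp: vecs_def)
  have "\<one> \<notin> comb es ` set L"
    using inj_on_image_mem_iff[OF comb_inj[OF es] z L(1)] zero comb_zero[OF es(1)] by simp
  moreover have "card (comb es ` set L) = length L"
    using card_image[OF inj_on_subset[OF comb_inj[OF es] L(1)]] L(2) by (simp add: distinct_card)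
  moreover have "comb es ` set L \<subseteq> ?K" using generate_comb[OF es(1)] L(1) by auto
  moreover have "rigid ?K (comb es ` set L)" by (rule rigidI[OF fx]) simp
  ultimately show ?thesis
    using card card_generate_indep[OF es] finite_generate_list[OF es(1)] subgroup_K
    by (simp add: sparse_def)
qed

theorem sparse_two_power_five:
  assumes "p = 2" "length es = 5" and es: "set es \<subseteq> carrier G" "indep es"
  shows "sparse (generate G (set es)) (comb es ` set rigid_2_5)"
proof (rule sparse_comb[OF es])
  let ?F = "fixd (generate G (set es)) (comb es ` set rigid_2_5)"
  have K: "subgroup (generate G (set es)) G" by (rule generate_is_subgroup[OF es(1)])
  note fx = rigid_2_5_fixd[OF assms]
  note sub = fixd_vsub[OF K es(1), of _ "comb es ` set rigid_2_5", unfolded assms(1,2)]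
  \<comment> \<open>The third unit vector is fixed already; the others are differences of fixed
    vectors.\<close>
  have e: "comb es [0, 0, 0, 0, 1] \<in> ?F" using sub[OF fx(1,2)] by (simp add: vsub_def)
  have a: "comb es [1, 0, 0, 0, 0] \<in> ?F" using sub[OF fx(2,5)] by (simp add: vsub_def)
  have b: "comb es [0, 1, 0, 0, 0] \<in> ?F" using sub[OF fx(2,3)] by (simp add: vsub_def)
  have d: "comb es [0, 0, 0, 1, 0] \<in> ?F" using sub[OF a fx(4)] by (simp add: vsub_def)
  obtain x1 x2 x3 x4 x5 where x: "es = [x1, x2, x3, x4, x5]"
    using assms(2) by (auto simp: numeral_eq_Suc length_Suc_conv)
  show "set es \<subseteq> ?F" using a b fx(1) d e es(1) by (simp add: x)
qed (use assms rigid_2_5_vecs in \<open>auto simp: rigid_2_5_def numeral_eq_Suc\<close>)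

theorem sparse_three_power_three:
  assumes "p = 3" "length es = 3" and es: "set es \<subseteq> carrier G" "indep es"
  shows "sparse (generate G (set es)) (comb es ` set rigid_3_3)" "asymmetric (comb es ` set rigid_3_3)"
proof -
  let ?F = "fixd (generate G (set es)) (comb es ` set rigid_3_3)"
  have K: "subgroup (generate G (set es)) G" by (rule generate_is_subgroup[OF es(1)])
  note fx = rigid_3_3_fixd[OF assms]
  note sub = fixd_vsub[OF K es(1), of _ "comb es ` set rigid_3_3", unfolded assms(1,2)]
  have c: "comb es [0, 0, 1] \<in> ?F" using sub[OF fx(1,2)] by (simp add: vsub_def)
  have a: "comb es [1, 0, 0] \<in> ?F" using sub[OF fx(2,3)] by (simp add: vsub_def)
  obtain x1 x2 x3 where x: "es = [x1, x2, x3]"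
    using assms(2) by (auto simp: numeral_eq_Suc length_Suc_conv)
  have "set es \<subseteq> ?F" using a fx(2) c es(1) by (simp add: x)
  then show "sparse (generate G (set es)) (comb es ` set rigid_3_3)"
    by (rule sparse_comb[OF es, rotated -1]) (use assms rigid_3_3_vecs in \<open>auto simp: rigid_3_3_def numeral_eq_Suc\<close>)
  note inj = inj_onD[OF comb_inj[OF es, unfolded assms(1,2)]]
  \<comment> \<open>The first unit vector witnesses asymmetry, as its negative is not in the
    list.\<close>
  have iv: "inv (comb es [1, 0, 0]) = comb es [2, 0, 0]"
    using comb_vsub[OF es(1), of "[1, 0, 0]" "[0, 0, 0]"] comb_zero[OF es(1), of 3] assms comb_closed[OF es(1)]
    by (simp add: vsub_def numeral_eq_Suc)
  have v: "[2, 0, 0] \<in> vecs 3 3" "[0, 0, 0] \<in> vecs 3 3" "[1, 0, 0] \<in> vecs 3 3" by (auto simp: vecs_def)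
  have "comb es [2, 0, 0] \<notin> comb es ` set rigid_3_3"
    using inj_on_image_mem_iff[OF comb_inj[OF es, unfolded assms(1,2)] v(1) rigid_3_3_vecs(1)] by (simp add: rigid_3_3_def)
  moreover have "comb es [1, 0, 0] \<otimes> comb es [1, 0, 0] \<noteq> \<one>"
  proof
    assume "comb es [1, 0, 0] \<otimes> comb es [1, 0, 0] = \<one>"
    then have "comb es [2, 0, 0] = comb es [1, 0, 0]" using iv comb_closed[OF es(1)] square_eq_oneD by metis
    then show False using inj[OF _ v(1,3)] by simp
  qed
  ultimately show "asymmetric (comb es ` set rigid_3_3)" unfolding asymmetric_def
    using iv by (intro bexI[of _ "comb es [1, 0, 0]"]) (auto simp: rigid_3_3_def)
qed

end

subsection \<open>Groups without sparse subgroups\<close>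

context group
begin

text \<open>The element z = x^2 is the image of -1. Moving z to the front and x before y brings
  every word to a normal form, so the homomorphism property is a finite check. The kernel is trivial
  because x^2 is none of 1, x, y, xy.\<close>

theorem iso_quaternion_group:
  assumes c: "x \<in> carrier G" "y \<in> carrier G" and nc: "x \<otimes> y \<noteq> y \<otimes> x"
    and D: "y \<otimes> (x \<otimes> y) = x" and F: "x \<otimes> y \<otimes> x = y" and xx: "x \<otimes> x \<noteq> \<one>"
    and gen: "generate G {x, y} = carrier G"
  shows "G \<cong> quaternion_group"
proof -
  define z where "z = x \<otimes> x"
  have zc: "z \<in> carrier G" using c by (simp add: z_def)
  note mi = mutual_inversion[OF c D F]
  have zz: "z \<otimes> z = \<one>" using mi(3) by (simp add: z_def)
  have yy: "y \<otimes> y = z" using mi(2) by (simp add: z_def)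
  have ix: "inv x = z \<otimes> x" using c zz by (intro inv_equality) (simp_all add: z_def m_assoc)
  have yx: "y \<otimes> x = z \<otimes> (x \<otimes> y)" using mi(1) ix c zc by (simp add: m_assoc)
  have zx: "x \<otimes> z = z \<otimes> x" using c by (simp add: z_def m_assoc)
  have zy: "y \<otimes> z = z \<otimes> y" unfolding yy[symmetric] using c by (simp add: m_assoc)
  have zr: "z \<otimes> (z \<otimes> g) = g" if "g \<in> carrier G" for g using that zz zc by (simp flip: m_assoc)
  have xxr: "x \<otimes> (x \<otimes> g) = z \<otimes> g" if "g \<in> carrier G" for g using that c by (simp add: z_def m_assoc)
  have yyr: "y \<otimes> (y \<otimes> g) = z \<otimes> g" if "g \<in> carrier G" for g using that c by (simp flip: m_assoc yy)
  have yxr: "y \<otimes> (x \<otimes> g) = z \<otimes> (x \<otimes> (y \<otimes> g))" if "g \<in> carrier G" for g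
  proof -
    have "y \<otimes> (x \<otimes> g) = (y \<otimes> x) \<otimes> g" using c that by (simp add: m_assoc)
    then show ?thesis unfolding yx using c zc that by (simp add: m_assoc)
  qed
  have zxr: "x \<otimes> (z \<otimes> g) = z \<otimes> (x \<otimes> g)" if "g \<in> carrier G" for g
    using that c zc zx by (simp flip: m_assoc)
  have zyr: "y \<otimes> (z \<otimes> g) = z \<otimes> (y \<otimes> g)" if "g \<in> carrier G" for g
    using that c zc zy by (simp flip: m_assoc)
  define m where "m u = (case u of Q1 \<Rightarrow> \<one> | Qi \<Rightarrow> x | Qj \<Rightarrow> y | Qk \<Rightarrow> x \<otimes> y)" for u
  define h where "h = (\<lambda>(s, u). (if s then z else \<one>) \<otimes> m u)"
  have xx': "x \<otimes> x = z" by (simp add: z_def)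
  note rules = c zc m_assoc zz yy xx' yx zx zy zr xxr yyr yxr zxr zyr
  have hom: "h ((s, u) \<otimes>\<^bsub>quaternion_group\<^esub> (t, v)) = h (s, u) \<otimes> h (t, v)" for s u t v
    by (cases u; cases v; cases s; cases t)
      (simp_all add: h_def m_def quaternion_group_def rules)
  have hc: "h q \<in> carrier G" for q
    using c zc by (cases q; cases "snd q") (auto simp: h_def m_def)
  have gh: "group_hom quaternion_group G h"
    using hom hc group_quaternion_group is_group
    by (auto simp: group_hom_def group_hom_axioms_def hom_def)
  interpret h: group_hom quaternion_group G h by (rule gh)
  note f = noncommuting_facts[OF c nc]
  have ker: "q = (False, Q1)" if "h q = \<one>" for q
  proof -
    obtain s u where q: "q = (s, u)" by (cases q)
    have "m u = z" if s
    proof -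
      have mc: "m u \<in> carrier G" using c by (cases u) (auto simp: m_def)
      have "z \<otimes> m u = \<one>" using \<open>h q = \<one>\<close> that by (simp add: q h_def)
      then have "z \<otimes> (z \<otimes> m u) = z" using zc by simp
      then show ?thesis using zr[OF mc] by simp
    qed
    moreover have "m u = \<one>" if "\<not> s"
      using \<open>h q = \<one>\<close> that c by (cases u) (simp_all add: q h_def m_def)
    moreover have "m u \<noteq> z" for u
      using f xx c by (cases u) (auto simp: m_def z_def)
    moreover have "u = Q1" if "m u = \<one>" using that f by (cases u) (auto simp: m_def)
    ultimately show ?thesis using q by auto
  qed
  have one: "\<one>\<^bsub>quaternion_group\<^esub> = (False, Q1)" by (simp add: quaternion_group_def)
  have "kernel quaternion_group G h = {\<one>\<^bsub>quaternion_group\<^esub>}"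
  proof -
    have "h (False, Q1) = \<one>" by (simp add: h_def m_def)
    moreover have "carrier quaternion_group = UNIV" by (simp add: quaternion_group_def)
    ultimately show ?thesis unfolding kernel_def one using ker by blast
  qed
  then have inj: "inj_on h (carrier quaternion_group)" using h.inj_iff_trivial_ker by blast
  have sub: "subgroup (h ` carrier quaternion_group) G"
    by (rule h.img_is_subgroup)
  have "x = h (False, Qi)" "y = h (False, Qj)" using c by (simp_all add: h_def m_def)
  then have "{x, y} \<subseteq> h ` carrier quaternion_group" by (auto simp: quaternion_group_def)
  then have "carrier G \<subseteq> h ` carrier quaternion_group"
    using generate_subgroup_incl[OF _ sub] gen by blast
  then have "h \<in> iso quaternion_group G"
    using inj hc h.homh by (auto simp: iso_def bij_betw_def)
  then show ?thesis using group.iso_sym[OF group_quaternion_group] unfolding is_iso_def by blast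
qed

end

text \<open>What is left once infinite pairs and asymmetric sparse sets have been dealt with.
  Together with the lemmas on sparse sets, the assumptions become upper bounds for orders of
  subgroups.\<close>

locale thin = group +
  assumes finite_pair: "\<And>x y. x \<in> carrier G \<Longrightarrow> y \<in> carrier G \<Longrightarrow> finite (generate G {x, y})"
    and no_sparse: "\<And>K T. sparse K T \<Longrightarrow> \<not> asymmetric T"
begin

lemma finite_single: "x \<in> carrier G \<Longrightarrow> finite (generate G {x})"
  using finite_pair[of x x] by simp

lemma card_single: "x \<in> carrier G \<Longrightarrow> card (generate G {x}) \<le> 7"
  using sparse_cyclic[of x] no_sparse finite_single by fastforce

lemma card_involution_pair:
  assumes "x \<in> carrier G" "y \<in> carrier G" "x \<otimes> x \<noteq> \<one>" "y \<otimes> y = \<one>" "y \<noteq> \<one>"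
  shows "card (generate G {x, y}) \<le> 7"
  using sparse_pair[OF assms finite_pair[OF assms(1,2)]] no_sparse by fastforce

lemma card_two_cosets:
  assumes c: "x \<in> carrier G" "y \<in> carrier G" and y: "y \<notin> generate G {x}"
  shows "2 * card (generate G {x}) \<le> card (generate G {x, y})"
proof -
  interpret X: subgrp G "generate G {x}" using c by (intro generate_subgrp) auto
  interpret K: subgrp G "generate G {x, y}" using c by (intro generate_subgrp) auto
  have "y \<noteq> \<one>" using y X.K_closed by auto
  have iy: "inv y \<notin> generate G {x}" using X.K_closed(2)[of "inv y"] y c by auto
  have "card (generate G {x}) * card {\<one>, y} \<le> card (generate G {x, y})"
    by (rule card_cosets[OF X.subgroup_K _ K.subgroup_K finite_pair[OF c]])
      (use c y iy K.K_closed in \<open>auto intro: generate.incl mono_generate[THEN subsetD, of "{x}"]\<close>)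
  then show ?thesis using \<open>y \<noteq> \<one>\<close> by simp
qed

lemma card_three_cosets:
  assumes c: "x \<in> carrier G" "y \<in> carrier G" and y: "y \<notin> generate G {x}"
    and g: "g \<in> generate G {x, y}" "g \<notin> generate G {x}" "g \<otimes> inv y \<notin> generate G {x}"
  shows "3 * card (generate G {x}) \<le> card (generate G {x, y})"
proof -
  interpret X: subgrp G "generate G {x}" using c by (intro generate_subgrp) auto
  interpret K: subgrp G "generate G {x, y}" using c by (intro generate_subgrp) auto
  have gc: "g \<in> carrier G" using g K.K_carrier by blast
  have ne: "y \<noteq> \<one>" "g \<noteq> \<one>" "g \<noteq> y" using y g X.K_closed c by auto
  have i: "inv h \<notin> generate G {x}" if "h \<in> carrier G" "h \<notin> generate G {x}" for h
    using X.K_closed(2)[of "inv h"] that by auto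
  have "y \<otimes> inv g \<notin> generate G {x}" using i[of "g \<otimes> inv y"] g(3) gc c by (simp add: inv_mult_group)
  then have "card (generate G {x}) * card {\<one>, y, g} \<le> card (generate G {x, y})"
    by (intro card_cosets[OF X.subgroup_K _ K.subgroup_K finite_pair[OF c]])
      (use c y g gc i K.K_closed in \<open>auto intro: generate.incl mono_generate[THEN subsetD, of "{x}"]\<close>)
  then show ?thesis using ne by simp
qed

lemma mem_generate_four:
  assumes x: "x \<in> carrier G" "card (generate G {x}) = 4" and g: "g \<in> generate G {x}"
  shows "g = \<one> \<or> g = x \<or> g = x \<otimes> x \<or> g = inv x"
proof -
  interpret X: subgrp G "generate G {x}" using x by (intro generate_subgrp) auto
  have n: "x \<noteq> \<one>" "x \<otimes> x \<noteq> \<one>" "x \<otimes> (x \<otimes> x) \<noteq> \<one>"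
    using pow_neq_one[OF x(1), of 1] pow_neq_one[OF x(1), of 2] pow_neq_one[OF x(1), of 3] x
    by (auto simp: numeral_eq_Suc m_assoc)
  have "inv x \<noteq> x" "inv x \<noteq> x \<otimes> x" "inv x \<noteq> \<one>" "x \<noteq> x \<otimes> x"
    using n x(1) by (metis r_inv, metis r_inv, metis inv_eq_1_iff, simp)
  then have "card {\<one>, x, x \<otimes> x, inv x} = 4" using n by auto
  moreover have "{\<one>, x, x \<otimes> x, inv x} \<subseteq> generate G {x}"
    using X.K_closed by (auto intro: generate.incl generate.inv generate.eng)
  ultimately have "{\<one>, x, x \<otimes> x, inv x} = generate G {x}"
    using card_subset_eq[OF finite_single[OF x(1)]] x(2) by metis
  then show ?thesis using g by blast
qed

text \<open>Let X and K be generated by x and by x, y. If |K| \<ge> 10, then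
  \<open>sparse_square\<close> rules out commuting elements and \<open>sparse_triple\<close> leaves
  only mutual inversion. If |K| < 10, then |X| = 4 and K consists of two cosets of X, so that y
  normalises X and y^2 is in X, and the few possible values are inspected.\<close>

lemma mutual_inversion_of_order:
  assumes c: "x \<in> carrier G" "y \<in> carrier G" and y: "y \<notin> generate G {x}" and ord: "4 \<le> card (generate G {x})"
  shows "x \<otimes> y \<noteq> y \<otimes> x \<and> y \<otimes> (x \<otimes> y) = x \<and> x \<otimes> y \<otimes> x = y"
proof -
  let ?X = "generate G {x}" and ?K = "generate G {x, y}"
  interpret X: subgrp G ?X using c by (intro generate_subgrp) auto
  interpret K: subgrp G ?K using c by (intro generate_subgrp) auto
  have xX: "x \<in> ?X" by (auto intro: generate.incl)
  have xK: "x \<in> ?K" "y \<in> ?K" by (auto intro: generate.incl)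
  have n: "x \<noteq> \<one>" "x \<otimes> x \<noteq> \<one>" "x \<otimes> (x \<otimes> x) \<noteq> \<one>"
    using pow_neq_one[OF c(1), of 1] pow_neq_one[OF c(1), of 2] pow_neq_one[OF c(1), of 3] ord c
    by (auto simp: numeral_eq_Suc m_assoc)
  \<comment> \<open>Two cosets of \<open>?X\<close> have at least 8 elements, while x and an
    involution generate at most 7.\<close>
  have no_inv: "g \<otimes> g \<noteq> \<one>" if g: "g \<in> carrier G" "g \<notin> ?X" for g
  proof
    assume "g \<otimes> g = \<one>"
    moreover have "g \<noteq> \<one>" using g X.K_closed by auto
    ultimately have "card (generate G {x, g}) \<le> 7" by (intro card_involution_pair c n g)
    then show False using card_two_cosets[OF c(1) g] ord by simp
  qed
  note two = card_two_cosets[OF c y]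
  have big: "10 \<le> card ?K" if "5 \<le> card ?X" using two that by simp
  have three: "g \<in> ?X \<or> g \<otimes> inv y \<in> ?X" if "g \<in> ?K" "card ?K < 10" for g
    using card_three_cosets[OF c y that(1)] that(2) ord by linarith
  have four: "card ?X = 4" if "card ?K < 10" using big that ord by linarith
  have xy: "x \<notin> generate G {y}"
  proof
    assume "x \<in> generate G {y}"
    then have "?K \<subseteq> generate G {y}" using c by (intro generate_mono2) (auto intro: generate.incl)
    then have "card ?K \<le> card (generate G {y})" by (rule card_mono[OF finite_single[OF c(2)]])
    then show False using card_single[OF c(2)] two ord by linarith
  qed
  have yX: "inv y \<notin> ?X" using X.K_closed(2)[of "inv y"] y c by auto
  have nc: "x \<otimes> y \<noteq> y \<otimes> x"
  proof
    assume comm: "x \<otimes> y = y \<otimes> x"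
    have iy: "x \<otimes> inv y \<notin> ?X"
    proof
      assume "x \<otimes> inv y \<in> ?X"
      then have "inv x \<otimes> (x \<otimes> inv y) \<in> ?X" using xX X.K_closed by blast
      then show False using yX c by simp
    qed
    \<comment> \<open>Otherwise x y^{-1} would be an involution outside \<open>?X\<close>.\<close>
    have "y \<otimes> y \<noteq> x \<otimes> x"
    proof
      assume e: "y \<otimes> y = x \<otimes> x"
      have "inv y \<otimes> x = x \<otimes> inv y" using comm c by (metis inv_solve_left inv_solve_right m_assoc inv_closed m_closed)
      then have "(x \<otimes> inv y) \<otimes> (x \<otimes> inv y) = (x \<otimes> x) \<otimes> (inv y \<otimes> inv y)"
        using c by (metis m_assoc inv_closed m_closed)
      also have "\<dots> = \<one>" unfolding e[symmetric] using c by (simp add: m_assoc)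
      finally show False using no_inv[of "x \<otimes> inv y"] iy c by simp
    qed
    moreover have "10 \<le> card ?K"
    proof (rule ccontr)
      assume s: "\<not> 10 \<le> card ?K"
      have "y \<otimes> y \<otimes> inv y = y" using c by (simp add: m_assoc)
      then have "y \<otimes> y \<in> ?X" using three[of "y \<otimes> y"] s xK K.K_closed y by auto
      then consider "y \<otimes> y = \<one>" | "y \<otimes> y = x" | "y \<otimes> y = x \<otimes> x" | "y \<otimes> y = inv x"
        using mem_generate_four[OF c(1) four] s by fastforce
      then show False
      proof cases
        case 2
        then have "x \<in> generate G {y}" by (metis generate.eng generate.incl singletonI)
        then show False using xy by blast
      next
        case 4
        interpret Y: subgrp G "generate G {y}" using c by (intro generate_subgrp) auto
        have "inv (y \<otimes> y) \<in> generate G {y}" by (intro Y.K_closed) (auto intro: generate.incl)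
        then show False using xy c 4 by simp
      qed (use no_inv[OF c(2) y] \<open>y \<otimes> y \<noteq> x \<otimes> x\<close> in auto)
    qed
    ultimately show False
      using sparse_square[OF c n(2,3) no_inv[OF c(2) y] _ y xy finite_pair[OF c]] no_sparse by blast
  qed
  show ?thesis
  proof (cases "10 \<le> card ?K")
    case True
    then show ?thesis
      using sparse_triple[OF c nc n(2) no_inv[OF c(2) y] _ finite_pair[OF c]] no_sparse nc by blast
  next
    case False
    then have s: "card ?K < 10" "card ?X = 4" using four by auto
    note mem = mem_generate_four[OF c(1) s(2)]
    have "y \<otimes> x \<notin> ?X"
    proof
      assume "y \<otimes> x \<in> ?X"
      then have "(y \<otimes> x) \<otimes> inv x \<in> ?X" using xX X.K_closed by blast
      then show False using y c by (simp add: m_assoc)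
    qed
    then have cX: "y \<otimes> x \<otimes> inv y \<in> ?X" using three[of "y \<otimes> x"] s xK K.K_closed by blast
    have yx: "y \<otimes> x = (y \<otimes> x \<otimes> inv y) \<otimes> y" using c by (simp add: m_assoc)
    have "y \<otimes> x \<otimes> inv y = inv x"
      using mem[OF cX]
    proof (elim disjE)
      assume "y \<otimes> x \<otimes> inv y = \<one>"
      then have "y \<otimes> x = y" using yx c by simp
      then show ?thesis using n c by simp
    next
      assume "y \<otimes> x \<otimes> inv y = x"
      then show ?thesis using yx nc by simp
    next
      assume e: "y \<otimes> x \<otimes> inv y = x \<otimes> x"
      have "x \<otimes> (x \<otimes> (x \<otimes> x)) = x [^] (4::nat)" using c by (simp add: numeral_eq_Suc m_assoc)
      then have x4: "x \<otimes> x \<otimes> (x \<otimes> x) = \<one>" using pow_eq_id[OF c(1), of 4] generate_pow_card[OF c(1)] s c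
        by (simp add: m_assoc)
      have "y \<otimes> (x \<otimes> x) \<otimes> inv y = (y \<otimes> x \<otimes> inv y) \<otimes> (y \<otimes> x \<otimes> inv y)" using c by (simp add: m_assoc)
      then have "y \<otimes> (x \<otimes> x) \<otimes> inv y = \<one>" using e x4 by simp
      then have "y \<otimes> (x \<otimes> x) = y" using c by (metis inv_solve_right' l_one m_closed one_closed)
      then show ?thesis using n c by simp
    qed
    then have yx': "y \<otimes> x = inv x \<otimes> y" using yx by simp
    have "y \<otimes> y \<otimes> inv y = y" using c by (simp add: m_assoc)
    then have "y \<otimes> y \<in> ?X" using three[of "y \<otimes> y"] s xK K.K_closed y by auto
    have comm_yy: "y \<otimes> (y \<otimes> y) = (y \<otimes> y) \<otimes> y" using c by (simp add: m_assoc)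
    have yy: "y \<otimes> y = x \<otimes> x"
      using mem[OF \<open>y \<otimes> y \<in> ?X\<close>]
    proof (elim disjE)
      assume "y \<otimes> y = \<one>" then show ?thesis using no_inv[OF c(2) y] by simp
    next
      assume "y \<otimes> y = x" then show ?thesis using comm_yy nc by simp
    next
      assume e: "y \<otimes> y = inv x"
      then have "y \<otimes> inv x = inv x \<otimes> y" using comm_yy by simp
      then have "x \<otimes> y = y \<otimes> x" using c by (metis inv_solve_left inv_solve_right m_assoc inv_closed m_closed)
      then show ?thesis using nc by simp
    qed
    have "y \<otimes> (x \<otimes> y) = (y \<otimes> x) \<otimes> y" using c by (simp add: m_assoc)
    also have "\<dots> = inv x \<otimes> (y \<otimes> y)" unfolding yx' using c by (simp add: m_assoc)
    also have "\<dots> = x" unfolding yy using c by simp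
    finally have "y \<otimes> (x \<otimes> y) = x" .
    moreover have "x \<otimes> y \<otimes> x = x \<otimes> (y \<otimes> x)" using c by (simp add: m_assoc)
    then have "x \<otimes> y \<otimes> x = y" unfolding yx' using c by simp
    ultimately show ?thesis using nc by blast
  qed
qed

lemma card_four:
  assumes "x \<in> carrier G" "x \<otimes> x \<noteq> \<one>" "(x \<otimes> x) \<otimes> (x \<otimes> x) = \<one>"
  shows "4 \<le> card (generate G {x})"
proof -
  have "x [^] (4::nat) = \<one>" "x [^] (2::nat) \<noteq> \<one>"
    using assms by (simp_all add: numeral_eq_Suc m_assoc)
  then have d: "ord x dvd 4" "\<not> ord x dvd 2" using pow_eq_id[OF assms(1)] by auto
  have "ord x \<noteq> 0" using d(1) by (metis dvd_0_left_iff zero_neq_numeral)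
  moreover have "ord x \<noteq> 1" "ord x \<noteq> 2" "ord x \<noteq> 3" using d by auto
  ultimately show ?thesis using generate_pow_card[OF assms(1)] by linarith
qed

text \<open>Choose y outside the group of x. An element w outside the group of x and y would invert
  both, hence commute with xy, because x^{-1} y^{-1} = xy; but
  \<open>mutual_inversion_of_order\<close> for xy and w forbids this.\<close>

theorem quaternion_of_order_four:
  assumes c: "x \<in> carrier G" and ord: "4 \<le> card (generate G {x})" and nx: "generate G {x} \<noteq> carrier G"
  shows "G \<cong> quaternion_group"
proof -
  have "generate G {x} \<subseteq> carrier G" using c by (intro generate_incl) auto
  then obtain y where y: "y \<in> carrier G" "y \<notin> generate G {x}" using nx by blast
  have A: "x \<otimes> y \<noteq> y \<otimes> x" "y \<otimes> (x \<otimes> y) = x" "x \<otimes> y \<otimes> x = y"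
    using mutual_inversion_of_order[OF c y ord] by auto
  note mi = mutual_inversion[OF c y(1) A(2,3)]
  have xx: "x \<otimes> x \<noteq> \<one>"
    using pow_neq_one[OF c, of 2] ord c by (simp add: numeral_eq_Suc)
  let ?K = "generate G {x, y}"
  interpret K: subgrp G ?K using c y by (intro generate_subgrp) auto
  have xyK: "x \<in> ?K" "y \<in> ?K" "x \<otimes> y \<in> ?K" by (auto intro: generate.incl generate.eng)
  have sub: "generate G {g} \<subseteq> ?K" if "g \<in> ?K" for g
    using that K.subgroup_K by (intro generate_subgroup_incl) auto
  have "carrier G \<subseteq> ?K"
  proof
    fix w assume w: "w \<in> carrier G"
    show "w \<in> ?K"
    proof (rule ccontr)
      assume wK: "w \<notin> ?K"
      have xyc: "x \<otimes> y \<in> carrier G" using c y by simp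
      have y4: "4 \<le> card (generate G {y})" by (rule card_four[OF y(1)]) (use mi xx in simp_all)
      have xy2: "(x \<otimes> y) \<otimes> (x \<otimes> y) = x \<otimes> x"
      proof -
        have "(x \<otimes> y) \<otimes> (x \<otimes> y) = x \<otimes> (y \<otimes> (x \<otimes> y))" using c y by (simp add: m_assoc)
        then show ?thesis using A(2) by simp
      qed
      have xy4: "4 \<le> card (generate G {x \<otimes> y})" by (rule card_four[OF xyc]) (use xy2 mi xx in simp_all)
      have B: "x \<otimes> w \<noteq> w \<otimes> x \<and> w \<otimes> (x \<otimes> w) = x \<and> x \<otimes> w \<otimes> x = w"
        by (rule mutual_inversion_of_order[OF c w _ ord]) (use sub[OF xyK(1)] wK in blast)
      have C: "y \<otimes> w \<noteq> w \<otimes> y \<and> w \<otimes> (y \<otimes> w) = y \<and> y \<otimes> w \<otimes> y = w"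
        by (rule mutual_inversion_of_order[OF y(1) w _ y4]) (use sub[OF xyK(2)] wK in blast)
      have D: "(x \<otimes> y) \<otimes> w \<noteq> w \<otimes> (x \<otimes> y)"
        using mutual_inversion_of_order[OF xyc w _ xy4] sub[OF xyK(3)] wK by blast
      have wx: "w \<otimes> x = inv x \<otimes> w" using mutual_inversion(1)[OF c w] B by blast
      have wy: "w \<otimes> y = inv y \<otimes> w" using mutual_inversion(1)[OF y(1) w] C by blast
      have "inv y \<otimes> x = x \<otimes> y" using A(2) c y by (metis m_inv_cancel(1) m_closed)
      moreover have "inv x \<otimes> inv y = inv y \<otimes> x"
      proof -
        have "inv x \<otimes> inv y = inv (y \<otimes> x)" using c y by (simp add: inv_mult_group)
        then show ?thesis unfolding mi(1) using c y by (simp add: inv_mult_group)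
      qed
      moreover have "w \<otimes> (x \<otimes> y) = (inv x \<otimes> inv y) \<otimes> w"
      proof -
        have "w \<otimes> (x \<otimes> y) = (w \<otimes> x) \<otimes> y" using c y w by (simp add: m_assoc)
        also have "\<dots> = inv x \<otimes> (w \<otimes> y)" unfolding wx using c y w by (simp add: m_assoc)
        finally show ?thesis unfolding wy using c y w by (simp add: m_assoc)
      qed
      ultimately show False using D by simp
    qed
  qed
  then have "?K = carrier G" using K.K_carrier by blast
  then show ?thesis by (rule iso_quaternion_group[OF c y(1) A xx])
qed

end

context group
begin

lemma commute_generate:
  assumes A: "A \<subseteq> carrier G" and y: "y \<in> carrier G"
    and comm: "\<And>a. a \<in> A \<Longrightarrow> y \<otimes> a = a \<otimes> y" and g: "g \<in> generate G A"
  shows "y \<otimes> g = g \<otimes> y"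
  using g
proof (induction g rule: generate.induct)
  case one
  then show ?case using y by simp
next
  case (incl h)
  then show ?case by (rule comm)
next
  case (inv h)
  then have h: "h \<in> carrier G" "y \<otimes> h = h \<otimes> y" using A comm by auto
  then have "h \<otimes> (y \<otimes> inv h) = h \<otimes> (inv h \<otimes> y)" using y by (metis inv_closed m_assoc r_inv m_inv_cancel(2) r_one)
  then show ?case by (rule l_cancel) (use h y in auto)
next
  case (eng h1 h2)
  then have h: "h1 \<in> carrier G" "h2 \<in> carrier G" using generate_in_carrier[OF A] by auto
  have "y \<otimes> (h1 \<otimes> h2) = (y \<otimes> h1) \<otimes> h2" using h y by (simp add: m_assoc)
  also have "\<dots> = h1 \<otimes> (y \<otimes> h2)" unfolding eng.IH(1) using h y by (simp add: m_assoc)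
  finally show ?case unfolding eng.IH(2) using h y by (simp add: m_assoc)
qed

end

section \<open>Elements of order two and three\<close>

context thin
begin

lemma order_three:
  assumes a: "a \<in> carrier G" "a \<noteq> \<one>" "a \<otimes> (a \<otimes> a) = \<one>"
  shows "card (generate G {a}) = 3" "a \<otimes> a \<noteq> \<one>" "inv a = a \<otimes> a"
    "\<And>g. g \<in> generate G {a} \<Longrightarrow> g = \<one> \<or> g = a \<or> g = inv a"
proof -
  interpret A: subgrp G "generate G {a}" using a by (intro generate_subgrp) auto
  have "a [^] (3::nat) = \<one>" using a by (simp add: numeral_eq_Suc m_assoc)
  then have "ord a dvd 3" using pow_eq_id[OF a(1)] by blast
  moreover have "ord a \<noteq> 1" using ord_eq_1[OF a(1)] a(2) by simp
  ultimately have "ord a = 3" using prime_nat_iff[of 3] by auto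
  then show c: "card (generate G {a}) = 3" using generate_pow_card[OF a(1)] by simp
  show aa: "a \<otimes> a \<noteq> \<one>" using a by (metis r_one)
  show ia: "inv a = a \<otimes> a" using a by (intro inv_equality) (auto simp: m_assoc)
  have "a \<noteq> inv a" "\<one> \<noteq> inv a" "\<one> \<noteq> a" using a aa by (metis r_inv, metis inv_eq_1_iff, metis)
  then have "card {\<one>, a, inv a} = 3" by simp
  moreover have "{\<one>, a, inv a} \<subseteq> generate G {a}" by (auto intro: generate.intros)
  ultimately have "{\<one>, a, inv a} = generate G {a}"
    using card_subset_eq[OF finite_single[OF a(1)]] c by metis
  then show "\<And>g. g \<in> generate G {a} \<Longrightarrow> g = \<one> \<or> g = a \<or> g = inv a" by blast
qed

lemma card_pair_three:
  assumes a: "a \<in> carrier G" "a \<noteq> \<one>" "a \<otimes> (a \<otimes> a) = \<one>"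
    and b: "b \<in> carrier G" "b \<otimes> (b \<otimes> b) = \<one>" "b \<notin> generate G {a}"
  shows "9 \<le> card (generate G {a, b})"
proof -
  interpret A: subgrp G "generate G {a}" using a by (intro generate_subgrp) auto
  have ib: "inv b = b \<otimes> b" using b by (intro inv_equality) (auto simp: m_assoc)
  have "inv b \<notin> generate G {a}" using A.K_closed(2)[of "inv b"] b by auto
  moreover have "b \<otimes> b \<in> generate G {a, b}" by (intro generate.eng generate.incl) auto
  ultimately have "3 * card (generate G {a}) \<le> card (generate G {a, b})"
    using b ib by (intro card_three_cosets[OF a(1) b(1,3)]) (auto simp: m_assoc)
  then show ?thesis using order_three(1)[OF a] by simp
qed

text \<open>A noncommuting pair generates at least 9 elements, and \<open>sparse_triple\<close>
  applies from 10 on. With 9 elements there is no room for a fourth coset of the group X of a, so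
  bab^{-1} or bab lies in X, and each value it could take is contradictory.\<close>

lemma order_three_commute:
  assumes a: "a \<in> carrier G" "a \<otimes> (a \<otimes> a) = \<one>" and b: "b \<in> carrier G" "b \<otimes> (b \<otimes> b) = \<one>"
  shows "a \<otimes> b = b \<otimes> a"
proof (rule ccontr)
  assume nc: "a \<otimes> b \<noteq> b \<otimes> a"
  note f = noncommuting_facts[OF a(1) b(1) nc]
  note oa = order_three[OF a(1) f(1) a(2)] and ob = order_three[OF b(1) f(2) b(2)]
  let ?X = "generate G {a}" and ?K = "generate G {a, b}"
  interpret X: subgrp G ?X using a by (intro generate_subgrp) auto
  interpret K: subgrp G ?K using a b by (intro generate_subgrp) auto
  have aX: "a \<in> ?X" by (auto intro: generate.incl)
  have abK: "a \<in> ?K" "b \<in> ?K" by (auto intro: generate.incl)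
  have bX: "b \<notin> ?X" using oa(4)[of b] f nc a b by auto
  have bbX: "inv b \<notin> ?X" using X.K_closed(2)[of "inv b"] bX b by auto
  note nine = card_pair_three[OF a(1) f(1) a(2) b bX]
  have DF: "\<not> (b \<otimes> (a \<otimes> b) = a \<and> a \<otimes> b \<otimes> a = b)"
  proof
    assume "b \<otimes> (a \<otimes> b) = a \<and> a \<otimes> b \<otimes> a = b"
    then have "(a \<otimes> a) \<otimes> (a \<otimes> a) = \<one>" using mutual_inversion(3)[OF a(1) b(1)] by blast
    then have "a = \<one>" using a by (simp add: m_assoc)
    then show False using f by simp
  qed
  \<comment> \<open>The elements a and ba generate the same group, which would have at most 7
    elements if ba were an involution.\<close>
  have ninv: "(b \<otimes> a) \<otimes> (b \<otimes> a) \<noteq> \<one>"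
  proof
    assume i: "(b \<otimes> a) \<otimes> (b \<otimes> a) = \<one>"
    have "card (generate G {a, b \<otimes> a}) \<le> 7"
      by (rule card_involution_pair) (use a b i f oa in simp_all)
    moreover have "?K \<subseteq> generate G {a, b \<otimes> a}"
    proof (rule generate_mono2)
      have "(b \<otimes> a) \<otimes> inv a \<in> generate G {a, b \<otimes> a}"
        by (intro generate.eng generate.incl generate.inv) auto
      then show "{a, b} \<subseteq> generate G {a, b \<otimes> a}" using a b by (auto simp: m_assoc intro: generate.incl)
    qed (use a b in auto)
    moreover have "finite (generate G {a, b \<otimes> a})" using finite_pair a b by simp
    ultimately show False using card_mono[of "generate G {a, b \<otimes> a}" ?K] nine by linarith
  qed
  have "10 \<le> card ?K"
  proof (rule ccontr)
    assume s: "\<not> 10 \<le> card ?K"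
    have four: "b \<otimes> a \<otimes> inv b \<in> ?X \<or> b \<otimes> a \<otimes> b \<in> ?X"
    proof (rule ccontr)
      assume n: "\<not> ?thesis"
      let ?g = "b \<otimes> a"
      have gX: "?g \<notin> ?X"
      proof
        assume "?g \<in> ?X"
        then have "?g \<otimes> inv a \<in> ?X" using aX X.K_closed by blast
        then show False using bX a b by (simp add: m_assoc)
      qed
      have i: "inv h \<notin> ?X" if "h \<in> carrier G" "h \<notin> ?X" for h
        using X.K_closed(2)[of "inv h"] that by auto
      have ig: "b \<otimes> inv ?g \<notin> ?X" "inv b \<otimes> inv ?g \<notin> ?X"
        using i[of "?g \<otimes> inv b"] i[of "?g \<otimes> b"] n a b by (simp_all add: inv_mult_group)
      have iib: "inv b \<otimes> inv b = b" using ob(3) b by (metis inv_inv inv_mult_group)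
      have bib: "b \<otimes> b \<notin> ?X" using bbX ob(3) by simp
      have Rne: "b \<noteq> \<one>" "inv b \<noteq> \<one>" "inv b \<noteq> b" "?g \<noteq> \<one>" "?g \<noteq> b" "?g \<noteq> inv b"
      proof -
        show "b \<noteq> \<one>" "?g \<noteq> \<one>" using f by auto
        show "inv b \<noteq> \<one>" using f b by simp
        show "inv b \<noteq> b" using ob(2) b by (metis r_inv)
        show "?g \<noteq> b" using f a b by simp
        show "?g \<noteq> inv b"
        proof
          assume "?g = inv b"
          then have "?g \<otimes> b = \<one>" using b by simp
          then show False using n X.K_closed by simp
        qed
      qed
      have "card ?X * card {\<one>, b, inv b, ?g} \<le> card ?K"
      proof (rule card_cosets[OF X.subgroup_K _ K.subgroup_K finite_pair[OF a(1) b(1)]])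
        show "?X \<subseteq> ?K" by (rule mono_generate) auto
        show "{\<one>, b, inv b, ?g} \<subseteq> ?K" using abK K.K_closed by auto
        fix p q assume "p \<in> {\<one>, b, inv b, ?g}" "q \<in> {\<one>, b, inv b, ?g}" "p \<noteq> q"
        then show "p \<otimes> inv q \<notin> ?X"
          using a b bX bbX bib gX i[of ?g] ig n iib by (elim insertE emptyE) simp_all
      qed
      moreover have "card {\<one>, b, inv b, ?g} = 4" using Rne by auto
      ultimately show False using oa(1) s by simp
    qed
    then show False
    proof
      assume m: "b \<otimes> a \<otimes> inv b \<in> ?X"
      have ba: "b \<otimes> a = (b \<otimes> a \<otimes> inv b) \<otimes> b" using a b by (simp add: m_assoc)
      from oa(4)[OF m] show False
      proof (elim disjE)
        assume "b \<otimes> a \<otimes> inv b = \<one>"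
        then show False using ba a b f by simp
      next
        assume "b \<otimes> a \<otimes> inv b = a"
        then show False using ba nc by simp
      next
        assume e: "b \<otimes> a \<otimes> inv b = inv a"
        have ba: "b \<otimes> a = inv a \<otimes> b" using ba e by simp
        have bia: "b \<otimes> inv a = a \<otimes> b"
        proof -
          have "a \<otimes> b \<otimes> a = b" using ba a b by (simp add: m_assoc)
          then show ?thesis using a b by (metis inv_solve_right m_closed)
        qed
        \<comment> \<open>If conjugation by b inverts a, so does conjugation by b^3, which is the
          identity.\<close>
        have "b \<otimes> (b \<otimes> (b \<otimes> a)) = inv a \<otimes> (b \<otimes> (b \<otimes> b))"
        proof -
          have "b \<otimes> (b \<otimes> (b \<otimes> a)) = b \<otimes> ((b \<otimes> inv a) \<otimes> b)" unfolding ba using a b by (simp add: m_assoc)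
          also have "\<dots> = (b \<otimes> a) \<otimes> (b \<otimes> b)" unfolding bia using a b by (simp add: m_assoc)
          finally show ?thesis unfolding ba using a b by (simp add: m_assoc)
        qed
        moreover have "b \<otimes> (b \<otimes> (b \<otimes> a)) = (b \<otimes> (b \<otimes> b)) \<otimes> a"
          using a(1) b(1) by (simp add: m_assoc)
        ultimately have "a = inv a" using a b by simp
        then show False using oa(2) a by (metis r_inv)
      qed
    next
      assume m: "b \<otimes> a \<otimes> b \<in> ?X"
      from oa(4)[OF m] show False
      proof (elim disjE)
        assume "b \<otimes> a \<otimes> b = \<one>"
        then show False using f a b by (simp add: m_assoc)
      next
        assume e: "b \<otimes> a \<otimes> b = a"
        have ba: "b \<otimes> a = a \<otimes> inv b" using e a b by (metis inv_solve_right m_closed)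
        have iba: "inv b \<otimes> a = a \<otimes> b" using e a b by (metis m_assoc m_closed m_inv_cancel(1))
        \<comment> \<open>The same argument with exchanged roles: now a inverts b, and hence so does
          a^3 = 1.\<close>
        have "b \<otimes> (a \<otimes> (a \<otimes> a)) = (b \<otimes> a) \<otimes> (a \<otimes> a)" using a(1) b(1) by (simp add: m_assoc)
        also have "\<dots> = a \<otimes> (inv b \<otimes> a) \<otimes> a" unfolding ba using a b by (simp add: m_assoc)
        also have "\<dots> = a \<otimes> (a \<otimes> (b \<otimes> a))" unfolding iba using a b by (simp add: m_assoc)
        also have "\<dots> = (a \<otimes> (a \<otimes> a)) \<otimes> inv b" unfolding ba using a(1) b(1) by (simp add: m_assoc)
        finally have "b = inv b" using a b by simp
        then show False using ob(2) b by (metis r_inv)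
      next
        assume e: "b \<otimes> a \<otimes> b = inv a"
        then have "(b \<otimes> a \<otimes> b) \<otimes> a = \<one>" using a by simp
        then show False using ninv a b by (simp add: m_assoc)
      qed
    qed
  qed
  then show False
    using sparse_triple[OF a(1) b(1) nc oa(2) ob(2) DF finite_pair[OF a(1) b(1)]] no_sparse by blast
qed

context
  assumes small: "\<And>x. x \<in> carrier G \<Longrightarrow> card (generate G {x}) \<le> 3"
begin

lemma exponent_cases:
  assumes x: "x \<in> carrier G" shows "x \<otimes> x = \<one> \<or> x \<otimes> (x \<otimes> x) = \<one>"
proof -
  have "\<one> \<in> generate G {x}" by (rule generate.one)
  then have "card (generate G {x}) \<noteq> 0" using finite_single[OF x] by auto
  then have "ord x = 1 \<or> ord x = 2 \<or> ord x = 3" using small[OF x] generate_pow_card[OF x] by linarith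
  then have "x [^] (1::nat) = \<one> \<or> x [^] (2::nat) = \<one> \<or> x [^] (3::nat) = \<one>"
    using pow_ord_eq_1[OF x] by metis
  then show ?thesis using x by (auto simp: numeral_eq_Suc m_assoc)
qed

text \<open>A group with at most 7 elements has room for only two cosets of the group of a, so s
  normalises it. If s commuted with a, then as would have order 6.\<close>

lemma involution_inverts:
  assumes a: "a \<in> carrier G" "a \<noteq> \<one>" "a \<otimes> (a \<otimes> a) = \<one>" and s: "s \<in> carrier G" "s \<noteq> \<one>" "s \<otimes> s = \<one>"
  shows "s \<otimes> a = inv a \<otimes> s"
proof -
  note oa = order_three[OF a]
  let ?X = "generate G {a}"
  interpret X: subgrp G ?X using a by (intro generate_subgrp) auto
  have aX: "a \<in> ?X" by (auto intro: generate.incl)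
  have sX: "s \<notin> ?X"
  proof
    assume "s \<in> ?X"
    then have "s = a \<or> s = inv a" using oa(4) s by blast
    then show False using oa(2) s a by (metis inv_inv square_eq_oneD r_inv)
  qed
  have saX: "s \<otimes> a \<notin> ?X"
  proof
    assume "s \<otimes> a \<in> ?X"
    then have "(s \<otimes> a) \<otimes> inv a \<in> ?X" using aX X.K_closed by blast
    then show False using sX a s by (simp add: m_assoc)
  qed
  have "card (generate G {a, s}) \<le> 7" by (rule card_involution_pair[OF a(1) s(1) oa(2) s(3,2)])
  moreover have "s \<otimes> a \<in> generate G {a, s}" by (intro generate.eng generate.incl) auto
  ultimately have m: "s \<otimes> a \<otimes> inv s \<in> ?X"
    using card_three_cosets[OF a(1) s(1) sX _ saX] oa(1) by linarith
  have sa: "s \<otimes> a = (s \<otimes> a \<otimes> inv s) \<otimes> s" using a s by (simp add: m_assoc)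
  from oa(4)[OF m] show ?thesis
  proof (elim disjE)
    assume "s \<otimes> a \<otimes> inv s = \<one>"
    then have "s \<otimes> a = s" using sa s by simp
    then show ?thesis using a s by simp
  next
    assume "s \<otimes> a \<otimes> inv s = a"
    then have c: "s \<otimes> a = a \<otimes> s" using sa by simp
    have sq: "(a \<otimes> s) \<otimes> (a \<otimes> s) = a \<otimes> a"
    proof -
      have "(a \<otimes> s) \<otimes> (a \<otimes> s) = a \<otimes> (s \<otimes> a) \<otimes> s" using a s by (simp add: m_assoc)
      then show ?thesis unfolding c using a s by (simp add: m_assoc)
    qed
    have "(a \<otimes> s) \<otimes> ((a \<otimes> s) \<otimes> (a \<otimes> s)) = a \<otimes> (s \<otimes> a) \<otimes> a" unfolding sq using a s by (simp add: m_assoc)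
    also have "\<dots> = a \<otimes> (a \<otimes> s) \<otimes> a" unfolding c ..
    also have "\<dots> = a \<otimes> (a \<otimes> (s \<otimes> a))" using a s by (simp add: m_assoc)
    also have "\<dots> = (a \<otimes> (a \<otimes> a)) \<otimes> s" unfolding c using a(1) s(1) by (simp add: m_assoc)
    finally have "(a \<otimes> s) \<otimes> ((a \<otimes> s) \<otimes> (a \<otimes> s)) = s" using a s by simp
    then show ?thesis using exponent_cases[of "a \<otimes> s"] sq oa(2) s a by simp
  next
    assume "s \<otimes> a \<otimes> inv s = inv a"
    then show ?thesis using sa by simp
  qed
qed

text \<open>Without involutions the group is elementary abelian, and
  \<open>sparse_three_power_three\<close> bounds its rank by 2. With an involution s, a second
  subgroup of order three produces the sparse set of \<open>sparse_dihedral\<close>; if there is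
  none, a and s generate everything.\<close>

lemma exponent_le_three_cases:
  assumes a: "a \<in> carrier G" "a \<noteq> \<one>" "a \<otimes> (a \<otimes> a) = \<one>"
  shows "generate G {a} = carrier G \<or> G \<cong> cyclic_power 3 2 \<or>
    (\<exists>s\<in>carrier G. s \<noteq> \<one> \<and> s \<otimes> s = \<one> \<and> generate G {a, s} = carrier G)"
proof (cases "\<exists>s\<in>carrier G. s \<noteq> \<one> \<and> s \<otimes> s = \<one>")
  case False
  then have cube: "g \<otimes> (g \<otimes> g) = \<one>" if "g \<in> carrier G" for g
    using exponent_cases[OF that] that by auto
  have "comm_group G"
    by (rule group_comm_groupI) (use cube order_three_commute in blast)
  moreover have "Factorial_Ring.prime (3::nat)" by simp
  moreover have "g [^] (3::nat) = \<one>" if "g \<in> carrier G" for g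
    using cube[OF that] that by (simp add: numeral_eq_Suc m_assoc)
  ultimately interpret elementary G 3 by (intro elementary.intro elementary_axioms.intro)
  have g0: "generate G {} = {\<one>}" by (rule generate_empty)
  show ?thesis
  proof (cases "generate G {a} = carrier G")
    case na: False
    have "generate G {a} \<subseteq> carrier G" using a by (intro generate_incl) auto
    then obtain b where b: "b \<in> carrier G" "b \<notin> generate G {a}" using na by blast
    have ba: "indep [b, a]" using a b by (simp add: g0)
    show ?thesis
    proof (cases "generate G {b, a} = carrier G")
      case True
      then show ?thesis using iso_cyclic_power[of "[b, a]"] ba a b by (simp add: numeral_2_eq_2)
    next
      case nb: False
      have "generate G {b, a} \<subseteq> carrier G" using a b by (intro generate_incl) auto
      then obtain c where c: "c \<in> carrier G" "c \<notin> generate G {b, a}" using nb by blast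
      have "indep [c, b, a]" "set [c, b, a] \<subseteq> carrier G" "length [c, b, a] = 3" using ba a b c by auto
      then show ?thesis using sparse_three_power_three[of "[c, b, a]"] no_sparse by blast
    qed
  qed simp
next
  case True
  then obtain s where s: "s \<in> carrier G" "s \<noteq> \<one>" "s \<otimes> s = \<one>" by blast
  note oa = order_three[OF a]
  have sa: "s \<otimes> a = inv a \<otimes> s" by (rule involution_inverts[OF a s])
  have conj: "s \<otimes> g \<otimes> inv s = inv g" if "g \<in> carrier G" "s \<otimes> g = inv g \<otimes> s" for g
    using that s by (simp add: m_assoc)
  show ?thesis
  proof (cases "\<exists>b\<in>carrier G. b \<otimes> (b \<otimes> b) = \<one> \<and> b \<notin> generate G {a}")
    case True
    then obtain b where b: "b \<in> carrier G" "b \<otimes> (b \<otimes> b) = \<one>" "b \<notin> generate G {a}" by blast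
    have "b \<noteq> \<one>" using b(3) generate.one by metis
    have sb: "s \<otimes> b = inv b \<otimes> s" by (rule involution_inverts[OF b(1) \<open>b \<noteq> \<one>\<close> b(2) s])
    have ab: "a \<otimes> b = b \<otimes> a" by (rule order_three_commute[OF a(1,3) b(1,2)])
    let ?B = "generate G {a, b}" and ?K = "generate G {a, b, s}"
    have Bc: "{a, b} \<subseteq> carrier G" using a b by auto
    interpret B: subgrp G ?B by (rule generate_subgrp[OF Bc])
    interpret K: subgrp G ?K using a b s by (intro generate_subgrp) auto
    have sB: "s \<notin> ?B"
    proof
      assume "s \<in> ?B"
      then have "a \<otimes> s = s \<otimes> a" by (rule commute_generate[OF Bc a(1), rotated]) (use ab in auto)
      then have "inv a \<otimes> s = a \<otimes> s" using sa by simp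
      then have "inv a = a" using a s by simp
      then show False using oa(2) a by (metis r_inv)
    qed
    have "finite (generate G (insert s ?B))"
    proof (rule finite_generate_insert[OF B.subgroup_K finite_pair[OF a(1) b(1)] s(1) finite_single[OF s(1)]])
      fix g assume "g \<in> ?B"
      then show "s \<otimes> g \<otimes> inv s \<in> ?B"
      proof (rule conj_generate[OF Bc s(1), rotated])
        fix h assume "h \<in> {a, b}"
        then show "s \<otimes> h \<otimes> inv s \<in> ?B"
          using conj[OF a(1) sa] conj[OF b(1) sb] by (auto intro: generate.inv)
      qed
    qed
    moreover have "?K \<subseteq> generate G (insert s ?B)"
      by (rule mono_generate) (auto intro: generate.incl)
    ultimately have fin: "finite ?K" by (rule finite_subset[rotated])
    have is1: "inv s = s" by (rule square_eq_oneD[OF s(1,3)])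
    have "card ?B * card {\<one>, s} \<le> card ?K"
    proof (rule card_cosets[OF B.subgroup_K _ K.subgroup_K fin])
      show "?B \<subseteq> ?K" by (rule mono_generate) auto
      show "{\<one>, s} \<subseteq> ?K" by (auto intro: generate.one generate.incl)
      fix g h assume "g \<in> {\<one>, s}" "h \<in> {\<one>, s}" "g \<noteq> h"
      then show "g \<otimes> inv h \<notin> ?B" using sB is1 s by auto
    qed
    moreover have "9 \<le> card ?B" by (rule card_pair_three[OF a b])
    moreover have "card {\<one>, s} = 2" using s by auto
    ultimately have "12 \<le> card ?K" by simp
    then show ?thesis
      using sparse_dihedral[OF a(1) b(1) s(1) ab a(2,3) b(2,3) s(2,3) sa sb sB fin] no_sparse by blast
  next
    case none: False
    have sub: "generate G {a} \<subseteq> generate G {a, s}" by (rule mono_generate) auto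
    have "carrier G \<subseteq> generate G {a, s}"
    proof
      fix g assume g: "g \<in> carrier G"
      show "g \<in> generate G {a, s}"
      proof (cases "g \<otimes> (g \<otimes> g) = \<one>")
        case True
        then show ?thesis using none g sub by blast
      next
        case False
        then have g2: "g \<otimes> g = \<one>" "g \<noteq> \<one>" using exponent_cases[OF g] by auto
        have ga: "g \<otimes> a = inv a \<otimes> g" by (rule involution_inverts[OF a g g2(2,1)])
        have gs: "g \<otimes> s \<in> carrier G" using g s by simp
        \<comment> \<open>Both g and s invert a, so gs centralises a, which an involution cannot
          do.\<close>
        have "(g \<otimes> s) \<otimes> ((g \<otimes> s) \<otimes> (g \<otimes> s)) = \<one>"
        proof (rule ccontr)
          assume n: "\<not> ?thesis"
          then have "(g \<otimes> s) \<otimes> (g \<otimes> s) = \<one>" "g \<otimes> s \<noteq> \<one>" using exponent_cases[OF gs] by auto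
          then have e: "(g \<otimes> s) \<otimes> a = inv a \<otimes> (g \<otimes> s)" by (intro involution_inverts[OF a gs])
          have gia: "g \<otimes> inv a = a \<otimes> g"
          proof -
            have "a \<otimes> g \<otimes> a = g" using ga a g by (simp add: m_assoc)
            then show ?thesis using a g by (metis inv_solve_right m_closed)
          qed
          have "(g \<otimes> s) \<otimes> a = (g \<otimes> inv a) \<otimes> s" using sa a g s by (simp add: m_assoc)
          then have "(g \<otimes> s) \<otimes> a = a \<otimes> (g \<otimes> s)" unfolding gia using a g s by (simp add: m_assoc)
          then have "inv a \<otimes> (g \<otimes> s) = a \<otimes> (g \<otimes> s)" using e by simp
          then have "inv a = a" using gs a by simp
          then show False using oa(2) a by (metis r_inv)
        qed
        then have "g \<otimes> s \<in> generate G {a, s}" using none gs sub by blast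
        moreover have "s \<in> generate G {a, s}" by (auto intro: generate.incl)
        ultimately have "(g \<otimes> s) \<otimes> s \<in> generate G {a, s}" by (rule generate.eng)
        then show ?thesis using g s by (simp add: m_assoc)
      qed
    qed
    moreover have "generate G {a, s} \<subseteq> carrier G" using a s by (intro generate_incl) auto
    ultimately show ?thesis using s by blast
  qed
qed

end

theorem thin_cases:
  "(\<exists>x\<in>carrier G. generate G {x} = carrier G) \<or> G \<cong> quaternion_group \<or> (\<forall>g\<in>carrier G. g \<otimes> g = \<one>) \<or>
   G \<cong> cyclic_power 3 2 \<or>
   (\<exists>a\<in>carrier G. \<exists>s\<in>carrier G. a \<otimes> a \<noteq> \<one> \<and> s \<noteq> \<one> \<and> s \<otimes> s = \<one> \<and> generate G {a, s} = carrier G)"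
proof (cases "\<exists>x\<in>carrier G. 4 \<le> card (generate G {x})")
  case True
  then show ?thesis using quaternion_of_order_four by blast
next
  case False
  then have small: "card (generate G {x}) \<le> 3" if "x \<in> carrier G" for x
  proof -
    have "\<not> 4 \<le> card (generate G {x})" using False that by blast
    then show ?thesis by linarith
  qed
  show ?thesis
  proof (cases "\<forall>g\<in>carrier G. g \<otimes> g = \<one>")
    case False
    then obtain a where a: "a \<in> carrier G" "a \<otimes> a \<noteq> \<one>" by blast
    then have "a \<noteq> \<one>" "a \<otimes> (a \<otimes> a) = \<one>" using exponent_cases[OF small a(1)] by auto
    from exponent_le_three_cases[OF small a(1) this] show ?thesis using a by blast
  qed blast
qed

end

subsection \<open>The exceptional groups\<close>

context elementary
begin

lemma comb_unit:
  "set es \<subseteq> carrier G \<Longrightarrow> i < length es \<Longrightarrow> comb es ((replicate (length es) 0)[i := 1]) = es ! i"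
proof (induction es arbitrary: i)
  case (Cons e es)
  then show ?case
  proof (cases i)
    case 0
    then show ?thesis using Cons.prems comb_zero[of es] by simp
  next
    case (Suc j)
    then have "es ! j \<in> carrier G" using Cons.prems by auto
    then show ?thesis using Suc Cons by simp
  qed
qed simp

lemma comb_eq_imp_eq:
  assumes "set es \<subseteq> carrier G" "set fs \<subseteq> carrier G" "length es = length fs"
    and eq: "\<And>v. v \<in> vecs p (length es) \<Longrightarrow> comb es v = comb fs v"
  shows "es = fs"
proof (rule nth_equalityI[OF assms(3)])
  fix i assume i: "i < length es"
  have "1 < p" using p by (rule prime_gt_1_nat)
  then have "(replicate (length es) 0)[i := 1] \<in> vecs p (length es)"
    using set_update_subset_insert[of "replicate (length es) (0::int)" i 1] by (auto simp: vecs_def)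
  then show "es ! i = fs ! i"
    using eq comb_unit[OF assms(1) i] comb_unit[OF assms(2), of i] i assms(3) by simp
qed

text \<open>The change of coordinates respects differences, so it is an automorphism of the digraph
  if \<open>S\<close> has the same pattern in both systems. The maps \<open>c\<close> and
  \<open>d\<close> are arbitrary, so that \<open>d\<close> may come from a second basis or from a
  matrix applied to the coordinates of \<open>c\<close>.\<close>

lemma coordinates_eq_of_rigid:
  assumes bij: "bij_betw c (vecs p n) (carrier G)" "bij_betw d (vecs p n) (carrier G)"
    and diff: "\<And>u v. u \<in> vecs p n \<Longrightarrow> v \<in> vecs p n \<Longrightarrow> inv (c u) \<otimes> c v = c (vsub p v u)"
      "\<And>u v. u \<in> vecs p n \<Longrightarrow> v \<in> vecs p n \<Longrightarrow> inv (d u) \<otimes> d v = d (vsub p v u)"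
    and S: "rigid (carrier G) S" "\<And>v. v \<in> vecs p n \<Longrightarrow> c v \<in> S \<longleftrightarrow> d v \<in> S" and v: "v \<in> vecs p n"
  shows "c v = d v"
proof -
  let ?V = "vecs p n"
  let ?f = "d \<circ> inv_into ?V c"
  have len: "u \<in> ?V \<Longrightarrow> length u = n" for u by (simp add: vecs_def)
  have sub: "vsub p u w \<in> ?V" if "u \<in> ?V" "w \<in> ?V" for u w
    using that by (intro vsub_vecs p_pos) (auto simp: len)
  have ic: "inv_into ?V c a \<in> ?V" "c (inv_into ?V c a) = a" if "a \<in> carrier G" for a
    using that bij(1) by (auto simp: bij_betw_def inv_into_into f_inv_into_f)
  have fc: "?f (c u) = d u" if "u \<in> ?V" for u using that bij(1) by (simp add: bij_betw_def)
  have cc: "c u \<in> carrier G" "d u \<in> carrier G" if "u \<in> ?V" for u using that bij by (auto simp: bij_betw_def)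
  have "?f \<in> aut1 (carrier G) S"
    unfolding aut1_def
  proof (intro CollectI conjI ballI)
    show "bij_betw ?f (carrier G) (carrier G)"
      by (rule bij_betw_trans[OF bij_betw_inv_into[OF bij(1)] bij(2)])
    have "\<one> = c (vsub p v v)" "\<one> = d (vsub p v v)" using diff[OF v v] cc[OF v] by auto
    then show "?f \<one> = \<one>" using fc[OF sub[OF v v]] by simp
    fix a b assume ab: "a \<in> carrier G" "b \<in> carrier G"
    let ?u = "inv_into ?V c a" and ?w = "inv_into ?V c b"
    have uw: "?u \<in> ?V" "?w \<in> ?V" using ic ab by auto
    have "inv a \<otimes> b = c (vsub p ?w ?u)" using diff(1)[OF uw] ic(2) ab by simp
    moreover have "inv (?f a) \<otimes> ?f b = d (vsub p ?w ?u)" using diff(2)[OF uw] by simp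
    ultimately show "inv (?f a) \<otimes> ?f b \<in> S \<longleftrightarrow> inv a \<otimes> b \<in> S" using S(2)[OF sub[OF uw(2,1)]] by simp
  qed
  then have "?f (c v) = c v" using S(1) cc[OF v] by (auto simp: rigid_def)
  then show ?thesis using fc[OF v] by simp
qed

lemma comb_bij:
  assumes "set es \<subseteq> carrier G" "indep es" "generate G (set es) = carrier G"
  shows "bij_betw (comb es) (vecs p (length es)) (carrier G)"
  using comb_inj[OF assms(1,2)] generate_comb[OF assms(1)] assms(3) by (simp add: bij_betw_def)

lemma comb_vsub_vecs:
  assumes "set es \<subseteq> carrier G" "u \<in> vecs p (length es)" "v \<in> vecs p (length es)"
  shows "inv (comb es u) \<otimes> comb es v = comb es (vsub p v u)"
  using comb_vsub[OF assms(1)] assms(2,3) by (simp add: vecs_def)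

definition bases :: "nat \<Rightarrow> 'a list set" where
  "bases k = {es. length es = k \<and> set es \<subseteq> carrier G \<and> indep es}"

lemma bases_Suc:
  "bases (Suc k) = (\<lambda>(es, e). e # es) ` (SIGMA es:bases k. carrier G - generate G (set es))"
  by (force simp: bases_def length_Suc_conv image_iff)

text \<open>An independent list of length k spans p^k elements, and any other element extends it.
  For |G| = p^n and k = n the product is the order of GL_n(p).\<close>

lemma card_bases:
  assumes fin: "finite (carrier G)"
  shows "finite (bases k) \<and> card (bases k) = (\<Prod>i<k. card (carrier G) - p ^ i)"
proof (induction k)
  case 0
  have "bases 0 = {[]}" by (auto simp: bases_def)
  then show ?case by simp
next
  case (Suc k)
  have c: "card (carrier G - generate G (set es)) = card (carrier G) - p ^ k" if "es \<in> bases k" for es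
  proof -
    have es: "set es \<subseteq> carrier G" "indep es" "length es = k" using that by (auto simp: bases_def)
    have sub: "generate G (set es) \<subseteq> carrier G" by (rule generate_incl[OF es(1)])
    show ?thesis using card_Diff_subset[OF finite_subset[OF sub fin] sub] card_generate_indep[OF es(1,2)] es(3) by simp
  qed
  have inj: "inj_on (\<lambda>(es, e). e # es) A" for A :: "('a list \<times> 'a) set" by (auto simp: inj_on_def)
  have "card (bases (Suc k)) = (\<Sum>es\<in>bases k. card (carrier G - generate G (set es)))"
    unfolding bases_Suc card_image[OF inj] using Suc fin by (simp add: card_SigmaI)
  also have "\<dots> = card (bases k) * (card (carrier G) - p ^ k)" using c by simp
  finally show ?case using Suc fin by (simp add: bases_Suc)
qed

lemma bases_or_generates:
  "(\<exists>es. es \<in> bases n) \<or> (\<exists>es. length es < n \<and> es \<in> bases (length es) \<and> generate G (set es) = carrier G)"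
proof (induction n)
  case 0
  have "[] \<in> bases 0" by (simp add: bases_def)
  then show ?case by blast
next
  case (Suc n)
  show ?case
  proof (cases "\<exists>es. length es < n \<and> es \<in> bases (length es) \<and> generate G (set es) = carrier G")
    case True
    then show ?thesis using less_Suc_eq by blast
  next
    case False
    then obtain es where es: "es \<in> bases n" using Suc by blast
    then have len: "length es = n" and sub: "generate G (set es) \<subseteq> carrier G"
      by (auto simp: bases_def intro!: generate_incl)
    show ?thesis
    proof (cases "generate G (set es) = carrier G")
      case True
      then show ?thesis using es len by auto
    next
      case ne: False
      then obtain e where "e \<in> carrier G - generate G (set es)" using sub by blast
      then have "e # es \<in> bases (Suc n)" using es by (auto simp: bases_def)
      then show ?thesis by blast
    qed
  qed
qed

lemma bases_generate:
  assumes "es \<in> bases n" "card (carrier G) = p ^ n"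
  shows "generate G (set es) = carrier G"
proof -
  have es: "set es \<subseteq> carrier G" "indep es" "length es = n" using assms by (auto simp: bases_def)
  have "finite (carrier G)" using assms(2) p_pos by (metis card_ge_0_finite zero_less_power)
  then show ?thesis
    using card_subset_eq[OF _ generate_incl[OF es(1)]] card_generate_indep[OF es(1,2)] es(3) assms(2) by simp
qed

text \<open>The pattern of \<open>S\<close> in the coordinates of a basis determines the basis if \<open>S\<close> is rigid,
  but there are more bases than possible patterns.\<close>

lemma not_rigid_of_count:
  assumes n: "card (carrier G) = p ^ n" and S: "S \<subseteq> carrier G" "\<one> \<notin> S"
    and count: "(p ^ n - 1) choose card S < (\<Prod>i<n. p ^ n - p ^ i)"
  shows "\<not> rigid (carrier G) S"
proof
  assume r: "rigid (carrier G) S"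
  have fin: "finite (carrier G)" using n p_pos by (metis card_ge_0_finite zero_less_power)
  let ?V = "vecs p n" and ?z = "replicate n (0::int)"
  have z: "?z \<in> ?V" using p_pos by (auto simp: vecs_def)
  define pat where "pat es = {v \<in> ?V. comb es v \<in> S}" for es
  have B: "set es \<subseteq> carrier G" "length es = n" "bij_betw (comb es) ?V (carrier G)" if "es \<in> bases n" for es
    using that comb_bij[of es] bases_generate[OF that n] by (auto simp: bases_def)
  \<comment> \<open>Patterns avoid the zero vector because the identity is not in \<open>S\<close>;
    hence p^n - 1 in the binomial coefficient.\<close>
  have "pat es \<in> {P. P \<subseteq> ?V - {?z} \<and> card P = card S}" if es: "es \<in> bases n" for es
  proof -
    have "comb es ` pat es = S" using B(3)[OF es] S(1) by (auto simp: pat_def bij_betw_def)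
    moreover have "inj_on (comb es) (pat es)"
      using B(3)[OF es] by (auto simp: pat_def bij_betw_def intro: inj_on_subset)
    ultimately have "card (pat es) = card S" by (metis card_image)
    moreover have "?z \<notin> pat es" using comb_zero[OF B(1)[OF es]] S(2) by (simp add: pat_def)
    ultimately show ?thesis by (auto simp: pat_def)
  qed
  then have sub: "pat ` bases n \<subseteq> {P. P \<subseteq> ?V - {?z} \<and> card P = card S}" by blast
  have "finite {P. P \<subseteq> ?V - {?z} \<and> card P = card S}" using finite_vecs[of p n] by simp
  then have "card (pat ` bases n) \<le> card {P. P \<subseteq> ?V - {?z} \<and> card P = card S}"
    using sub by (rule card_mono)
  also have "\<dots> = (p ^ n - 1) choose card S"
    using n_subsets[of "?V - {?z}" "card S"] finite_vecs[of p n] z by (simp add: card_vecs)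
  also note count
  also have "(\<Prod>i<n. p ^ n - p ^ i) = card (bases n)" using card_bases[OF fin, of n] n by simp
  finally have "card (pat ` bases n) < card (bases n)" .
  then have "\<not> inj_on pat (bases n)" using card_image by fastforce
  then obtain es fs where ef: "es \<in> bases n" "fs \<in> bases n" "pat es = pat fs" "es \<noteq> fs"
    by (auto simp: inj_on_def)
  have "comb es v = comb fs v" if "v \<in> ?V" for v
  proof (rule coordinates_eq_of_rigid[OF B(3)[OF ef(1)] B(3)[OF ef(2)] _ _ r _ that])
    show "inv (comb es u) \<otimes> comb es v = comb es (vsub p v u)" if "u \<in> ?V" "v \<in> ?V" for u v
      using comb_vsub_vecs[OF B(1)[OF ef(1)]] B(2)[OF ef(1)] that by simp
    show "inv (comb fs u) \<otimes> comb fs v = comb fs (vsub p v u)" if "u \<in> ?V" "v \<in> ?V" for u v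
      using comb_vsub_vecs[OF B(1)[OF ef(2)]] B(2)[OF ef(2)] that by simp
    show "comb es v \<in> S \<longleftrightarrow> comb fs v \<in> S" if "v \<in> ?V" for v using ef(3) that by (auto simp: pat_def)
  qed
  then have "es = fs"
    using comb_eq_imp_eq[OF B(1)[OF ef(1)] B(1)[OF ef(2)]] B(2)[OF ef(1)] B(2)[OF ef(2)] by simp
  then show False using ef by simp
qed

lemma not_rigid_two_power:
  assumes "p = 2" "card (carrier G) = 2 ^ n" "n \<in> {2, 3, 4}" and S: "S \<subseteq> carrier G" "\<one> \<notin> S"
  shows "\<not> rigid (carrier G) S"
proof (rule not_rigid_of_count[OF _ S])
  show "card (carrier G) = p ^ n" using assms by simp
  have max: "m choose k \<le> m choose (m div 2)" for m k :: nat by (rule binomial_maximum)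
  \<comment> \<open>The central binomial coefficients 3, 35 and 6435 are compared with 6, 168 and
    20160, the orders of GL_n(2) for n = 2, 3, 4.\<close>
  have "fact 1 * fact 2 * (3 choose 1) = (fact 3 :: nat)" "fact 3 * fact 4 * (7 choose 3) = (fact 7 :: nat)"
    "fact 7 * fact 8 * (15 choose 7) = (fact 15 :: nat)"
    using binomial_fact_lemma[of 1 3] binomial_fact_lemma[of 3 7] binomial_fact_lemma[of 7 15] by simp_all
  then have "3 choose (3 div 2) < (6::nat)" "7 choose (7 div 2) < (168::nat)" "15 choose (15 div 2) < (20160::nat)"
    by (simp_all add: fact_numeral)
  then have "3 choose card S < 6" "7 choose card S < 168" "15 choose card S < 20160"
    using le_less_trans[OF max] by blast+
  moreover have "(\<Prod>i<2. 2 ^ 2 - 2 ^ i) = (6::nat)" "(\<Prod>i<3. 2 ^ 3 - 2 ^ i) = (168::nat)"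
    "(\<Prod>i<4. 2 ^ 4 - 2 ^ i) = (20160::nat)"
  proof -
    have "{..<2::nat} = {0, 1}" "{..<3::nat} = {0, 1, 2}" "{..<4::nat} = {0, 1, 2, 3}" by auto
    then show "(\<Prod>i<2. 2 ^ 2 - 2 ^ i) = (6::nat)" "(\<Prod>i<3. 2 ^ 3 - 2 ^ i) = (168::nat)"
      "(\<Prod>i<4. 2 ^ 4 - 2 ^ i) = (20160::nat)" by simp_all
  qed
  ultimately show "(p ^ n - 1) choose card S < (\<Prod>i<n. p ^ n - p ^ i)"
    using assms(3) unfolding assms(1) by (elim insertE emptyE) simp_all
qed

end

section \<open>Explicit automorphisms for the group of order 9 and the quaternion group\<close>

definition vmat :: "int \<Rightarrow> int \<Rightarrow> int \<Rightarrow> int \<Rightarrow> int list \<Rightarrow> int list" where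
  "vmat a b c d v = [(hd v * a + hd (tl v) * c) mod 3, (hd v * b + hd (tl v) * d) mod 3]"

definition vecs32 :: "int list list" where
  "vecs32 = [[0, 0], [0, 1], [0, 2], [1, 0], [1, 1], [1, 2], [2, 0], [2, 1], [2, 2]]"

text \<open>Every subset of \<open>\<int>\<^sub>3\<^sup>2\<close> is preserved by one of the following matrices.\<close>

definition mats :: "(int \<times> int \<times> int \<times> int) list" where
  "mats = [(0,1,1,0), (1,0,0,2), (2,0,1,1), (2,1,0,1), (1,0,1,2), (0,2,2,0), (1,0,2,2), (1,1,0,2),
     (1,2,0,2), (2,0,0,1), (2,0,2,1), (2,2,0,1), (0,1,2,2), (0,2,1,2), (1,0,1,1), (1,1,0,1)]"

lemma mats_hom:
  "\<forall>(a, b, c, d)\<in>set mats. \<forall>u\<in>set vecs32. \<forall>v\<in>set vecs32.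
     vmat a b c d (vsub 3 v u) = vsub 3 (vmat a b c d v) (vmat a b c d u)"
  "\<forall>(a, b, c, d)\<in>set mats. set (map (vmat a b c d) vecs32) = set vecs32"
  "\<forall>(a, b, c, d)\<in>set mats. \<exists>v\<in>set vecs32. vmat a b c d v \<noteq> v"
  by code_simp+

lemma vecs32: "vecs 3 2 = set vecs32"
proof
  show "set vecs32 \<subseteq> vecs 3 2" by (auto simp: vecs32_def vecs_def)
  show "vecs 3 2 \<subseteq> set vecs32"
  proof
    fix v assume "v \<in> vecs 3 2"
    then obtain x y where v: "v = [x, y]" "x \<in> {0..<3}" "y \<in> {0..<3}"
      by (auto simp: vecs_def numeral_2_eq_2 length_Suc_conv)
    then have "x = 0 \<or> x = 1 \<or> x = 2" "y = 0 \<or> y = 1 \<or> y = 2" by auto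
    then show "v \<in> set vecs32" unfolding v by (auto simp: vecs32_def)
  qed
qed

text \<open>A nontrivial stabiliser contains an element of prime order, so candidates of prime order
  suffice. The list has the twelve reflections in GL_2(3) and one generator for each of its four
  subgroups of order three; all 512 subsets are tested.\<close>

lemma mats_preserve:
  "\<exists>(a, b, c, d)\<in>set mats. \<forall>v\<in>set vecs32. P v \<longleftrightarrow> P (vmat a b c d v)"
proof -
  have "\<exists>(a, b, c, d)\<in>set mats. \<forall>v\<in>set vecs32.
      v \<in> set (filter P vecs32) \<longleftrightarrow> vmat a b c d v \<in> set (filter P vecs32)"
  proof -
    have "set (filter P vecs32) \<in> Pow (set vecs32)" by auto
    then obtain L where L: "L \<in> set (subseqs vecs32)" "set (filter P vecs32) = set L"
      unfolding subseqs_powset[symmetric] by blast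
    have "\<forall>L\<in>set (subseqs vecs32). \<exists>(a, b, c, d)\<in>set mats. \<forall>v\<in>set vecs32.
      v \<in> set L \<longleftrightarrow> vmat a b c d v \<in> set L"
      by code_simp
    then show ?thesis unfolding L(2) using L(1) by blast
  qed
  then obtain a b c d where m: "(a, b, c, d) \<in> set mats"
    "\<forall>v\<in>set vecs32. v \<in> set (filter P vecs32) \<longleftrightarrow> vmat a b c d v \<in> set (filter P vecs32)" by blast
  moreover have "vmat a b c d v \<in> set vecs32" if "v \<in> set vecs32" for v
    using mats_hom(2) m(1) that by fastforce
  ultimately have "\<forall>v\<in>set vecs32. P v \<longleftrightarrow> P (vmat a b c d v)" by auto
  then show ?thesis using m(1) by blast
qed

text \<open>Counting bases would not do: GL_2(3) has order 48, but there are 56 subsets of size 3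
  and 70 of size 4 among the eight nonzero vectors.\<close>

lemma (in elementary) not_rigid_three_power_two:
  assumes "p = 3" "card (carrier G) = 3 ^ 2"
  shows "\<not> rigid (carrier G) S"
proof
  assume r: "rigid (carrier G) S"
  have fin: "finite (carrier G)" using assms(2) by (metis card_ge_0_finite zero_less_power zero_less_numeral)
  have "card (bases 2) = 48" using card_bases[OF fin, of 2] assms by (simp add: numeral_2_eq_2 lessThan_Suc)
  then obtain es where es: "es \<in> bases 2" by fastforce
  then have len: "length es = 2" and ec: "set es \<subseteq> carrier G" by (auto simp: bases_def)
  have b: "bij_betw (comb es) (vecs 3 2) (carrier G)"
    using comb_bij[of es] bases_generate[OF es] es assms by (auto simp: bases_def)
  obtain a b' c d where m: "(a, b', c, d) \<in> set mats"
    and P: "\<forall>v\<in>set vecs32. comb es v \<in> S \<longleftrightarrow> comb es (vmat a b' c d v) \<in> S"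
    using mats_preserve[of "\<lambda>v. comb es v \<in> S"] by blast
  let ?m = "vmat a b' c d"
  have im: "?m ` vecs 3 2 = vecs 3 2" using mats_hom(2) m unfolding vecs32 by fastforce
  then have "inj_on ?m (vecs 3 2)" using finite_vecs by (intro eq_card_imp_inj_on) simp_all
  then have bm: "bij_betw ?m (vecs 3 2) (vecs 3 2)" using im by (simp add: bij_betw_def)
  have d: "inv (comb es u) \<otimes> comb es v = comb es (vsub 3 v u)" if "u \<in> vecs 3 2" "v \<in> vecs 3 2" for u v
    using comb_vsub_vecs[OF ec] len assms(1) that by simp
  have mh: "?m (vsub 3 v u) = vsub 3 (?m v) (?m u)" if "u \<in> vecs 3 2" "v \<in> vecs 3 2" for u v
    using mats_hom(1) m that unfolding vecs32 by blast
  have mV: "?m v \<in> vecs 3 2" if "v \<in> vecs 3 2" for v using im that by blast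
  have "comb es v = (comb es \<circ> ?m) v" if "v \<in> vecs 3 2" for v
  proof (rule coordinates_eq_of_rigid[where n = 2, unfolded assms(1),
        OF b bij_betw_trans[OF bm b] d _ r _ that])
    fix u v assume uv: "u \<in> vecs 3 2" "v \<in> vecs 3 2"
    show "inv ((comb es \<circ> ?m) u) \<otimes> (comb es \<circ> ?m) v = (comb es \<circ> ?m) (vsub 3 v u)"
      using d[OF mV mV] mh uv by simp
  next
    fix v assume "v \<in> vecs 3 2"
    then show "comb es v \<in> S \<longleftrightarrow> (comb es \<circ> ?m) v \<in> S" using P vecs32 by simp
  qed
  then have "?m v = v" if "v \<in> vecs 3 2" for v
    using that b mV inj_onD[of "comb es" "vecs 3 2" v "?m v"] by (auto simp: bij_betw_def)
  then show False using mats_hom(3) m unfolding vecs32 by blast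
qed

text \<open>The sign-compatible extension of an assignment on i, j, k. It is defined for all
  triples, but a homomorphism only for suitable ones.\<close>

definition qaut :: "(bool \<times> quat_unit) \<Rightarrow> (bool \<times> quat_unit) \<Rightarrow> (bool \<times> quat_unit) \<Rightarrow>
    bool \<times> quat_unit \<Rightarrow> bool \<times> quat_unit" where
  "qaut A B C q = (case (case snd q of Q1 \<Rightarrow> (False, Q1) | Qi \<Rightarrow> A | Qj \<Rightarrow> B | Qk \<Rightarrow> C) of
     (r, w) \<Rightarrow> (fst q \<noteq> r, w))"

text \<open>The triples are the images of \<open>i\<close>, \<open>j\<close> and \<open>k\<close> under automorphisms of the quaternion group, and
  every subset is preserved by one of these automorphisms.\<close>

definition qauts :: "((bool \<times> quat_unit) \<times> (bool \<times> quat_unit) \<times> (bool \<times> quat_unit)) list" where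
  "qauts = [((False, Qi), (True, Qj), (True, Qk)), ((True, Qi), (False, Qj), (True, Qk)),
     ((True, Qi), (True, Qj), (False, Qk)), ((True, Qi), (False, Qk), (False, Qj)),
     ((True, Qi), (True, Qk), (True, Qj)), ((False, Qj), (False, Qi), (True, Qk)),
     ((True, Qj), (True, Qi), (True, Qk)), ((False, Qk), (True, Qj), (False, Qi)),
     ((True, Qk), (True, Qj), (True, Qi)), ((False, Qj), (False, Qk), (False, Qi)),
     ((False, Qj), (True, Qk), (True, Qi)), ((True, Qj), (False, Qk), (True, Qi)),
     ((True, Qj), (True, Qk), (False, Qi))]"

definition qunits :: "(bool \<times> quat_unit) list" where
  "qunits = [(False, Qi), (True, Qi), (False, Qj), (True, Qj), (False, Qk), (True, Qk)]"

lemma qauts_simps: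
  "\<forall>(A, B, C)\<in>set qauts. \<exists>q\<in>set qunits. qaut A B C q \<noteq> q"
  "\<forall>(A, B, C)\<in>set qauts. set (map (qaut A B C) qunits) = set qunits"
  "\<forall>L\<in>set (subseqs qunits). \<exists>(A, B, C)\<in>set qauts. \<forall>q\<in>set qunits. q \<in> set L \<longleftrightarrow> qaut A B C q \<in> set L"
  by code_simp+

lemma qaut_hom:
  assumes "(A, B, C) \<in> set qauts"
  shows "qaut A B C (q \<otimes>\<^bsub>quaternion_group\<^esub> r) = qaut A B C q \<otimes>\<^bsub>quaternion_group\<^esub> qaut A B C r"
proof -
  obtain s u t v where qr: "q = (s, u)" "r = (t, v)" by (cases q; cases r)
  show ?thesis using assms unfolding qr qauts_def set_simps
    by (elim insertE emptyE; cases u; cases v) (auto simp: quaternion_group_def qaut_def)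
qed

lemma qunits_iff: "q \<in> set qunits \<longleftrightarrow> snd q \<noteq> Q1"
  by (cases q; cases "fst q"; cases "snd q") (auto simp: qunits_def)

lemma qaut_iso:
  assumes "(A, B, C) \<in> set qauts"
  shows "qaut A B C \<in> iso quaternion_group quaternion_group"
proof -
  have U: "carrier quaternion_group = UNIV" by (simp add: quaternion_group_def)
  have fin: "finite (carrier quaternion_group)"
    using order_quaternion_group by (metis card_ge_0_finite order_def zero_less_numeral)
  have "surj (qaut A B C)"
  proof -
    have "q \<in> range (qaut A B C)" for q
    proof (cases "snd q = Q1")
      case True
      then have "qaut A B C q = q" by (cases q) (simp add: qaut_def)
      then show ?thesis by (metis rangeI)
    next
      case False
      then have "q \<in> set (map (qaut A B C) qunits)" using qauts_simps(2) assms qunits_iff by blast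
      then show ?thesis by auto
    qed
    then show ?thesis by blast
  qed
  then have "bij (qaut A B C)" using fin U finite_UNIV_surj_inj by (metis bij_def)
  then show ?thesis using qaut_hom[OF assms] by (auto simp: iso_def hom_def U)
qed

text \<open>Automorphisms fix 1 and -1, so only the 64 subsets of the other six elements matter. The
  automorphism group is the symmetric group of degree four, and the 13 entries of the list represent
  its subgroups of prime order: nine of order two and four of order three.\<close>

lemma qauts_preserve:
  "\<exists>(A, B, C)\<in>set qauts. \<forall>q. P q \<longleftrightarrow> P (qaut A B C q)"
proof -
  have "set (filter P qunits) \<in> Pow (set qunits)" by auto
  then obtain L where L: "L \<in> set (subseqs qunits)" "set (filter P qunits) = set L"
    unfolding subseqs_powset[symmetric] by blast
  then obtain A B C where m: "(A, B, C) \<in> set qauts"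
    "\<forall>q\<in>set qunits. q \<in> set (filter P qunits) \<longleftrightarrow> qaut A B C q \<in> set (filter P qunits)"
    using qauts_simps(3) unfolding L(2) by blast
  have "P q \<longleftrightarrow> P (qaut A B C q)" for q
  proof (cases "snd q = Q1")
    case True
    then show ?thesis by (cases q) (simp add: qaut_def)
  next
    case False
    then have q: "q \<in> set qunits" using qunits_iff by blast
    have "set (map (qaut A B C) qunits) = set qunits" using qauts_simps(2) m(1) by blast
    then have "qaut A B C q \<in> set qunits" using q by auto
    then show ?thesis using m(2) q by simp
  qed
  then show ?thesis using m(1) by blast
qed

context group
begin

lemma iso_eq_id_of_rigid:
  assumes r: "rigid (carrier G) S" and f: "f \<in> iso G G" and S: "\<And>g. g \<in> carrier G \<Longrightarrow> f g \<in> S \<longleftrightarrow> g \<in> S"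
    and g: "g \<in> carrier G"
  shows "f g = g"
proof -
  interpret f: group_hom G G f
    using f is_group by (simp add: group_hom_def group_hom_axioms_def iso_def)
  have "f \<in> aut1 (carrier G) S"
    using f S by (auto simp: aut1_def iso_def simp flip: f.hom_inv f.hom_mult)
  then show ?thesis using r g by (auto simp: rigid_def)
qed

lemma not_rigid_quaternion:
  assumes "G \<cong> quaternion_group" shows "\<not> rigid (carrier G) S"
proof
  assume r: "rigid (carrier G) S"
  obtain h where h: "h \<in> iso quaternion_group G"
    using assms iso_sym unfolding is_iso_def by blast
  have h': "inv_into (carrier quaternion_group) h \<in> iso G quaternion_group"
    by (rule group.iso_set_sym[OF group_quaternion_group h])
  have U: "carrier quaternion_group = UNIV" by (simp add: quaternion_group_def)
  have ih: "inv_into UNIV h (h q) = q" for q using h by (simp add: iso_def bij_betw_def U)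
  obtain A B C where m: "(A, B, C) \<in> set qauts" "\<And>q. h q \<in> S \<longleftrightarrow> h (qaut A B C q) \<in> S"
    using qauts_preserve[of "\<lambda>q. h q \<in> S"] by blast
  let ?f = "h \<circ> qaut A B C \<circ> inv_into UNIV h"
  have f: "?f \<in> iso G G"
    using iso_set_trans[OF h' iso_set_trans[OF qaut_iso[OF m(1)] h]] by (simp add: U comp_assoc)
  have hq: "\<exists>q. g = h q" if "g \<in> carrier G" for g
  proof -
    have "g \<in> h ` carrier quaternion_group" using h that by (simp add: iso_def bij_betw_def)
    then show ?thesis by blast
  qed
  have "h (qaut A B C q) = h q" for q
  proof -
    have "?f (h q) = h q"
    proof (rule iso_eq_id_of_rigid[OF r f])
      show "h q \<in> carrier G" using h by (auto simp: iso_def bij_betw_def U)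
      fix g assume "g \<in> carrier G"
      then obtain q' where "g = h q'" using hq by blast
      then show "?f g \<in> S \<longleftrightarrow> g \<in> S" using m(2)[of q'] by (simp add: ih)
    qed
    then show ?thesis by (simp add: ih)
  qed
  then have "qaut A B C q = q" for q using ih by metis
  then show False using qauts_simps(1) m(1) by blast
qed

lemma elementary_of_iso:
  assumes p: "Factorial_Ring.prime p" and iso: "G \<cong> cyclic_power p n"
  shows "elementary G p" "card (carrier G) = p ^ n"
proof -
  let ?C = "cyclic_power p n"
  have p1: "p \<noteq> 0" "p \<noteq> 1" using p by auto
  have car: "carrier ?C = (\<Pi>\<^sub>E i\<in>{..<n}. {0..<int p})"
    using p1 by (simp add: cyclic_power_def carrier_integer_mod_group)
  have gC: "group ?C" by (simp add: cyclic_power_def)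
  interpret C: group ?C by (rule gC)
  obtain h where h: "h \<in> iso G ?C" using iso unfolding is_iso_def by blast
  interpret h: group_hom G ?C h
    using h gC is_group by (simp add: group_hom_def group_hom_axioms_def iso_def)
  have inj: "inj_on h (carrier G)" using h by (simp add: iso_def bij_betw_def)
  have mult: "f \<otimes>\<^bsub>?C\<^esub> g = (\<lambda>i\<in>{..<n}. (f i + g i) mod int p)" for f g by (simp add: cyclic_power_def)
  have pw: "f [^]\<^bsub>?C\<^esub> k = (\<lambda>i\<in>{..<n}. (int k * f i) mod int p)" for f and k :: nat
  proof (induction k)
    case 0
    then show ?case by (simp add: cyclic_power_def)
  next
    case (Suc k)
    then show ?case by (auto simp: mult algebra_simps mod_simps)
  qed
  have one: "\<one>\<^bsub>?C\<^esub> = (\<lambda>i\<in>{..<n}. 0)" by (simp add: cyclic_power_def)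
  have ex: "g [^] p = \<one>" if g: "g \<in> carrier G" for g
  proof -
    have "h (g [^] p) = h g [^]\<^bsub>?C\<^esub> p" using g by (simp add: h.hom_nat_pow)
    also have "\<dots> = \<one>\<^bsub>?C\<^esub>" unfolding pw one by (rule restrict_ext) simp
    finally show ?thesis using inj g by (metis h.hom_one inj_onD nat_pow_closed one_closed)
  qed
  have "comm_group G"
  proof (rule group_comm_groupI)
    fix x y assume xy: "x \<in> carrier G" "y \<in> carrier G"
    have "h (x \<otimes> y) = h (y \<otimes> x)" using xy by (simp add: mult add.commute)
    then show "x \<otimes> y = y \<otimes> x" by (rule inj_onD[OF inj]) (use xy in auto)
  qed
  then show "elementary G p" using p ex by (intro elementary.intro elementary_axioms.intro)
  have "card (carrier G) = card (carrier ?C)" using h by (auto simp: iso_def intro: bij_betw_same_card)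
  then show "card (carrier G) = p ^ n" by (simp add: car card_PiE)
qed

theorem exceptional_not_admits_DRR:
  assumes "G \<cong> quaternion_group \<or> G \<cong> cyclic_power 2 2 \<or> G \<cong> cyclic_power 2 3 \<or>
    G \<cong> cyclic_power 2 4 \<or> G \<cong> cyclic_power 3 2"
  shows "\<not> admits_DRR G"
proof
  assume "admits_DRR G"
  then obtain S where S: "S \<subseteq> carrier G" "\<one> \<notin> S" "rigid (carrier G) S"
    by (auto simp: admits_DRR_def is_DRR_iff)
  have two: False if "G \<cong> cyclic_power 2 n" "n \<in> {2, 3, 4}" for n
    using elementary.not_rigid_two_power[OF elementary_of_iso(1)[OF _ that(1)] refl elementary_of_iso(2)[OF _ that(1)] that(2) S(1,2)] S(3)
    by simp
  from assms show False
  proof (elim disjE)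
    assume "G \<cong> cyclic_power 3 2"
    then show False
      using elementary.not_rigid_three_power_two[OF elementary_of_iso(1) refl elementary_of_iso(2)] S(3) by simp
  qed (use not_rigid_quaternion S(3) two in auto)
qed

section \<open>Finite connection sets for all other groups\<close>

lemma DRR_of_cyclic:
  assumes x: "x \<in> carrier G" "generate G {x} = carrier G"
  shows "\<exists>S. finite S \<and> is_DRR G S"
proof -
  interpret C: subgrp G "carrier G" by (rule subgrpI[OF subgroup_self])
  \<comment> \<open>For the trivial group this is the empty set, as the identity may not be a
    member.\<close>
  let ?S = "{x} - {\<one>}"
  have "generate G ?S = carrier G"
  proof (cases "x = \<one>")
    case True
    then show ?thesis using x generate_one generate_empty by simp
  qed (use x in auto)
  moreover have "rigid (carrier G) ?S"
  proof (rule C.rigidI)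
    have i: "invar (carrier G) ?S ?S" using x by (intro C.invar_gens) auto
    show "?S \<subseteq> fixd (carrier G) ?S"
    proof (cases "x = \<one>")
      case False
      then have "?S = {x}" by auto
      then show ?thesis using i C.invar_singleton by simp
    qed simp
  qed (simp add: \<open>generate G ?S = carrier G\<close>)
  ultimately have "is_DRR G ?S" using x by (auto simp: is_DRR_iff)
  then show ?thesis by (intro exI[of _ ?S]) simp
qed

text \<open>From rank 5 on there is a sparse set, and finiteness of the group stands in for
  asymmetry. Ranks 2, 3 and 4 are excluded by hypothesis, and ranks 0 and 1 are cyclic.\<close>

lemma DRR_of_exponent_two:
  assumes sq: "\<forall>g\<in>carrier G. g \<otimes> g = \<one>" and A: "finite A" "A \<subseteq> carrier G" "generate G A = carrier G"
    and exc: "\<not> G \<cong> cyclic_power 2 2" "\<not> G \<cong> cyclic_power 2 3" "\<not> G \<cong> cyclic_power 2 4"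
  shows "\<exists>S. finite S \<and> is_DRR G S"
proof -
  have "comm_group G"
  proof (rule group_comm_groupI)
    fix x y assume xy: "x \<in> carrier G" "y \<in> carrier G"
    have "inv g = g" if "g \<in> carrier G" for g using sq square_eq_oneD that by blast
    then show "x \<otimes> y = y \<otimes> x" using xy by (metis inv_mult_group m_closed)
  qed
  moreover have "g [^] (2::nat) = \<one>" if "g \<in> carrier G" for g
    using sq that by (simp add: numeral_2_eq_2)
  ultimately interpret elementary G 2 by (intro elementary.intro elementary_axioms.intro) auto
  obtain as where "set as = A" using finite_list[OF A(1)] by blast
  then have fin: "finite (carrier G)" using finite_generate_list[of as] A by simp
  from bases_or_generates[of 5] show ?thesis
  proof (elim disjE exE conjE)
    fix es assume "es \<in> bases 5"
    then have es: "length es = 5" "set es \<subseteq> carrier G" "indep es" by (auto simp: bases_def)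
    show ?thesis
      by (rule DRR_of_sparse_subgroup[OF A sparse_two_power_five[OF refl es]]) (use fin in blast)
  next
    fix es assume es: "length es < 5" "es \<in> bases (length es)" "generate G (set es) = carrier G"
    then have iso: "G \<cong> cyclic_power 2 (length es)" and c: "set es \<subseteq> carrier G"
      using iso_cyclic_power[of es] by (auto simp: bases_def)
    have "length es \<noteq> 2" "length es \<noteq> 3" "length es \<noteq> 4" using iso exc by metis+
    then have "length es = 0 \<or> length es = 1" using es(1) by linarith
    then show ?thesis
    proof
      assume "length es = 0"
      then have "generate G {\<one>} = carrier G" using es(3) generate_one generate_empty by simp
      then show ?thesis using DRR_of_cyclic by blast
    next
      assume "length es = 1"
      then obtain e where "es = [e]" by (auto simp: length_Suc_conv)
      then show ?thesis using DRR_of_cyclic[of e] es(3) c by simp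
    qed
  qed
qed

theorem admits_finite_degree_DRR:
  assumes fg: "finitely_generated G"
    and exc: "\<not> G \<cong> quaternion_group" "\<not> G \<cong> cyclic_power 2 2" "\<not> G \<cong> cyclic_power 2 3"
      "\<not> G \<cong> cyclic_power 2 4" "\<not> G \<cong> cyclic_power 3 2"
  shows "\<exists>S. finite S \<and> is_DRR G S"
proof -
  obtain A where A: "finite A" "A \<subseteq> carrier G" "generate G A = carrier G"
    using fg by (auto simp: finitely_generated_def generating_set_def)
  show ?thesis
  proof (cases "\<exists>x\<in>carrier G. \<exists>y\<in>carrier G. infinite (generate G {x, y})")
    case True
    then show ?thesis using DRR_of_infinite_pair A by blast
  next
    case fin: False
    show ?thesis
    proof (cases "\<exists>K T. sparse K T \<and> asymmetric T")
      case True
      then show ?thesis using DRR_of_sparse_subgroup[OF A] by blast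
    next
      case False
      interpret thin G by unfold_locales (use fin False in auto)
      from thin_cases exc consider (cyclic) x where "x \<in> carrier G" "generate G {x} = carrier G"
        | (two) "\<forall>g\<in>carrier G. g \<otimes> g = \<one>"
        | (pair) a s where "a \<in> carrier G" "s \<in> carrier G" "a \<otimes> a \<noteq> \<one>" "s \<noteq> \<one>" "s \<otimes> s = \<one>"
            "generate G {a, s} = carrier G"
        by blast
      then show ?thesis
      proof cases
        case cyclic
        then show ?thesis by (rule DRR_of_cyclic)
      next
        case two
        then show ?thesis by (rule DRR_of_exponent_two[OF _ A exc(2-4)])
      next
        case pair
        \<comment> \<open>This case contains the symmetric group of degree three, whose order 6 is
          too small for \<open>sparse_pair\<close>; the pair itself serves as connection
          set.\<close>
        have "\<one> \<notin> {a, s}" using pair by auto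
        then have "is_DRR G {a, s}"
          using rigid_pair[OF pair(1-3,5,4)] pair by (simp add: is_DRR_iff)
        then show ?thesis by (intro exI[of _ "{a, s}"]) simp
      qed
    qed
  qed
qed

end

theorem proposition7p1:
  fixes G :: "('a, 'b) monoid_scheme"
  assumes "group G" and "finitely_generated G"
  shows "(admits_DRR G \<longleftrightarrow> admits_finite_degree_DRR G) \<and>
    (admits_finite_degree_DRR G \<longleftrightarrow>
      \<not> G \<cong> quaternion_group \<and>
      \<not> G \<cong> cyclic_power 2 2 \<and>
      \<not> G \<cong> cyclic_power 2 3 \<and>
      \<not> G \<cong> cyclic_power 2 4 \<and>
      \<not> G \<cong> cyclic_power 3 2)"
proof -
  interpret group G by (rule assms(1))
  have "admits_finite_degree_DRR G \<Longrightarrow> admits_DRR G"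
    by (auto simp: admits_finite_degree_DRR_def admits_DRR_def)
  moreover have "\<not> admits_DRR G"
    if "G \<cong> quaternion_group \<or> G \<cong> cyclic_power 2 2 \<or> G \<cong> cyclic_power 2 3 \<or>
      G \<cong> cyclic_power 2 4 \<or> G \<cong> cyclic_power 3 2"
    by (rule exceptional_not_admits_DRR[OF that])
  moreover have "admits_finite_degree_DRR G"
    if "\<not> G \<cong> quaternion_group" "\<not> G \<cong> cyclic_power 2 2" "\<not> G \<cong> cyclic_power 2 3"
      "\<not> G \<cong> cyclic_power 2 4" "\<not> G \<cong> cyclic_power 3 2"
    using admits_finite_degree_DRR[OF assms(2) that] by (simp add: admits_finite_degree_DRR_def)
  ultimately show ?thesis by blast
qed

end
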